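(* For every integer $m\ge 2$, $$\frac{1}{1080\,m}\le c_m^\star\le q_{m-2},$$ where $(q_r)_{r\ge0}$ is defined by $$q_0=\tfrac14,\qquad q_{r+1}=q_r(1-q_r)\quad(r\ge 0).$$ Moreover, $$q_{m-2}\le\frac1{m+2},\qquad q_{m-2}=\frac{1}{m+\log m+O(1)}\quad(m\to\infty).$$ Consequently $c_m^\star=\Theta(m^{-1})$ and $C_m^{\mathrm{opt}}=\Theta(m)$.
   Context: Let $\Omega$ be a finite set with $|\Omega|=m$, and let $P$ be an irreducible Markov kernel (stochastic matrix) on $\Omega$ that is reversible with respect to its stationary law $\pi$, i.e. $\pi_xP(x,y)=\pi_yP(y,x)$. Let $1=\lambda_1>\lambda_2\ge\cdots\ge\lambda_m\ge-1$ be the eigenvalues of $P$ in $L^2(\pi)$. "Gap" always means the right spectral gap: $\operatorname{Gap}(P)=1-\lambda_2$ (one minus the second largest eigenvalue, counted with multiplicity). Let $(X_t)_{t\in\mathbb Z}$ be a stationary two-sided Markov chain with kernel $P$ and marginal law $\pi$. For a window length $n\ge1$ put $K_t=\sum_{j=0}^{n-1}e_{X_{t+j}}\in\mathbb Z_+^\Omega$, where $e_x$ is the coordinate vector indexed by $x$. Let $\mu_n$ be the law of $K_0$ and $\mathsf S_n=\operatorname{supp}(\mu_n)$. The projected count kernel $\widetilde P_n$ is the Markov kernel on $\mathsf S_n$ defined by $\mu_n(k)\widetilde P_n(k,\ell)=\mathbb P(K_0=k,K_1=\ell)$; it is reversible with respect to $\mu_n$ and irreducible on $\mathsf S_n$.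 $\operatorname{Gap}(\widetilde P_n)$ is its right spectral gap on $\mathsf S_n$; if $\mathsf S_n$ is a singleton, $\operatorname{Gap}(\widetilde P_n)=1$ by convention. Define $$c_m^\star=\inf\frac{n\operatorname{Gap}(\widetilde P_n)}{\operatorname{Gap}(P)},\qquad C_m^{\mathrm{opt}}=(c_m^\star)^{-1},$$ where the infimum is over all irreducible reversible Markov kernels $P$ on a set $\Omega$ with $|\Omega|=m$ and all integers $n\ge2$. *)

theory Defs
  imports
    "HOL-Probability.Probability"
    "HOL-Library.Function_Algebras"
    "HOL-Library.Landau_Symbols"
    "HOL-Library.Multiset"
begin

text \<open>
  A Markov kernel is a function into probability mass functions. The state space is a finite
  carrier set \<open>\<Omega>\<close>; the rows of \<open>P\<close> outside \<open>\<Omega>\<close> are irrelevant.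
\<close>

definition markov_kernel :: "'a set \<Rightarrow> ('a \<Rightarrow> 'a pmf) \<Rightarrow> bool" where
  "markov_kernel \<Omega> P \<longleftrightarrow> finite \<Omega> \<and> (\<forall>x\<in>\<Omega>. set_pmf (P x) \<subseteq> \<Omega>)"

definition irreducible_kernel :: "'a set \<Rightarrow> ('a \<Rightarrow> 'a pmf) \<Rightarrow> bool" where
  "irreducible_kernel \<Omega> P \<longleftrightarrow>
     (\<forall>x\<in>\<Omega>. \<forall>y\<in>\<Omega>. (x, y) \<in> {(a, b). a \<in> \<Omega> \<and> b \<in> \<Omega> \<and> pmf (P a) b > 0}\<^sup>*)"

definition stationary_law :: "'a set \<Rightarrow> ('a \<Rightarrow> 'a pmf) \<Rightarrow> 'a pmf \<Rightarrow> bool" where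
  "stationary_law \<Omega> P \<pi> \<longleftrightarrow> set_pmf \<pi> \<subseteq> \<Omega> \<and> bind_pmf \<pi> P = \<pi>"

definition reversible_kernel :: "'a set \<Rightarrow> ('a \<Rightarrow> 'a pmf) \<Rightarrow> 'a pmf \<Rightarrow> bool" where
  "reversible_kernel \<Omega> P \<pi> \<longleftrightarrow>
     (\<forall>x\<in>\<Omega>. \<forall>y\<in>\<Omega>. pmf \<pi> x * pmf (P x) y = pmf \<pi> y * pmf (P y) x)"

definition irreducible_reversible :: "'a set \<Rightarrow> ('a \<Rightarrow> 'a pmf) \<Rightarrow> 'a pmf \<Rightarrow> bool" where
  "irreducible_reversible \<Omega> P \<pi> \<longleftrightarrow>
     markov_kernel \<Omega> P \<and> irreducible_kernel \<Omega> P \<and> stationary_law \<Omega> P \<pi> \<and> reversible_kernel \<Omega> P \<pi>"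

text \<open>
  Functions on the finite set \<open>S\<close> are represented by functions on the whole type that vanish
  outside \<open>S\<close>. They form a real vector space under the pointwise operations.
\<close>

definition fun_scale :: "real \<Rightarrow> ('a \<Rightarrow> real) \<Rightarrow> 'a \<Rightarrow> real" where
  "fun_scale c f = (\<lambda>x. c * f x)"

interpretation fun_vs: vector_space "fun_scale :: real \<Rightarrow> ('a \<Rightarrow> real) \<Rightarrow> 'a \<Rightarrow> real"
  by unfold_locales (auto simp: fun_scale_def fun_eq_iff algebra_simps)

definition eigenspace :: "'a set \<Rightarrow> ('a \<Rightarrow> 'a \<Rightarrow> real) \<Rightarrow> real \<Rightarrow> ('a \<Rightarrow> real) set" where
  "eigenspace S A \<kappa> =
     {f. (\<forall>x. x \<notin> S \<longrightarrow> f x = 0) \<and> (\<forall>x\<in>S. (\<Sum>y\<in>S. A x y * f y) = \<kappa> * f x)}"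

definition is_eigenvalue :: "'a set \<Rightarrow> ('a \<Rightarrow> 'a \<Rightarrow> real) \<Rightarrow> real \<Rightarrow> bool" where
  "is_eigenvalue S A \<kappa> \<longleftrightarrow> (\<exists>f\<in>eigenspace S A \<kappa>. f \<noteq> (\<lambda>_. 0))"

definition eig_mult :: "'a set \<Rightarrow> ('a \<Rightarrow> 'a \<Rightarrow> real) \<Rightarrow> real \<Rightarrow> nat" where
  "eig_mult S A \<kappa> = fun_vs.dim (eigenspace S A \<kappa>)"

text \<open>
  The \<open>k\<close>-th largest eigenvalue (\<open>k \<ge> 1\<close>) counted with multiplicity: the largest eigenvalue
  \<open>\<kappa>\<close> such that the eigenvalues \<open>\<ge> \<kappa>\<close> have total multiplicity at least \<open>k\<close>. Geometric
  multiplicity is the right one here, since reversible kernels are diagonalizable over the reals.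
\<close>

definition eigval :: "'a set \<Rightarrow> ('a \<Rightarrow> 'a \<Rightarrow> real) \<Rightarrow> nat \<Rightarrow> real" where
  "eigval S A k =
     Max {\<kappa>. is_eigenvalue S A \<kappa> \<and> k \<le> (\<Sum>\<nu> | is_eigenvalue S A \<nu> \<and> \<kappa> \<le> \<nu>. eig_mult S A \<nu>)}"

text \<open>
  The right spectral gap; the value \<open>1\<close> on a singleton state space is a convention.
\<close>

definition right_gap :: "'a set \<Rightarrow> ('a \<Rightarrow> 'a \<Rightarrow> real) \<Rightarrow> real" where
  "right_gap S A = (if is_singleton S then 1 else 1 - eigval S A 2)"

text \<open>
  The law of \<open>(X\<^sub>0, \<dots>, X\<^sub>n)\<close> (a list of length \<open>n + 1\<close>) for the stationary chain. The count
  kernel depends on the two-sided chain only through this law.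
\<close>

primrec path_from :: "('a \<Rightarrow> 'a pmf) \<Rightarrow> nat \<Rightarrow> 'a \<Rightarrow> 'a list pmf" where
  "path_from P 0 x = return_pmf [x]"
| "path_from P (Suc n) x = map_pmf (\<lambda>xs. x # xs) (bind_pmf (P x) (path_from P n))"

definition chain_law :: "('a \<Rightarrow> 'a pmf) \<Rightarrow> 'a pmf \<Rightarrow> nat \<Rightarrow> 'a list pmf" where
  "chain_law P \<pi> n = bind_pmf \<pi> (path_from P n)"

text \<open>
  The window count \<open>K\<^sub>t\<close>; the multiset \<open>{#x#}\<close> plays the role of the coordinate vector \<open>e\<^sub>x\<close>.
\<close>

definition window_count :: "nat \<Rightarrow> nat \<Rightarrow> 'a list \<Rightarrow> 'a multiset" where
  "window_count n t xs = (\<Sum>j<n. {# xs ! (t + j) #})"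

definition count_law :: "('a \<Rightarrow> 'a pmf) \<Rightarrow> 'a pmf \<Rightarrow> nat \<Rightarrow> 'a multiset pmf" where
  "count_law P \<pi> n = map_pmf (window_count n 0) (chain_law P \<pi> n)"

definition count_joint_law ::
    "('a \<Rightarrow> 'a pmf) \<Rightarrow> 'a pmf \<Rightarrow> nat \<Rightarrow> ('a multiset \<times> 'a multiset) pmf" where
  "count_joint_law P \<pi> n =
     map_pmf (\<lambda>xs. (window_count n 0 xs, window_count n 1 xs)) (chain_law P \<pi> n)"

definition count_states :: "('a \<Rightarrow> 'a pmf) \<Rightarrow> 'a pmf \<Rightarrow> nat \<Rightarrow> 'a multiset set" where
  "count_states P \<pi> n = set_pmf (count_law P \<pi> n)"

definition count_kernel ::
    "('a \<Rightarrow> 'a pmf) \<Rightarrow> 'a pmf \<Rightarrow> nat \<Rightarrow> 'a multiset \<Rightarrow> 'a multiset \<Rightarrow> real" where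
  "count_kernel P \<pi> n k l = pmf (count_joint_law P \<pi> n) (k, l) / pmf (count_law P \<pi> n) k"

definition gap_ratio :: "'a set \<Rightarrow> ('a \<Rightarrow> 'a pmf) \<Rightarrow> 'a pmf \<Rightarrow> nat \<Rightarrow> real" where
  "gap_ratio \<Omega> P \<pi> n =
     real n * right_gap (count_states P \<pi> n) (count_kernel P \<pi> n) / right_gap \<Omega> (\<lambda>x y. pmf (P x) y)"

text \<open>
  The ratio is invariant under relabelling of the states, so it is no restriction to take the
  \<open>m\<close>-element state spaces among the sets of natural numbers.
\<close>

definition c_star :: "nat \<Rightarrow> real" where
  "c_star m = Inf {gap_ratio \<Omega> P \<pi> n | (\<Omega> :: nat set) P \<pi> n.
     card \<Omega> = m \<and> irreducible_reversible \<Omega> P \<pi> \<and> 2 \<le> n}"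

definition C_opt :: "nat \<Rightarrow> real" where
  "C_opt m = inverse (c_star m)"

primrec q_seq :: "nat \<Rightarrow> real" where
  "q_seq 0 = 1 / 4"
| "q_seq (Suc r) = q_seq r * (1 - q_seq r)"

end

theory Submission
  imports Defs
begin

text \<open>
  Write \<open>D = E (F K\<^sub>0 - F K\<^sub>1)\<^sup>2\<close> and \<open>g = Gap P\<close>. The lower bound is a Poincare inequality
  \<open>Var (F K\<^sub>0) \<le> C n (m / g) D\<close>. For short windows, \<open>n \<le> m / g\<close>, let \<open>h x\<close> be the conditional
  expectation of \<open>F K\<^sub>0\<close> given \<open>X\<^sub>0 = x\<close>. Reversing the path \<open>X\<^sub>0, \<dots>, X\<^sub>n\<close> turns \<open>\<langle>h, (1 - P) h\<rangle>\<close> into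
  half the expectation of \<open>(h X\<^sub>0 - h X\<^sub>n) (F K\<^sub>0 - F K\<^sub>1)\<close>, which gives \<open>\<langle>h, (1 - P) h\<rangle> \<le> n D / 2\<close>, and
  two adjacent windows differ by at most \<open>n\<^sup>2 D\<close> in mean square. For long windows fix a state \<open>z\<close>.
  The excursions from \<open>z\<close> are independent, and \<open>F\<close> does not see their order, so in a martingale
  decomposition along the visits to \<open>z\<close> each excursion may be moved to the front of the window,
  where removing it amounts to shifting the window. A Hardy inequality, with the expected hitting
  time of \<open>z\<close> as potential, bounds each increment by \<open>D\<close>-type terms; the number of visits enters
  only through its sum over \<open>z\<close>, which is at most \<open>n\<close>. All states of mass at least \<open>1 / (2 m)\<close>
  have hitting times at most \<open>3 m / g\<close>, and together they have mass at least \<open>1 / 2\<close>.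

  For the upper bound take a walk on \<open>0, \<dots>, M\<close> with \<open>M = m - 1\<close>, downward rate \<open>\<delta>\<close> and a rare
  upward rate \<open>\<epsilon>\<close>, and the test function \<open>\<Prod>x. b\<^sub>x ^ k\<^sub>x\<close> restricted to the counts with \<open>k\<^sub>M > 0\<close>. As
  \<open>\<epsilon> \<rightarrow> 0\<close> only the paths climbing to \<open>M\<close> once matter; then as \<open>n \<rightarrow> \<infinity>\<close> the ratio becomes a sum over
  the levels, and as \<open>\<delta> \<rightarrow> 0\<close> it satisfies \<open>q\<^bsub>r+1\<^esub> = \<theta>\<^sup>2 + (1 - 2 \<theta>) q\<^sub>r\<close>, whose minimum over \<open>\<theta>\<close> is
  \<open>q\<^sub>r (1 - q\<^sub>r)\<close>.
\<close>

subsection \<open>Spectral gaps of reversible kernels\<close>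

text \<open>Telescoping between disjoint windows costs \<open>n\<^sup>2\<close>, affordable only for
  \<open>n \<le> m / g\<close>; a longer window holds many excursions, and each may be charged only
  for its own steps. The estimate obtained from a state \<open>z\<close> carries
  \<open>\<pi> z\<close> on the left and the number of visits to \<open>z\<close> on the right.
  Bounding the visits by \<open>n\<close> for each \<open>z\<close> separately would lose a second
  factor \<open>m\<close>; summed over \<open>z\<close> first, the masses still reach
  \<open>1 / 2\<close> and the visits together stay below \<open>n\<close>. The factor
  \<open>m\<close> that remains comes from the hitting times.

  In the upper bound the order of the limits matters. For fixed \<open>n\<close> everything is
  polynomial in \<open>\<epsilon>\<close>. At \<open>\<epsilon> = 0\<close> a path climbs and then
  descends, so the recursions in \<open>n\<close> are triangular in the level, and each level is a
  scalar affine recursion. The value \<open>q\<^sub>0 = 1 / 4\<close> is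
  \<open>\<theta>\<^sup>2\<close> at the critical exponent \<open>\<theta> = 1 / 2\<close>, where
  the factor \<open>1 - 2 * \<theta>\<close> vanishes.\<close>

lemma compact_box:
  assumes that: "\<And>x. compact (B x)"
  shows "compact {f :: 'a \<Rightarrow> real. \<forall>x. f x \<in> B x}"
proof -
  have "{f :: 'a \<Rightarrow> real. \<forall>x. f x \<in> B x} = PiE UNIV B" by (auto simp: PiE_def Pi_def)
  moreover have "compactin (product_topology (\<lambda>_. euclidean) UNIV) (PiE UNIV B)"
    using that by (auto simp: compactin_PiE)
  ultimately show ?thesis by (simp add: euclidean_product_topology)
qed

lemma continuous_on_coord: "continuous_on A (\<lambda>f :: 'a \<Rightarrow> real. f x)"
  by (rule continuous_on_subset[OF continuous_on_product_coordinates]) auto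

text \<open>First-order condition at a minimum: a nonzero linear term would dominate for small
  \<open>t\<close>. It is applied to variations of an energy minimizer.\<close>

lemma quadratic_nonneg_linear_zero:
  assumes "\<And>t :: real. 0 \<le> 2 * t * b + t\<^sup>2 * a"
  shows "b = 0"
proof (rule ccontr)
  assume b: "b \<noteq> 0"
  have a: "0 \<le> a + 2 * b" "0 \<le> a - 2 * b" using assms[of 1] assms[of "-1"] by auto
  \<comment> \<open>Close to the minimizer \<open>- b / a\<close>; the two bounds give
    \<open>a \<ge> 0\<close>, so the shift by 1 keeps the denominator positive.\<close>
  define t where "t = - b / (1 + a)"
  have a1: "1 + a > 0" using a by linarith
  have "b = - t * (1 + a)" unfolding t_def using a1 by simp
  then have "2 * t * b + t\<^sup>2 * a = 2 * t * (- t * (1 + a)) + t\<^sup>2 * a" by (rule arg_cong)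
  then have "2 * t * b + t\<^sup>2 * a = - (t\<^sup>2 * (2 + a))"
    by (simp add: power2_eq_square algebra_simps)
  moreover have "t \<noteq> 0" using b a1 by (simp add: t_def)
  then have "0 < t\<^sup>2 * (2 + a)" using a1 by (intro mult_pos_pos) auto
  ultimately show False using assms[of t] by simp
qed

text \<open>Based on a symmetric edge measure instead of a kernel, so that the chain
  (\<open>J x y = \<pi> x * p x y\<close>) and the count kernel (\<open>J\<close> the joint law of
  two consecutive counts) are both instances.\<close>

locale rev_form =
  fixes S :: "'a set" and J :: "'a \<Rightarrow> 'a \<Rightarrow> real" and \<mu> :: "'a \<Rightarrow> real"
  assumes fin: "finite S" and ne: "S \<noteq> {}"
    and J_nonneg: "\<And>x y. x \<in> S \<Longrightarrow> y \<in> S \<Longrightarrow> 0 \<le> J x y"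
    and J_sym: "\<And>x y. x \<in> S \<Longrightarrow> y \<in> S \<Longrightarrow> J x y = J y x"
    and J_row: "\<And>x. x \<in> S \<Longrightarrow> (\<Sum>y\<in>S. J x y) = \<mu> x"
    and mu_pos: "\<And>x. x \<in> S \<Longrightarrow> 0 < \<mu> x"
    and mu_sum: "(\<Sum>x\<in>S. \<mu> x) = 1"
begin

definition kern :: "'a \<Rightarrow> 'a \<Rightarrow> real" where
  "kern x y = J x y / \<mu> x"

definition mean :: "('a \<Rightarrow> real) \<Rightarrow> real" where
  "mean f = (\<Sum>x\<in>S. \<mu> x * f x)"

definition ip :: "('a \<Rightarrow> real) \<Rightarrow> ('a \<Rightarrow> real) \<Rightarrow> real" where
  "ip f g = (\<Sum>x\<in>S. \<mu> x * f x * g x)"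

definition energy :: "('a \<Rightarrow> real) \<Rightarrow> ('a \<Rightarrow> real) \<Rightarrow> real" where
  "energy f g = ip f g - (\<Sum>x\<in>S. \<Sum>y\<in>S. J x y * f x * g y)"

definition vari :: "('a \<Rightarrow> real) \<Rightarrow> real" where
  "vari f = ip f f - (mean f)\<^sup>2"

lemma energy_eq: "energy f f = (\<Sum>x\<in>S. \<Sum>y\<in>S. J x y * (f x - f y)\<^sup>2) / 2"
proof -
  have 1: "(\<Sum>x\<in>S. \<Sum>y\<in>S. J x y * (f x)\<^sup>2) = ip f f"
    by (simp add: ip_def sum_distrib_right[symmetric] J_row power2_eq_square mult.assoc)
  have 2: "(\<Sum>x\<in>S. \<Sum>y\<in>S. J x y * (f y)\<^sup>2) = ip f f"
    using 1 by (subst sum.swap) (simp add: J_sym cong: sum.cong)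
  have "(\<Sum>x\<in>S. \<Sum>y\<in>S. J x y * (f x - f y)\<^sup>2) =
    (\<Sum>x\<in>S. \<Sum>y\<in>S. J x y * (f x)\<^sup>2) + (\<Sum>x\<in>S. \<Sum>y\<in>S. J x y * (f y)\<^sup>2)
      - 2 * (\<Sum>x\<in>S. \<Sum>y\<in>S. J x y * f x * f y)"
    by (simp add: power2_diff algebra_simps sum.distrib sum_subtractf sum_distrib_left)
  then show ?thesis using 1 2 by (simp add: energy_def)
qed

lemma energy_nonneg: "0 \<le> energy f f"
  unfolding energy_eq by (intro divide_nonneg_nonneg sum_nonneg mult_nonneg_nonneg J_nonneg) auto

lemma ip_pos: assumes "x \<in> S" "f x \<noteq> 0" shows "0 < ip f f"
  unfolding ip_def
proof (rule sum_pos2[OF fin assms(1)])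
  have "0 < f x * f x" using assms(2) by (metis not_real_square_gt_zero)
  then show "0 < \<mu> x * f x * f x" using mu_pos[OF assms(1)] by (simp add: mult.assoc)
next
  fix i assume "i \<in> S"
  then show "0 \<le> \<mu> i * f i * f i" using mu_pos[of i] by (simp add: mult.assoc)
qed

lemma ip_nonneg: "0 \<le> ip f f"
  unfolding ip_def
  by (rule sum_nonneg) (use mu_pos in \<open>simp add: mult.assoc less_imp_le\<close>)

lemma ip_mean_shift: "ip (\<lambda>x. f x - mean f) (\<lambda>x. f x - mean f) = vari f"
proof -
  have "ip (\<lambda>x. f x - mean f) (\<lambda>x. f x - mean f) =
    (\<Sum>x\<in>S. \<mu> x * f x * f x - 2 * mean f * (\<mu> x * f x) + (mean f)\<^sup>2 * \<mu> x)"
    unfolding ip_def by (rule sum.cong) (auto simp: algebra_simps power2_eq_square)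
  also have "\<dots> = ip f f - 2 * mean f * mean f + (mean f)\<^sup>2 * 1"
    by (simp add: sum.distrib sum_subtractf sum_distrib_left[symmetric] ip_def mean_def mu_sum)
  finally show ?thesis by (simp add: vari_def power2_eq_square)
qed

lemma vari_nonneg: "0 \<le> vari f"
  using ip_nonneg[of "\<lambda>x. f x - mean f"] by (simp add: ip_mean_shift)

lemma vari_le: "vari f \<le> ip (\<lambda>x. f x - c) (\<lambda>x. f x - c)"
proof -
  have "ip (\<lambda>x. f x - c) (\<lambda>x. f x - c) =
    (\<Sum>x\<in>S. \<mu> x * f x * f x - 2 * c * (\<mu> x * f x) + c\<^sup>2 * \<mu> x)"
    unfolding ip_def by (rule sum.cong) (auto simp: algebra_simps power2_eq_square)
  also have "\<dots> = ip f f - 2 * c * mean f + c\<^sup>2"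
    by (simp add: sum.distrib sum_subtractf sum_distrib_left[symmetric] ip_def mean_def mu_sum)
  also have "\<dots> = vari f + (mean f - c)\<^sup>2"
    by (simp add: vari_def power2_eq_square algebra_simps)
  finally show ?thesis by simp
qed

lemma eigen_weak:
  assumes "f \<in> eigenspace S kern \<kappa>"
  shows "energy g f = (1 - \<kappa>) * ip g f"
proof -
  have "(\<Sum>y\<in>S. J x y * g x * f y) = \<kappa> * (\<mu> x * g x * f x)" if x: "x \<in> S" for x
  proof -
    have "(\<Sum>y\<in>S. J x y * g x * f y) = g x * \<mu> x * (\<Sum>y\<in>S. kern x y * f y)"
      unfolding kern_def sum_distrib_left
      by (rule sum.cong) (use mu_pos[OF x] in \<open>auto simp: field_simps\<close>)
    also have "\<dots> = g x * \<mu> x * (\<kappa> * f x)"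
      using assms x by (simp add: eigenspace_def)
    finally show ?thesis by (simp add: algebra_simps)
  qed
  then have "(\<Sum>x\<in>S. \<Sum>y\<in>S. J x y * g x * f y) = \<kappa> * ip g f"
    by (simp add: ip_def sum_distrib_left)
  then show ?thesis by (simp add: energy_def algebra_simps)
qed

lemma ip_sym: "ip f g = ip g f"
  by (simp add: ip_def mult_ac)

lemma energy_sym: "energy f g = energy g f"
proof -
  have "(\<Sum>x\<in>S. \<Sum>y\<in>S. J x y * f x * g y) = (\<Sum>x\<in>S. \<Sum>y\<in>S. J x y * g x * f y)"
    by (subst sum.swap) (intro sum.cong refl, simp add: J_sym mult_ac)
  then show ?thesis by (simp add: energy_def ip_sym)
qed

lemma eigen_orth:
  assumes "f \<in> eigenspace S kern \<kappa>" "g \<in> eigenspace S kern \<nu>" "\<kappa> \<noteq> \<nu>"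
  shows "ip f g = 0"
  using eigen_weak[OF assms(1), of g] eigen_weak[OF assms(2), of f] assms(3)
  by (simp add: energy_sym[of g f] ip_sym[of g f])

text \<open>Testing against the indicator of one state recovers the eigenvalue equation there, as
  \<open>\<mu> x > 0\<close>.\<close>

lemma weak_eigen:
  assumes out: "\<And>x. x \<notin> S \<Longrightarrow> f x = 0" and w: "\<And>g. energy g f = (1 - \<kappa>) * ip g f"
  shows "f \<in> eigenspace S kern \<kappa>"
proof -
  have "(\<Sum>y\<in>S. kern x y * f y) = \<kappa> * f x" if x: "x \<in> S" for x
  proof -
    let ?g = "\<lambda>z. if z = x then 1 else 0 :: real"
    have 1: "ip ?g f = \<mu> x * f x"
      using x fin by (simp add: ip_def if_distrib if_distribR cong: if_cong)
    have 2: "(\<Sum>z\<in>S. \<Sum>y\<in>S. J z y * ?g z * f y) = (\<Sum>y\<in>S. J x y * f y)"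
    proof -
      have "(\<Sum>z\<in>S. \<Sum>y\<in>S. J z y * ?g z * f y) = (\<Sum>z\<in>S. if z = x then \<Sum>y\<in>S. J x y * f y else 0)"
        by (rule sum.cong) auto
      then show ?thesis using x fin by simp
    qed
    have "(\<Sum>y\<in>S. J x y * f y) = \<kappa> * (\<mu> x * f x)"
      using w[of ?g] unfolding energy_def 1 2 by (simp add: algebra_simps)
    moreover have "(\<Sum>y\<in>S. kern x y * f y) = (\<Sum>y\<in>S. J x y * f y) / \<mu> x"
      by (simp add: kern_def sum_divide_distrib)
    ultimately show ?thesis using mu_pos[OF x] by simp
  qed
  then show ?thesis using out by (simp add: eigenspace_def)
qed

lemma const_eigen: "(\<lambda>x. if x \<in> S then 1 else 0) \<in> eigenspace S kern 1"
proof -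
  have "(\<Sum>y\<in>S. kern x y * (if y \<in> S then 1 else 0)) = 1" if "x \<in> S" for x
  proof -
    have "(\<Sum>y\<in>S. kern x y * (if y \<in> S then 1 else 0)) = (\<Sum>y\<in>S. J x y) / \<mu> x"
      by (simp add: kern_def sum_divide_distrib)
    then show ?thesis using that mu_pos[OF that] by (simp add: J_row)
  qed
  then show ?thesis by (simp add: eigenspace_def)
qed

lemma eigenvalue_le_1:
  assumes "is_eigenvalue S kern \<kappa>"
  shows "\<kappa> \<le> 1"
proof -
  obtain f where f: "f \<in> eigenspace S kern \<kappa>" "f \<noteq> (\<lambda>_. 0)"
    using assms by (auto simp: is_eigenvalue_def)
  obtain x where "f x \<noteq> 0" using f(2) by auto
  then have "x \<in> S" using f(1) by (auto simp: eigenspace_def)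
  with \<open>f x \<noteq> 0\<close> have "0 < ip f f" by (rule ip_pos[rotated])
  moreover have "0 \<le> (1 - \<kappa>) * ip f f" using energy_nonneg[of f] eigen_weak[OF f(1)] by simp
  ultimately show ?thesis by (simp add: zero_le_mult_iff)
qed

section \<open>Orthogonal families and multiplicities\<close>

definition delta :: "'a \<Rightarrow> 'a \<Rightarrow> real" where
  "delta x = (\<lambda>y. if y = x then 1 else 0)"

lemma supported_in_span:
  assumes "\<And>x. x \<notin> S \<Longrightarrow> f x = 0"
  shows "f \<in> fun_vs.span (delta ` S)"
proof -
  have "f = (\<Sum>x\<in>S. fun_scale (f x) (delta x))"
  proof
    fix y
    have "(\<Sum>x\<in>S. fun_scale (f x) (delta x)) y = (\<Sum>x\<in>S. f x * delta x y)"
    proof -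
      have "(\<Sum>x\<in>T. fun_scale (f x) (delta x)) y = (\<Sum>x\<in>T. f x * delta x y)" if "finite T" for T
        using that by (induction T) (auto simp: fun_scale_def)
      then show ?thesis using fin by blast
    qed
    also have "\<dots> = f y" using assms[of y] fin by (auto simp: delta_def if_distrib cong: if_cong)
    finally show "f y = (\<Sum>x\<in>S. fun_scale (f x) (delta x)) y" by simp
  qed
  also have "\<dots> \<in> fun_vs.span (delta ` S)"
    by (intro fun_vs.span_sum fun_vs.span_scale fun_vs.span_base) auto
  finally show ?thesis .
qed

lemma ip_sum_right: "finite T \<Longrightarrow> ip f (\<Sum>v\<in>T. fun_scale (c v) v) = (\<Sum>v\<in>T. c v * ip f v)"
proof (induction T rule: finite_induct)
  case empty then show ?case by (simp add: ip_def)
next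
  case (insert v T)
  have "ip f (fun_scale (c v) v + g) = c v * ip f v + ip f g" for g
    by (simp add: ip_def fun_scale_def algebra_simps sum.distrib sum_distrib_left)
  then have "ip f (fun_scale (c v) v + (\<Sum>v\<in>T. fun_scale (c v) v)) = c v * ip f v
      + ip f (\<Sum>v\<in>T. fun_scale (c v) v)" .
  then show ?case using insert(3) by (simp only: sum.insert[OF insert(1,2)])
qed

lemma orth_independent:
  assumes "finite T" and nz: "\<And>v. v \<in> T \<Longrightarrow> 0 < ip v v"
    and orth: "\<And>v w. v \<in> T \<Longrightarrow> w \<in> T \<Longrightarrow> v \<noteq> w \<Longrightarrow> ip v w = 0"
  shows "fun_vs.independent T"
proof (rule fun_vs.independent_if_scalars_zero[OF assms(1)])
  fix c v assume s: "(\<Sum>x\<in>T. fun_scale (c x) x) = 0" and v: "v \<in> T"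
  have "0 = ip v (\<Sum>x\<in>T. fun_scale (c x) x)" unfolding s by (simp add: ip_def)
  also have "\<dots> = (\<Sum>x\<in>T. c x * ip v x)" by (rule ip_sum_right[OF assms(1)])
  also have "\<dots> = (\<Sum>x\<in>T. if x = v then c v * ip v v else 0)"
    by (rule sum.cong) (use orth v in auto)
  also have "\<dots> = c v * ip v v" using v assms(1) by simp
  finally show "c v = 0" using nz[OF v] by simp
qed

text \<open>Orthogonal functions of positive norm are independent, so both bounds are Steinitz
  exchange. All functions vanishing off \<open>S\<close> lie in the span of the point masses, which
  also makes the basis of \<open>V\<close> finite, so that its cardinality carries
  information.\<close>

lemma orth_card_le:
  assumes "finite T" and nz: "\<And>v. v \<in> T \<Longrightarrow> 0 < ip v v"
    and orth: "\<And>v w. v \<in> T \<Longrightarrow> w \<in> T \<Longrightarrow> v \<noteq> w \<Longrightarrow> ip v w = 0"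
    and sub: "T \<subseteq> V" and V: "\<And>v x. v \<in> V \<Longrightarrow> x \<notin> S \<Longrightarrow> v x = 0"
  shows "card T \<le> fun_vs.dim V" "card T \<le> card S"
proof -
  have ind: "fun_vs.independent T" by (rule orth_independent) fact+
  obtain B where B: "B \<subseteq> V" "fun_vs.independent B" "V \<subseteq> fun_vs.span B" "card B = fun_vs.dim V"
    using fun_vs.basis_exists[of V] by blast
  have "B \<subseteq> fun_vs.span (delta ` S)" using B(1) V supported_in_span by blast
  then have "finite B" using fun_vs.independent_span_bound[of "delta ` S" B] fin B(2) by auto
  then show "card T \<le> fun_vs.dim V"
    using fun_vs.independent_span_bound[of B T] ind sub B(3,4) by auto
  have "T \<subseteq> fun_vs.span (delta ` S)" using sub V supported_in_span by blast
  then have "card T \<le> card (delta ` S)" using fun_vs.independent_span_bound[of "delta ` S" T] fin ind by auto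
  also have "\<dots> \<le> card S" by (rule card_image_le[OF fin])
  finally show "card T \<le> card S" .
qed

lemma eigenvector_ip_pos:
  assumes "f \<in> eigenspace S kern \<kappa>" "f \<noteq> (\<lambda>_. 0)"
  shows "0 < ip f f"
proof -
  obtain x where "f x \<noteq> 0" using assms(2) by auto
  then have "x \<in> S" using assms(1) by (auto simp: eigenspace_def)
  with \<open>f x \<noteq> 0\<close> show ?thesis by (rule ip_pos[rotated])
qed

text \<open>Needed because \<open>eigval\<close> is a \<open>Max\<close>. Eigenvectors for distinct
  eigenvalues are orthogonal, so there are at most \<open>card S\<close> of them.\<close>

lemma finite_eigenvalues: "finite {\<kappa>. is_eigenvalue S kern \<kappa>}"
proof (rule ccontr)
  assume "infinite {\<kappa>. is_eigenvalue S kern \<kappa>}"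
  then obtain U where U: "finite U" "card U = card S + 1" "U \<subseteq> {\<kappa>. is_eigenvalue S kern \<kappa>}"
    by (meson infinite_arbitrarily_large)
  then have "\<forall>\<kappa>\<in>U. \<exists>f. f \<in> eigenspace S kern \<kappa> \<and> f \<noteq> (\<lambda>_. 0)" by (auto simp: is_eigenvalue_def)
  then obtain v where v: "\<And>\<kappa>. \<kappa> \<in> U \<Longrightarrow> v \<kappa> \<in> eigenspace S kern \<kappa> \<and> v \<kappa> \<noteq> (\<lambda>_. 0)" by metis
  have inj: "inj_on v U"
  proof (rule inj_onI, rule ccontr)
    fix a b assume ab: "a \<in> U" "b \<in> U" "v a = v b" "a \<noteq> b"
    then have "ip (v a) (v b) = 0" using eigen_orth[of "v a" a "v b" b] v by blast
    then have "ip (v a) (v a) = 0" using ab(3) by simp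
    then show False using eigenvector_ip_pos[of "v a" a] v[OF ab(1)] by auto
  qed
  have "card (v ` U) \<le> card S"
  proof (rule orth_card_le(2)[where V = "v ` U"])
    show "finite (v ` U)" using U(1) by simp
    show "0 < ip w w" if "w \<in> v ` U" for w using that v eigenvector_ip_pos by auto
    show "ip w w' = 0" if "w \<in> v ` U" "w' \<in> v ` U" "w \<noteq> w'" for w w'
      using that v eigen_orth by blast
    show "w x = 0" if "w \<in> v ` U" "x \<notin> S" for w x using that v by (auto simp: eigenspace_def)
  qed simp
  then show False using U(2) card_image[OF inj] by simp
qed

lemma eigenspace_dim:
  assumes "finite T" "T \<subseteq> eigenspace S kern \<kappa>" "\<And>v. v \<in> T \<Longrightarrow> 0 < ip v v"
    and "\<And>v w. v \<in> T \<Longrightarrow> w \<in> T \<Longrightarrow> v \<noteq> w \<Longrightarrow> ip v w = 0"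
  shows "card T \<le> eig_mult S kern \<kappa>"
  unfolding eig_mult_def
  by (rule orth_card_le(1)) (use assms in \<open>auto simp: eigenspace_def\<close>)

text \<open>Rayleigh quotient: the energy attains its minimum on the compact sphere of centred unit
  functions, and scaling makes this minimum a Poincare constant.\<close>

lemma minimizer:
  assumes "2 \<le> card S"
  obtains f c where "\<And>x. x \<notin> S \<Longrightarrow> f x = 0" "mean f = 0" "ip f f = 1" "energy f f = c"
    "\<And>g. c * vari g \<le> energy g g"
proof -
  define K where "K = {f. (\<forall>x. x \<notin> S \<longrightarrow> f x = 0) \<and> mean f = 0 \<and> ip f f = 1}"
  \<comment> \<open>A unit function has \<open>(f x)\<^sup>2 \<le> 1 / \<mu> x \<le> M\<close>; the
    summand 1 gives \<open>M \<le> M\<^sup>2\<close>, so that \<open>M\<close> itself bounds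
    \<open>f\<close>.\<close>
  define M where "M = 1 + (\<Sum>x\<in>S. 1 / \<mu> x)"
  define Bx where "Bx = {f :: 'a \<Rightarrow> real. \<forall>x. f x \<in> (if x \<in> S then {-M..M} else {0})}"
  have cB: "compact Bx" unfolding Bx_def by (rule compact_box) auto
  have M1: "1 \<le> M" unfolding M_def using mu_pos by (simp add: sum_nonneg less_imp_le)
  have KB: "K \<subseteq> Bx"
  proof
    fix f assume f: "f \<in> K"
    have "\<bar>f x\<bar> \<le> M" if x: "x \<in> S" for x
    proof -
      have "\<mu> x * f x * f x \<le> ip f f" unfolding ip_def
        by (rule member_le_sum[OF x _ fin]) (use mu_pos in \<open>auto simp: mult.assoc less_imp_le\<close>)
      then have "(f x)\<^sup>2 \<le> 1 / \<mu> x" using f mu_pos[OF x] by (simp add: K_def field_simps power2_eq_square)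
      also have "\<dots> \<le> (\<Sum>x\<in>S. 1 / \<mu> x)"
        by (rule member_le_sum[OF x _ fin]) (use mu_pos in \<open>auto simp: less_imp_le\<close>)
      also have "\<dots> \<le> M" by (simp add: M_def)
      also have "\<dots> \<le> M\<^sup>2" using M1 by (simp add: power2_eq_square)
      finally show ?thesis using M1 by (simp add: abs_le_square_iff[symmetric])
    qed
    then show "f \<in> Bx" using f by (force simp: Bx_def K_def abs_le_iff)
  qed
  have cont_mean: "continuous_on UNIV mean" unfolding mean_def
    by (intro continuous_intros continuous_on_coord)
  have cont_ip: "continuous_on UNIV (\<lambda>f. ip f f)" unfolding ip_def
    by (intro continuous_intros continuous_on_coord)
  have cont_en: "continuous_on UNIV (\<lambda>f. energy f f)" unfolding energy_def ip_def
    by (intro continuous_intros continuous_on_coord)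
  have "K = Bx \<inter> (mean -` {0}) \<inter> ((\<lambda>f. ip f f) -` {1})"
  proof
    show "K \<subseteq> Bx \<inter> (mean -` {0}) \<inter> ((\<lambda>f. ip f f) -` {1})"
      using KB by (auto simp: K_def)
    show "Bx \<inter> (mean -` {0}) \<inter> ((\<lambda>f. ip f f) -` {1}) \<subseteq> K"
    proof
      fix f assume f: "f \<in> Bx \<inter> (mean -` {0}) \<inter> ((\<lambda>f. ip f f) -` {1})"
      have "f x = 0" if "x \<notin> S" for x
      proof -
        have "f x \<in> (if x \<in> S then {-M..M} else {0})" using f by (simp add: Bx_def)
        then show ?thesis using that by simp
      qed
      then show "f \<in> K" using f by (simp add: K_def)
    qed
  qed
  moreover have "closed (mean -` {0})" "closed ((\<lambda>f. ip f f) -` {1})"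
    using cont_mean cont_ip by (auto intro!: closed_vimage simp: continuous_on_eq_continuous_within)
  ultimately have cK: "compact K" using cB by (auto intro!: compact_Int_closed)
  have normalize: "\<exists>h\<in>K. \<exists>s>0. s\<^sup>2 = vari g \<and> energy g g = vari g * energy h h" if "0 < vari g" for g
  proof -
    define s where "s = sqrt (vari g)"
    have s: "0 < s" "s\<^sup>2 = vari g" using that by (auto simp: s_def)
    define h where "h = (\<lambda>x. if x \<in> S then (g x - mean g) / s else 0)"
    have m: "mean h = 0"
    proof -
      have "mean h = (\<Sum>x\<in>S. \<mu> x * g x - mean g * \<mu> x) / s"
        unfolding mean_def h_def sum_divide_distrib by (rule sum.cong) (auto simp: algebra_simps mean_def)
      also have "\<dots> = 0" by (simp add: sum_subtractf sum_distrib_left[symmetric] mu_sum) (simp add: mean_def)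
      finally show ?thesis .
    qed
    have i: "ip h h = 1"
    proof -
      have "ip h h = ip (\<lambda>x. g x - mean g) (\<lambda>x. g x - mean g) / s\<^sup>2"
        unfolding ip_def sum_divide_distrib h_def by (rule sum.cong) (auto simp: power2_eq_square)
      then show ?thesis using s that by (simp add: ip_mean_shift)
    qed
    have "energy h h = energy g g / s\<^sup>2"
      unfolding energy_eq h_def
      using s by (simp add: diff_divide_distrib[symmetric] power_divide sum_divide_distrib mult.commute cong: sum.cong)
    then have "energy g g = vari g * energy h h" using s that by simp
    then show ?thesis using m i s by (intro bexI[of _ h]) (auto simp: K_def h_def)
  qed
  obtain a where a: "a \<in> S" using ne by blast
  obtain b where b: "b \<in> S" "b \<noteq> a"
  proof (rule ccontr)
    assume "\<not> thesis"
    then have "S \<subseteq> {a}" using that by blast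
    then have "card S \<le> 1" using card_mono[of "{a}" S] by simp
    then show False using assms by simp
  qed
  \<comment> \<open>With two states a point mass is not constant, so the sphere is nonempty.\<close>
  have "0 < vari (delta a)"
  proof (rule ccontr)
    assume "\<not> 0 < vari (delta a)"
    then have "ip (\<lambda>x. delta a x - mean (delta a)) (\<lambda>x. delta a x - mean (delta a)) \<le> 0"
        by (simp add: ip_mean_shift)
    then have "\<forall>x\<in>S. delta a x - mean (delta a) = 0" using ip_pos[of _ "\<lambda>x. delta a x - mean (delta a)"]
        by force
    then have "delta a a = delta a b" using a b by force
    then show False using b by (simp add: delta_def)
  qed
  then have "K \<noteq> {}" using normalize by blast
  then obtain f where f: "f \<in> K" "\<And>g. g \<in> K \<Longrightarrow> energy f f \<le> energy g g"
    using continuous_attains_inf[OF cK _ continuous_on_subset[OF cont_en]] by auto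
  show thesis
  proof
    show "energy f f * vari g \<le> energy g g" for g
    proof (cases "0 < vari g")
      case True
      then obtain h where "h \<in> K" "energy g g = vari g * energy h h" using normalize by blast
      then show ?thesis using f(2)[of h] True by (simp add: mult.commute)
    next
      case False
      then show ?thesis using vari_nonneg[of g] energy_nonneg[of g] by (simp add: antisym)
    qed
  qed (use f(1) in \<open>auto simp: K_def\<close>)
qed

lemma energy_add: "energy (\<lambda>x. f x + t * g x) (\<lambda>x. f x + t * g x) = energy f f + 2 * t * energy g f
    + t\<^sup>2 * energy g g"
proof -
  have e: "energy (\<lambda>x. a x + t * b x) c = energy a c + t * energy b c" for a b c :: "'a \<Rightarrow> real" and t
    unfolding energy_def ip_def by (simp add: algebra_simps sum.distrib sum_distrib_left)
  show ?thesis
    by (simp add: e energy_sym[of _ "\<lambda>x. f x + t * g x"])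
        (simp add: energy_sym[of f g] power2_eq_square algebra_simps)
qed

lemma ip_add: "ip (\<lambda>x. f x + t * g x) (\<lambda>x. f x + t * g x) = ip f f + 2 * t * ip g f + t\<^sup>2 * ip g g"
  unfolding ip_def by (simp add: algebra_simps power2_eq_square sum.distrib sum_distrib_left)

lemma mean_add: "mean (\<lambda>x. f x + t * g x) = mean f + t * mean g"
  unfolding mean_def by (simp add: algebra_simps sum.distrib sum_distrib_left)

text \<open>The form \<open>energy - c * vari\<close> is nonnegative and vanishes at the minimizer,
  so its first variation there is zero in every direction; this is the weak eigenvalue
  equation.\<close>

lemma poincare_eigen:
  assumes "2 \<le> card S"
  obtains f c where "f \<in> eigenspace S kern (1 - c)" "mean f = 0" "ip f f = 1"
    "\<And>g. c * vari g \<le> energy g g"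
proof -
  obtain f c where f: "\<And>x. x \<notin> S \<Longrightarrow> f x = 0" "mean f = 0" "ip f f = 1" "energy f f = c"
    "\<And>g. c * vari g \<le> energy g g" using minimizer[OF assms] by blast
  have "energy g f = c * ip g f" for g
  proof -
    have "0 \<le> 2 * t * (energy g f - c * ip g f) + t\<^sup>2 * (energy g g - c * vari g)" for t
    proof -
      have "c * vari (\<lambda>x. f x + t * g x) \<le> energy (\<lambda>x. f x + t * g x) (\<lambda>x. f x + t * g x)" by (rule f(5))
      then have "c * (1 + 2 * t * ip g f + t\<^sup>2 * ip g g - (t * mean g)\<^sup>2) \<le> c + 2 * t * energy g f
          + t\<^sup>2 * energy g g"
        by (simp add: vari_def energy_add ip_add mean_add f)
      then show ?thesis by (simp add: vari_def algebra_simps power_mult_distrib)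
    qed
    then have "energy g f - c * ip g f = 0" by (rule quadratic_nonneg_linear_zero)
    then show ?thesis by simp
  qed
  then have "f \<in> eigenspace S kern (1 - c)" using f(1) by (intro weak_eigen) auto
  then show thesis using that f by blast
qed

lemma mean_ip: "mean f = ip f (\<lambda>x. if x \<in> S then 1 else 0)"
  unfolding mean_def ip_def by (rule sum.cong) auto

definition candidates :: "real set" where
  "candidates = {\<kappa>. is_eigenvalue S kern \<kappa> \<and> 2 \<le> (\<Sum>\<nu> | is_eigenvalue S kern \<nu> \<and> \<kappa> \<le> \<nu>. eig_mult S kern \<nu>)}"

lemma finite_candidates: "finite candidates"
  unfolding candidates_def by (rule finite_subset[OF _ finite_eigenvalues]) auto

text \<open>The constants account for one unit of multiplicity at the eigenvalue 1. A centred
  eigenvector supplies the second: in the same eigenspace if \<open>\<kappa> = 1\<close>, at another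
  eigenvalue otherwise.\<close>

lemma mem_candidates:
  assumes f: "f \<in> eigenspace S kern \<kappa>" "mean f = 0" "0 < ip f f"
  shows "\<kappa> \<in> candidates"
proof -
  let ?one = "\<lambda>x. if x \<in> S then 1 else 0 :: real"
  have fnz: "f \<noteq> (\<lambda>_. 0)" using f(3) by (auto simp: ip_def)
  have ev: "is_eigenvalue S kern \<kappa>" using f(1) fnz by (auto simp: is_eigenvalue_def)
  have one: "0 < ip ?one ?one" using ne by (auto intro: ip_pos)
  then have "?one \<noteq> (\<lambda>_. 0)" by (force simp: ip_def)
  then have ev1: "is_eigenvalue S kern 1" using const_eigen unfolding is_eigenvalue_def by blast
  have fin: "finite {\<nu>. is_eigenvalue S kern \<nu> \<and> \<kappa> \<le> \<nu>}"
    by (rule finite_subset[OF _ finite_eigenvalues]) auto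
  have "2 \<le> (\<Sum>\<nu> | is_eigenvalue S kern \<nu> \<and> \<kappa> \<le> \<nu>. eig_mult S kern \<nu>)"
  proof (cases "\<kappa> = 1")
    case True
    have orth: "ip f ?one = 0" using f(2) mean_ip by simp
    have "f \<noteq> ?one" using orth f(3) by auto
    then have "card {f, ?one} = 2" by simp
    moreover have "card {f, ?one} \<le> eig_mult S kern 1"
      by (rule eigenspace_dim) (use f True const_eigen one orth ip_sym[of f ?one] in auto)
    moreover have "eig_mult S kern 1 \<le> (\<Sum>\<nu> | is_eigenvalue S kern \<nu> \<and> \<kappa> \<le> \<nu>. eig_mult S kern \<nu>)"
      by (rule member_le_sum[OF _ _ fin]) (use ev1 True in auto)
    ultimately show ?thesis by simp
  next
    case False
    have "1 \<le> eig_mult S kern 1" using eigenspace_dim[of "{?one}" 1] const_eigen one by auto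
    moreover have "1 \<le> eig_mult S kern \<kappa>" using eigenspace_dim[of "{f}" \<kappa>] f by auto
    moreover have "(\<Sum>\<nu>\<in>{1, \<kappa>}. eig_mult S kern \<nu>) \<le> (\<Sum>\<nu> | is_eigenvalue S kern \<nu> \<and> \<kappa> \<le> \<nu>. eig_mult S kern \<nu>)"
      by (rule sum_mono2[OF fin]) (use ev ev1 eigenvalue_le_1[OF ev] in auto)
    ultimately show ?thesis using False by auto
  qed
  then show ?thesis using ev by (simp add: candidates_def)
qed

lemma right_gap_eq: "2 \<le> card S \<Longrightarrow> right_gap S kern = 1 - Max candidates"
  by (auto simp: right_gap_def eigval_def candidates_def is_singleton_altdef)

text \<open>It suffices that \<open>right_gap \<le> c\<close> for the constant \<open>c\<close> of
  the minimizer: \<open>1 - c\<close> is a candidate, hence at most the maximum. On a singleton the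
  variance is zero.\<close>

lemma right_gap_poincare: "right_gap S kern * vari g \<le> energy g g"
proof (cases "2 \<le> card S")
  case True
  obtain f c where f: "f \<in> eigenspace S kern (1 - c)" "mean f = 0" "ip f f = 1"
    "\<And>g. c * vari g \<le> energy g g" using poincare_eigen[OF True] by blast
  have "1 - c \<in> candidates" by (rule mem_candidates) (use f in auto)
  then have "1 - c \<le> Max candidates" using finite_candidates by simp
  then have "right_gap S kern \<le> c" using right_gap_eq[OF True] by simp
  then have "right_gap S kern * vari g \<le> c * vari g" by (intro mult_right_mono vari_nonneg)
  also have "\<dots> \<le> energy g g" by (rule f)
  finally show ?thesis .
next
  case False
  have "0 < card S" using fin ne by (simp add: card_gt_0_iff)
  with False have "card S = 1" by linarith
  then obtain a where S: "S = {a}" by (auto simp: card_1_singleton_iff)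
  have "vari g = 0" using mu_sum unfolding vari_def ip_def mean_def by (simp add: S power2_eq_square)
  then show ?thesis using energy_nonneg[of g] by simp
qed

text \<open>Connectedness makes the eigenvalue 1 simple. So the second eigenvalue differs from 1,
  and its eigenvectors are orthogonal to the constants, that is, centred.\<close>

lemma right_gap_eigenvector:
  assumes "2 \<le> card S" and conn: "\<And>f. energy f f = 0 \<Longrightarrow> vari f = 0"
  obtains f where "energy f f = right_gap S kern * vari f" "0 < vari f"
proof -
  define \<kappa> where "\<kappa> = Max candidates"
  obtain f0 c where f0: "f0 \<in> eigenspace S kern (1 - c)" "mean f0 = 0" "ip f0 f0 = 1"
    using poincare_eigen[OF assms(1)] by metis
  have "candidates \<noteq> {}" using mem_candidates[OF f0(1,2)] f0(3) by auto
  then have k: "\<kappa> \<in> candidates" unfolding \<kappa>_def using finite_candidates by (rule Max_in[rotated])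
  then obtain f where f: "f \<in> eigenspace S kern \<kappa>" "f \<noteq> (\<lambda>_. 0)"
    by (auto simp: candidates_def is_eigenvalue_def)
  have fpos: "0 < ip f f" using eigenvector_ip_pos f by blast
  have "\<kappa> \<noteq> 1"
  proof
    assume k1: "\<kappa> = 1"
    have "{\<nu>. is_eigenvalue S kern \<nu> \<and> 1 \<le> \<nu>} = {1}"
      using k k1 eigenvalue_le_1 by (force simp: candidates_def)
    then have "2 \<le> eig_mult S kern 1" using k k1 by (simp add: candidates_def)
    moreover have "eig_mult S kern 1 \<le> 1"
    proof -
      have "g \<in> fun_vs.span {\<lambda>x. if x \<in> S then 1 else 0}" if g: "g \<in> eigenspace S kern 1" for g
      proof -
        have "vari g = 0" using eigen_weak[OF g, of g] by (intro conn) simp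
        then have "ip (\<lambda>x. g x - mean g) (\<lambda>x. g x - mean g) = 0" by (simp add: ip_mean_shift)
        then have "\<forall>x\<in>S. g x = mean g" using ip_pos[of _ "\<lambda>x. g x - mean g"] by force
        then have "g = fun_scale (mean g) (\<lambda>x. if x \<in> S then 1 else 0)"
          using g by (auto simp: fun_scale_def eigenspace_def)
        then show ?thesis by (metis fun_vs.span_base fun_vs.span_scale insertI1)
      qed
      then show ?thesis unfolding eig_mult_def
        using fun_vs.dim_le_card[of "eigenspace S kern 1" "{\<lambda>x. if x \<in> S then 1 else 0}"] by auto
    qed
    ultimately show False by simp
  qed
  then have "mean f = 0" using eigen_orth[OF f(1) const_eigen] mean_ip by simp
  then have v: "vari f = ip f f" by (simp add: vari_def)
  show thesis
    by (rule that[of f]) (use eigen_weak[OF f(1), of f] fpos v right_gap_eq[OF assms(1)] in \<open>auto simp: \<kappa>_def\<close>)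
qed

lemma right_gap_pos:
  assumes "2 \<le> card S" and conn: "\<And>f. energy f f = 0 \<Longrightarrow> vari f = 0"
  shows "0 < right_gap S kern"
proof -
  obtain f where f: "energy f f = right_gap S kern * vari f" "0 < vari f"
    using right_gap_eigenvector[OF assms] by blast
  have "energy f f \<noteq> 0" using conn[of f] f(2) by auto
  then have "0 < right_gap S kern * vari f" using energy_nonneg[of f]
      by (simp add: f(1)[symmetric] order_less_le)
  then show ?thesis using f(2) by (simp add: zero_less_mult_iff)
qed

lemma right_gap_ge:
  assumes "2 \<le> card S" "0 < c" and "\<And>f. c * vari f \<le> energy f f"
  shows "c \<le> right_gap S kern"
proof -
  have "vari f = 0" if "energy f f = 0" for f
    using assms(2) assms(3)[of f] that vari_nonneg[of f] by (simp add: mult_le_0_iff)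
  then obtain f where f: "energy f f = right_gap S kern * vari f" "0 < vari f"
    using right_gap_eigenvector[OF assms(1)] by metis
  then show ?thesis using assms(3)[of f] by simp
qed

text \<open>All eigenvalues are at least -1. This yields \<open>1 \<le> card S / g\<close> for two
  or more states and settles the case of a one-element count space.\<close>

lemma right_gap_le_2: "right_gap S kern \<le> 2"
proof (cases "2 \<le> card S")
  case True
  obtain f c where f: "f \<in> eigenspace S kern (1 - c)" "mean f = 0" "ip f f = 1"
    using poincare_eigen[OF True] by metis
  have "right_gap S kern * vari f \<le> energy f f" by (rule right_gap_poincare)
  moreover have "vari f = 1" using f by (simp add: vari_def)
  moreover have "energy f f \<le> 2"
  proof -
    have "(\<Sum>x\<in>S. \<Sum>y\<in>S. J x y * (f x - f y)\<^sup>2) \<le> (\<Sum>x\<in>S. \<Sum>y\<in>S. J x y * (2 * (f x)\<^sup>2 + 2 * (f y)\<^sup>2))"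
    proof (intro sum_mono mult_left_mono J_nonneg)
      fix x y
      have "0 \<le> (f x + f y)\<^sup>2" by simp
      then show "(f x - f y)\<^sup>2 \<le> 2 * (f x)\<^sup>2 + 2 * (f y)\<^sup>2" by (simp add: power2_sum power2_diff)
    qed
    also have "\<dots> = 2 * (\<Sum>x\<in>S. \<Sum>y\<in>S. J x y * (f x)\<^sup>2) + 2 * (\<Sum>x\<in>S. \<Sum>y\<in>S. J x y * (f y)\<^sup>2)"
      by (simp add: algebra_simps sum.distrib sum_distrib_left)
    also have "(\<Sum>x\<in>S. \<Sum>y\<in>S. J x y * (f y)\<^sup>2) = (\<Sum>x\<in>S. \<Sum>y\<in>S. J x y * (f x)\<^sup>2)"
      by (subst sum.swap) (simp add: J_sym cong: sum.cong)
    also have "(\<Sum>x\<in>S. \<Sum>y\<in>S. J x y * (f x)\<^sup>2) = ip f f"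
      by (simp add: ip_def sum_distrib_right[symmetric] J_row power2_eq_square mult.assoc)
    finally show ?thesis using f(3) by (simp add: energy_eq)
  qed
  ultimately show ?thesis by simp
next
  case False
  have "0 < card S" using fin ne by (simp add: card_gt_0_iff)
  with False have "is_singleton S" by (simp add: is_singleton_altdef)
  then show ?thesis by (simp add: right_gap_def)
qed

end

lemma right_gap_cong:
  assumes "\<And>x y. x \<in> S \<Longrightarrow> y \<in> S \<Longrightarrow> A x y = B x y"
  shows "right_gap S A = right_gap S B"
proof -
  have "eigenspace S A = eigenspace S B"
    unfolding eigenspace_def by (intro ext Collect_cong) (use assms in \<open>simp cong: sum.cong\<close>)
  then show ?thesis by (simp add: right_gap_def eigval_def is_eigenvalue_def eig_mult_def)
qed

subsection \<open>Path expectations\<close>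

lemma sum_sq_le: "(\<Sum>i<n. a i :: real)\<^sup>2 \<le> real n * (\<Sum>i<n. (a i)\<^sup>2)"
  using Cauchy_Schwarz_ineq_sum[of "\<lambda>_. 1" a "{..<n}"] by simp

text \<open>Young's inequality with weight \<open>C - b\<close>. In the application
  \<open>b = 1 + \<phi> y / \<tau>\<close> and \<open>C = 4 * \<tau> + 2\<close>, so that
  \<open>4 / (C - 2) = 1 / \<tau>\<close>.\<close>

lemma square_shift_le:
  fixes b C A a :: real
  assumes "1 \<le> b" "b \<le> 2" "2 < C"
  shows "b * (A + a)\<^sup>2 \<le> (b + 4 / (C - 2)) * A\<^sup>2 + C * a\<^sup>2"
proof -
  have Cb: "0 < C - b" using assms by simp
  have "0 \<le> ((C - b) * a - b * A)\<^sup>2 / (C - b)" using Cb by simp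
  also have "\<dots> = (C - b) * a\<^sup>2 - 2 * b * A * a + b\<^sup>2 / (C - b) * A\<^sup>2"
    using Cb by (simp add: power2_eq_square field_simps)
  finally have "b * (A + a)\<^sup>2 \<le> (b + b\<^sup>2 / (C - b)) * A\<^sup>2 + C * a\<^sup>2"
    by (simp add: power2_eq_square algebra_simps)
  moreover have "b\<^sup>2 / (C - b) \<le> 4 / (C - 2)"
  proof (rule frac_le)
    show "b\<^sup>2 \<le> 4" using power_mono[of b 2 2] assms by simp
  qed (use assms in auto)
  then have "(b + b\<^sup>2 / (C - b)) * A\<^sup>2 \<le> (b + 4 / (C - 2)) * A\<^sup>2"
    by (intro mult_right_mono) auto
  ultimately show ?thesis by simp
qed

locale rev_chain =
  fixes S :: "'a set" and p :: "'a \<Rightarrow> 'a \<Rightarrow> real" and \<pi> :: "'a \<Rightarrow> real"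
  assumes fin_S: "finite S" and ne_S: "S \<noteq> {}"
    and p_nonneg: "\<And>x y. x \<in> S \<Longrightarrow> y \<in> S \<Longrightarrow> 0 \<le> p x y"
    and p_row: "\<And>x. x \<in> S \<Longrightarrow> (\<Sum>y\<in>S. p x y) = 1"
    and balance: "\<And>x y. x \<in> S \<Longrightarrow> y \<in> S \<Longrightarrow> \<pi> x * p x y = \<pi> y * p y x"
    and pi_pos: "\<And>x. x \<in> S \<Longrightarrow> 0 < \<pi> x"
    and pi_sum: "(\<Sum>x\<in>S. \<pi> x) = 1"
begin

sublocale rev_form S "\<lambda>x y. \<pi> x * p x y" \<pi>
proof
  show "(\<Sum>y\<in>S. \<pi> x * p x y) = \<pi> x" if "x \<in> S" for x
    using that by (simp add: sum_distrib_left[symmetric] p_row)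
qed (auto simp: fin_S ne_S p_nonneg balance pi_pos pi_sum less_imp_le)

lemma kern_eq: "x \<in> S \<Longrightarrow> kern x y = p x y"
  using pi_pos[of x] by (simp add: kern_def)

definition lists_of :: "nat \<Rightarrow> 'a list set" where
  "lists_of n = {xs. set xs \<subseteq> S \<and> length xs = n}"

fun wt :: "'a list \<Rightarrow> real" where
  "wt [] = 1"
| "wt [x] = 1"
| "wt (x # y # xs) = p x y * wt (y # xs)"

text \<open>
  \<open>nx n x \<Phi>\<close> is the expectation of \<open>\<Phi> [X\<^sub>1, \<dots>, X\<^sub>n]\<close> given \<open>X\<^sub>0 = x\<close>, and \<open>sx n \<Phi>\<close> is that of
  \<open>\<Phi> [X\<^sub>0, \<dots>, X\<^bsub>n-1\<^esub>]\<close> for the stationary chain (for \<open>n > 0\<close> only, because of \<open>hd []\<close>).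
\<close>

definition nx :: "nat \<Rightarrow> 'a \<Rightarrow> ('a list \<Rightarrow> real) \<Rightarrow> real" where
  "nx n x \<Phi> = (\<Sum>ys\<in>lists_of n. wt (x # ys) * \<Phi> ys)"

definition sx :: "nat \<Rightarrow> ('a list \<Rightarrow> real) \<Rightarrow> real" where
  "sx n \<Phi> = (\<Sum>xs\<in>lists_of n. \<pi> (hd xs) * wt xs * \<Phi> xs)"

lemma lists_of_0: "lists_of 0 = {[]}"
  by (auto simp: lists_of_def)

lemma lists_of_SucE:
  assumes "xs \<in> lists_of (Suc n)" obtains x ys where "xs = x # ys" "x \<in> S" "ys \<in> lists_of n"
  using assms by (cases xs) (auto simp: lists_of_def)

lemma sum_lists_Suc: "(\<Sum>xs\<in>lists_of (Suc n). f xs) = (\<Sum>x\<in>S. \<Sum>xs\<in>lists_of n. f (x # xs))"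
proof -
  have "(\<Sum>xs\<in>lists_of (Suc n). f xs) = (\<Sum>(x, xs)\<in>S \<times> lists_of n. f (x # xs))"
    by (rule sum.reindex_bij_witness[of _ "\<lambda>(x, xs). x # xs" "\<lambda>xs. (hd xs, tl xs)"])
       (auto simp: lists_of_def length_Suc_conv)
  then show ?thesis by (simp add: sum.cartesian_product)
qed

lemma sum_lists_add:
  "(\<Sum>xs\<in>lists_of (a + b). f xs) = (\<Sum>us\<in>lists_of a. \<Sum>vs\<in>lists_of b. f (us @ vs))"
  by (induction a arbitrary: f) (simp_all add: lists_of_0 sum_lists_Suc)

lemma sum_lists_rev: "(\<Sum>xs\<in>lists_of n. f (rev xs)) = (\<Sum>xs\<in>lists_of n. f xs)"
  by (rule sum.reindex_bij_witness[of _ rev rev]) (auto simp: lists_of_def)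

lemma wt_nonneg: "set xs \<subseteq> S \<Longrightarrow> 0 \<le> wt xs"
  by (induction xs rule: wt.induct) (auto simp: p_nonneg)

lemma wt_append: "us \<noteq> [] \<Longrightarrow> wt (us @ vs) = wt us * wt (last us # vs)"
proof (induction us rule: wt.induct)
  case (2 x) then show ?case by simp
qed auto

lemma wt_rev: "xs \<noteq> [] \<Longrightarrow> set xs \<subseteq> S \<Longrightarrow> \<pi> (hd xs) * wt xs = \<pi> (last xs) * wt (rev xs)"
proof (induction xs rule: wt.induct)
  case (3 x y xs)
  have IH: "\<pi> y * wt (y # xs) = \<pi> (last (y # xs)) * wt (rev (y # xs))" using 3 by simp
  have "wt (rev (x # y # xs)) = wt (rev (y # xs) @ [x])" by simp
  also have "\<dots> = wt (rev (y # xs)) * p y x" by (subst wt_append) auto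
  finally have r: "wt (rev (x # y # xs)) = wt (rev (y # xs)) * p y x" .
  have "\<pi> (hd (x # y # xs)) * wt (x # y # xs) = \<pi> x * p x y * wt (y # xs)" by simp
  also have "\<dots> = p y x * (\<pi> y * wt (y # xs))" using 3 balance[of x y] by simp
  also have "\<dots> = \<pi> (last (x # y # xs)) * wt (rev (x # y # xs))" unfolding IH r by simp
  finally show ?case .
qed auto

lemma nx_0 [simp]: "nx 0 x \<Phi> = \<Phi> []"
  by (simp add: nx_def lists_of_0)

lemma nx_Suc: "nx (Suc n) x \<Phi> = (\<Sum>y\<in>S. p x y * nx n y (\<lambda>ys. \<Phi> (y # ys)))"
  by (simp add: nx_def sum_lists_Suc sum_distrib_left mult.assoc)

lemma sx_Suc: "sx (Suc n) \<Phi> = (\<Sum>x\<in>S. \<pi> x * nx n x (\<lambda>ys. \<Phi> (x # ys)))"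
  by (simp add: nx_def sx_def sum_lists_Suc sum_distrib_left mult.assoc)

lemma nx_cong: "(\<And>ys. ys \<in> lists_of n \<Longrightarrow> \<Phi> ys = \<Psi> ys) \<Longrightarrow> nx n x \<Phi> = nx n x \<Psi>"
  by (simp add: nx_def)

lemma sx_cong: "(\<And>ys. ys \<in> lists_of n \<Longrightarrow> \<Phi> ys = \<Psi> ys) \<Longrightarrow> sx n \<Phi> = sx n \<Psi>"
  by (simp add: sx_def)

lemma nx_mono: "x \<in> S \<Longrightarrow> (\<And>ys. ys \<in> lists_of n \<Longrightarrow> \<Phi> ys \<le> \<Psi> ys) \<Longrightarrow> nx n x \<Phi> \<le> nx n x \<Psi>"
  unfolding nx_def by (intro sum_mono mult_left_mono wt_nonneg) (auto simp: lists_of_def)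

lemma sx_weight_nonneg: "0 < n \<Longrightarrow> xs \<in> lists_of n \<Longrightarrow> 0 \<le> \<pi> (hd xs) * wt xs"
  using hd_in_set[of xs] by (intro mult_nonneg_nonneg wt_nonneg less_imp_le[OF pi_pos])
      (auto simp: lists_of_def)

lemma sx_mono: "0 < n \<Longrightarrow> (\<And>ys. ys \<in> lists_of n \<Longrightarrow> \<Phi> ys \<le> \<Psi> ys) \<Longrightarrow> sx n \<Phi> \<le> sx n \<Psi>"
  unfolding sx_def by (intro sum_mono mult_left_mono sx_weight_nonneg) auto

lemma nx_add: "nx n x (\<lambda>ys. \<Phi> ys + \<Psi> ys) = nx n x \<Phi> + nx n x \<Psi>"
  by (simp add: nx_def algebra_simps sum.distrib)

lemma sx_add: "sx n (\<lambda>ys. \<Phi> ys + \<Psi> ys) = sx n \<Phi> + sx n \<Psi>"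
  by (simp add: sx_def algebra_simps sum.distrib)

lemma nx_diff: "nx n x (\<lambda>ys. \<Phi> ys - \<Psi> ys) = nx n x \<Phi> - nx n x \<Psi>"
  by (simp add: nx_def algebra_simps sum_subtractf)

lemma sx_diff: "sx n (\<lambda>ys. \<Phi> ys - \<Psi> ys) = sx n \<Phi> - sx n \<Psi>"
  by (simp add: sx_def algebra_simps sum_subtractf)

lemma nx_cmult: "nx n x (\<lambda>ys. c * \<Phi> ys) = c * nx n x \<Phi>"
  by (simp add: nx_def algebra_simps sum_distrib_left)

lemma sx_cmult: "sx n (\<lambda>ys. c * \<Phi> ys) = c * sx n \<Phi>"
  by (simp add: sx_def algebra_simps sum_distrib_left)

lemma nx_sum: "nx n x (\<lambda>ys. \<Sum>i\<in>I. \<Phi> i ys) = (\<Sum>i\<in>I. nx n x (\<Phi> i))"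
  unfolding nx_def by (subst sum.swap) (simp add: sum_distrib_left)

lemma sx_sum: "sx n (\<lambda>ys. \<Sum>i\<in>I. \<Phi> i ys) = (\<Sum>i\<in>I. sx n (\<Phi> i))"
  unfolding sx_def by (subst sum.swap) (simp add: sum_distrib_left)

lemma nx_const: "x \<in> S \<Longrightarrow> nx n x (\<lambda>_. c) = c"
  by (induction n arbitrary: x) (simp_all add: nx_Suc sum_distrib_right[symmetric] p_row)

lemma sx_const: "0 < n \<Longrightarrow> sx n (\<lambda>_. c) = c"
  by (cases n) (simp_all add: sx_Suc nx_const sum_distrib_right[symmetric] pi_sum)

lemma nx_nonneg: "x \<in> S \<Longrightarrow> (\<And>ys. ys \<in> lists_of n \<Longrightarrow> 0 \<le> \<Phi> ys) \<Longrightarrow> 0 \<le> nx n x \<Phi>"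
  using nx_mono[of x n "\<lambda>_. 0" \<Phi>] by (simp add: nx_const)

lemma sx_nonneg: "0 < n \<Longrightarrow> (\<And>ys. ys \<in> lists_of n \<Longrightarrow> 0 \<le> \<Phi> ys) \<Longrightarrow> 0 \<le> sx n \<Phi>"
  using sx_mono[of n "\<lambda>_. 0" \<Phi>] by (simp add: sx_const)

lemma nx_sq: assumes "x \<in> S" shows "nx n x (\<lambda>ys. (\<Phi> ys - c)\<^sup>2) =
    nx n x (\<lambda>ys. (\<Phi> ys - nx n x \<Phi>)\<^sup>2) + (nx n x \<Phi> - c)\<^sup>2"
proof -
  have e: "nx n x (\<lambda>ys. (\<Phi> ys - c)\<^sup>2) = nx n x (\<lambda>ys. (\<Phi> ys)\<^sup>2) - 2 * c * nx n x \<Phi> + c\<^sup>2" for c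
  proof -
    have "nx n x (\<lambda>ys. (\<Phi> ys - c)\<^sup>2) = nx n x (\<lambda>ys. ((\<Phi> ys)\<^sup>2 - (2 * c) * \<Phi> ys) + c\<^sup>2)"
      by (rule nx_cong) (simp add: power2_diff)
    then show ?thesis by (simp only: nx_add nx_diff nx_cmult nx_const[OF assms])
  qed
  show ?thesis unfolding e[of c] e[of "nx n x \<Phi>"] by (simp add: power2_eq_square algebra_simps)
qed

lemma nx_cs: "x \<in> S \<Longrightarrow> (nx n x \<Phi> - c)\<^sup>2 \<le> nx n x (\<lambda>ys. (\<Phi> ys - c)\<^sup>2)"
  unfolding nx_sq[of x n \<Phi> c] by (simp add: nx_nonneg)

lemma nx_append:
  "nx (a + b) x \<Phi> = nx a x (\<lambda>us. nx b (last (x # us)) (\<lambda>vs. \<Phi> (us @ vs)))"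
proof (induction a arbitrary: x \<Phi>)
  case (Suc a)
  then show ?case by (simp add: nx_Suc)
qed simp

lemma last_in_S: "x \<in> S \<Longrightarrow> us \<in> lists_of n \<Longrightarrow> last (x # us) \<in> S"
  by (auto simp: lists_of_def intro: subsetD[OF _ last_in_set])

lemma nx_take: "x \<in> S \<Longrightarrow> a \<le> n \<Longrightarrow> nx n x (\<lambda>ys. \<Phi> (take a ys)) = nx a x \<Phi>"
proof -
  assume x: "x \<in> S" and "a \<le> n"
  then obtain b where n: "n = a + b" using le_Suc_ex by blast
  have "nx (a + b) x (\<lambda>ys. \<Phi> (take a ys)) = nx a x (\<lambda>us. nx b (last (x # us)) (\<lambda>vs. \<Phi> us))"
    unfolding nx_append by (intro nx_cong) (simp add: lists_of_def)
  also have "\<dots> = nx a x \<Phi>" by (rule nx_cong) (simp only: nx_const last_in_S[OF x])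
  finally show ?thesis by (simp add: n)
qed

lemma sx_rev: "0 < n \<Longrightarrow> sx n (\<lambda>xs. \<Phi> (rev xs)) = sx n \<Phi>"
proof -
  assume n: "0 < n"
  have "sx n (\<lambda>xs. \<Phi> (rev xs)) = (\<Sum>xs\<in>lists_of n. \<pi> (hd (rev xs)) * wt (rev xs) * \<Phi> (rev xs))"
    unfolding sx_def
  proof (intro sum.cong refl)
    fix xs assume xs: "xs \<in> lists_of n"
    then have "xs \<noteq> []" using n by (auto simp: lists_of_def)
    then show "\<pi> (hd xs) * wt xs * \<Phi> (rev xs) = \<pi> (hd (rev xs)) * wt (rev xs) * \<Phi> (rev xs)"
      using wt_rev[of xs] xs by (simp add: lists_of_def hd_rev)
  qed
  also have "\<dots> = sx n \<Phi>" unfolding sx_def by (rule sum_lists_rev)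
  finally show ?thesis .
qed

lemma sx_take: "0 < a \<Longrightarrow> a \<le> n \<Longrightarrow> sx n (\<lambda>xs. \<Phi> (take a xs)) = sx a \<Phi>"
proof -
  assume "0 < a" "a \<le> n"
  then obtain b m where a: "a = Suc b" and n: "n = Suc m" "b \<le> m" by (cases a; cases n) auto
  show ?thesis unfolding a n(1)
    by (simp add: sx_Suc) (intro sum.cong refl, simp add: nx_take n(2) nx_take[of _ b m "\<lambda>ys. \<Phi> (_ # ys)"])
qed

text \<open>Stationarity, obtained from reversibility: deleting entries at the front is truncating
  the reversed path.\<close>

lemma sx_drop: "0 < b \<Longrightarrow> sx (a + b) (\<lambda>xs. \<Phi> (drop a xs)) = sx b \<Phi>"
proof -
  assume b: "0 < b"
  have "sx (a + b) (\<lambda>xs. \<Phi> (drop a xs)) = sx (a + b) (\<lambda>xs. \<Phi> (drop a (rev xs)))"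
    using b by (intro sx_rev[symmetric]) simp
  also have "\<dots> = sx (a + b) (\<lambda>xs. \<Phi> (rev (take b xs)))"
    by (rule sx_cong) (simp add: lists_of_def drop_rev)
  also have "\<dots> = sx b (\<lambda>xs. \<Phi> (rev xs))" using b by (intro sx_take) auto
  also have "\<dots> = sx b \<Phi>" by (rule sx_rev[OF b])
  finally show ?thesis .
qed

lemma sx_window: "0 < b \<Longrightarrow> a + b \<le> n \<Longrightarrow> sx n (\<lambda>xs. \<Phi> (take b (drop a xs))) = sx b \<Phi>"
proof -
  assume b: "0 < b" and n: "a + b \<le> n"
  have "sx n (\<lambda>xs. \<Phi> (take b (drop a xs))) = sx n (\<lambda>xs. \<Phi> (drop a (take (a + b) xs)))"
    by (simp add: drop_take)
  also have "\<dots> = sx (a + b) (\<lambda>xs. \<Phi> (drop a xs))"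
    using b n by (intro sx_take[where \<Phi> = "\<lambda>xs. \<Phi> (drop a xs)"]) auto
  also have "\<dots> = sx b \<Phi>" by (rule sx_drop[OF b])
  finally show ?thesis .
qed

lemma sx_hd: "0 < n \<Longrightarrow> sx n (\<lambda>xs. f (hd xs)) = mean f"
  by (cases n) (auto simp: sx_Suc nx_const mean_def intro!: sum.cong)

lemma sx_last: "0 < n \<Longrightarrow> sx n (\<lambda>xs. f (last xs)) = mean f"
  using sx_rev[of n "\<lambda>xs. f (hd xs)"] sx_hd[of n f] by (simp add: hd_rev)

definition pop :: "('a \<Rightarrow> real) \<Rightarrow> 'a \<Rightarrow> real" where
  "pop f x = (\<Sum>y\<in>S. p x y * f y)"

text \<open>Because of \<open>take\<close> the list may be longer than the window: on a path of
  length \<open>n + 1\<close> the two windows are \<open>winF\<close> of the list and of its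
  tail.\<close>

definition winF :: "('a multiset \<Rightarrow> real) \<Rightarrow> nat \<Rightarrow> 'a list \<Rightarrow> real" where
  "winF F n xs = F (mset (take n xs))"

definition diffF :: "('a multiset \<Rightarrow> real) \<Rightarrow> nat \<Rightarrow> 'a list \<Rightarrow> real" where
  "diffF F n xs = winF F n xs - winF F n (tl xs)"

definition dirF :: "('a multiset \<Rightarrow> real) \<Rightarrow> nat \<Rightarrow> real" where
  "dirF F n = sx (Suc n) (\<lambda>xs. (diffF F n xs)\<^sup>2)"

definition varF :: "('a multiset \<Rightarrow> real) \<Rightarrow> nat \<Rightarrow> real" where
  "varF F n = sx n (\<lambda>xs. (winF F n xs - sx n (winF F n))\<^sup>2)"

lemma sx_sq: assumes "0 < n" shows "sx n (\<lambda>ys. (\<Phi> ys - c)\<^sup>2) =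
    sx n (\<lambda>ys. (\<Phi> ys - sx n \<Phi>)\<^sup>2) + (sx n \<Phi> - c)\<^sup>2"
proof -
  have e: "sx n (\<lambda>ys. (\<Phi> ys - c)\<^sup>2) = sx n (\<lambda>ys. (\<Phi> ys)\<^sup>2) - 2 * c * sx n \<Phi> + c\<^sup>2" for c
  proof -
    have "sx n (\<lambda>ys. (\<Phi> ys - c)\<^sup>2) = sx n (\<lambda>ys. ((\<Phi> ys)\<^sup>2 - (2 * c) * \<Phi> ys) + c\<^sup>2)"
      by (rule sx_cong) (simp add: power2_diff)
    then show ?thesis by (simp only: sx_add sx_diff sx_cmult sx_const[OF assms])
  qed
  show ?thesis unfolding e[of c] e[of "sx n \<Phi>"] by (simp add: power2_eq_square algebra_simps)
qed

lemma varF_le: "0 < n \<Longrightarrow> varF F n \<le> sx n (\<lambda>xs. (winF F n xs - c)\<^sup>2)"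
  unfolding sx_sq[of n "winF F n" c] varF_def by simp

lemma dirF_nonneg: "0 \<le> dirF F n"
  unfolding dirF_def by (rule sx_nonneg) auto

subsection \<open>Short windows\<close>

lemma pop_sym: "ip f (pop g) = ip (pop f) g"
proof -
  have "ip f (pop g) = (\<Sum>x\<in>S. \<Sum>y\<in>S. \<pi> x * p x y * f x * g y)"
    by (simp add: ip_def pop_def sum_distrib_left mult_ac)
  also have "\<dots> = (\<Sum>y\<in>S. \<Sum>x\<in>S. \<pi> x * p x y * f x * g y)" by (rule sum.swap)
  also have "\<dots> = (\<Sum>y\<in>S. \<Sum>x\<in>S. \<pi> y * p y x * f x * g y)"
    by (intro sum.cong refl) (simp add: balance)
  also have "\<dots> = ip (pop f) g"
    by (simp add: ip_def pop_def sum_distrib_left sum_distrib_right mult_ac)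
  finally show ?thesis .
qed

lemma energy_pop: "energy f g = ip f g - ip f (pop g)"
  by (simp add: energy_def ip_def pop_def sum_distrib_left mult_ac)

lemma ip_diff_left: "ip (\<lambda>x. f x - g x) h = ip f h - ip g h"
  by (simp add: ip_def algebra_simps sum_subtractf)

lemma ip_diff_right: "ip h (\<lambda>x. f x - g x) = ip h f - ip h g"
  by (simp add: ip_def algebra_simps sum_subtractf)

lemma pop_diff: "pop (\<lambda>x. f x - g x) = (\<lambda>x. pop f x - pop g x)"
  by (simp add: pop_def fun_eq_iff algebra_simps sum_subtractf)

lemma energy_plus_nonneg: "0 \<le> ip u u + ip u (pop u)"
proof -
  have 1: "(\<Sum>x\<in>S. \<Sum>y\<in>S. \<pi> x * p x y * (u x)\<^sup>2) = ip u u"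
    by (simp add: ip_def sum_distrib_right[symmetric] sum_distrib_left[symmetric] p_row power2_eq_square mult.assoc)
  have 2: "(\<Sum>x\<in>S. \<Sum>y\<in>S. \<pi> x * p x y * (u y)\<^sup>2) = ip u u"
    using 1 by (subst sum.swap) (simp add: balance cong: sum.cong)
  have "0 \<le> (\<Sum>x\<in>S. \<Sum>y\<in>S. \<pi> x * p x y * (u x + u y)\<^sup>2)"
    by (intro sum_nonneg mult_nonneg_nonneg) (auto simp: p_nonneg pi_pos less_imp_le)
  also have "\<dots> = 2 * ip u u + 2 * (\<Sum>x\<in>S. \<Sum>y\<in>S. \<pi> x * p x y * u x * u y)"
    using 1 2 by (simp add: power2_sum algebra_simps sum.distrib sum_distrib_left)
  also have "(\<Sum>x\<in>S. \<Sum>y\<in>S. \<pi> x * p x y * u x * u y) = ip u (pop u)"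
    by (simp add: ip_def pop_def sum_distrib_left mult_ac)
  finally show ?thesis by simp
qed

text \<open>With \<open>u = f - pop f\<close> the difference of the energies is the form of
  \<open>1 + P\<close> at \<open>u\<close>, since
  \<open>(1 - P) * (1 - P\<^sup>2) = (1 - P)\<^sup>2 * (1 + P)\<close>.\<close>

lemma energy_pop_le: "energy (pop f) (pop f) \<le> energy f f"
proof -
  define u where "u = (\<lambda>x. f x - pop f x)"
  have "ip u u + ip u (pop u) = energy f f - energy (pop f) (pop f)"
    unfolding energy_pop u_def pop_diff ip_diff_left ip_diff_right
    using pop_sym[of f f] pop_sym[of f "pop f"] ip_sym[of f "pop f"] by simp
  then show ?thesis using energy_plus_nonneg[of u] by simp
qed

lemma energy_iter_le: "energy ((pop ^^ i) f) ((pop ^^ i) f) \<le> energy f f"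
  by (induction i) (auto intro: order_trans[OF energy_pop_le])

lemma pop_iter_sym: "ip f ((pop ^^ i) g) = ip ((pop ^^ i) f) g"
proof (induction i arbitrary: f g)
  case (Suc i)
  have "ip f ((pop ^^ Suc i) g) = ip (pop f) ((pop ^^ i) g)" by (simp add: pop_sym)
  also have "\<dots> = ip ((pop ^^ i) (pop f)) g" by (rule Suc)
  finally show ?case by (simp add: funpow_swap1)
qed simp

text \<open>Spectrally this is \<open>\<lambda> ^ i * (1 - \<lambda>) \<le> 1 - \<lambda>\<close> on
  \<open>[-1, 1]\<close>. Splitting \<open>i\<close> into halves by parity and moving one half
  across the inner product replaces the spectral theorem.\<close>

lemma pop_iter_step: "ip f ((pop ^^ i) f) - ip f ((pop ^^ Suc i) f) \<le> energy f f"
proof -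
  obtain r where "i = r + r \<or> i = r + Suc r"
    by (metis add_Suc_right even_Suc_div_two evenE mult_2 odd_two_times_div_two_succ oddE plus_1_eq_Suc add.commute)
  then show ?thesis
  proof
    assume i: "i = r + r"
    have "ip f ((pop ^^ i) f) - ip f ((pop ^^ Suc i) f) = energy ((pop ^^ r) f) ((pop ^^ r) f)"
      unfolding i energy_pop funpow_add[of r r pop] funpow_add[of r "Suc r" pop] add_Suc_right[symmetric]
      by (simp add: pop_iter_sym)
    then show ?thesis using energy_iter_le[of r f] by simp
  next
    assume i: "i = r + Suc r"
    define h where "h = (pop ^^ r) f"
    have 1: "ip f ((pop ^^ i) f) = ip h (pop h)"
      unfolding i funpow_add[of r "Suc r" pop] h_def by (simp add: pop_iter_sym)
    have 2: "ip f ((pop ^^ Suc i) f) = ip (pop h) (pop h)"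
      unfolding i add_Suc[symmetric] funpow_add[of "Suc r" "Suc r" pop] h_def
      by (simp add: pop_iter_sym pop_sym funpow_swap1)
    have "0 \<le> ip (\<lambda>x. h x - pop h x) (\<lambda>x. h x - pop h x)" by (rule ip_nonneg)
    then have "ip h (pop h) - ip (pop h) (pop h) \<le> energy h h"
      by (simp add: energy_pop ip_diff_left ip_diff_right ip_sym[of "pop h" h])
    also have "\<dots> \<le> energy f f" unfolding h_def by (rule energy_iter_le)
    finally show ?thesis unfolding 1 2 .
  qed
qed

lemma pop_iter_energy: "ip f f - ip f ((pop ^^ n) f) \<le> real n * energy f f"
proof (induction n)
  case (Suc n)
  then show ?case using pop_iter_step[of f n] by (simp add: algebra_simps)
qed simp

lemma nx_last: "nx n x (\<lambda>ys. f (last (x # ys))) = (pop ^^ n) f x"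
proof (induction n arbitrary: x)
  case (Suc n)
  then show ?case by (simp add: nx_Suc pop_def)
qed simp

lemma sx_ends: "sx (Suc n) (\<lambda>xs. (f (hd xs) - f (last xs))\<^sup>2) \<le> 2 * real n * energy f f"
proof -
  have "sx (Suc n) (\<lambda>xs. f (hd xs) * f (last xs)) = ip f ((pop ^^ n) f)"
    by (simp add: sx_Suc nx_cmult nx_last ip_def mult.assoc del: last.simps)
  moreover have "sx (Suc n) (\<lambda>xs. (f (hd xs))\<^sup>2) = ip f f"
    using sx_hd[of "Suc n" "\<lambda>x. (f x)\<^sup>2"] by (simp add: mean_def ip_def power2_eq_square mult.assoc)
  moreover have "sx (Suc n) (\<lambda>xs. (f (last xs))\<^sup>2) = ip f f"
    using sx_last[of "Suc n" "\<lambda>x. (f x)\<^sup>2"] by (simp add: mean_def ip_def power2_eq_square mult.assoc)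
  moreover have "sx (Suc n) (\<lambda>xs. (f (hd xs) - f (last xs))\<^sup>2) =
    sx (Suc n) (\<lambda>xs. (f (hd xs))\<^sup>2 + (f (last xs))\<^sup>2 - 2 * (f (hd xs) * f (last xs)))"
    by (rule sx_cong) (simp add: power2_diff)
  ultimately have "sx (Suc n) (\<lambda>xs. (f (hd xs) - f (last xs))\<^sup>2) = 2 * (ip f f - ip f ((pop ^^ n) f))"
    by (simp only: sx_diff sx_add sx_cmult) simp
  then show ?thesis using pop_iter_energy[of f n] by simp
qed

lemma take_rev_window:
  assumes "xs \<in> lists_of (Suc n)"
  shows "take n (rev xs) = rev (tl xs)" "tl (rev xs) = rev (take n xs)"
proof -
  have l: "length xs = Suc n" using assms by (simp add: lists_of_def)
  then show "take n (rev xs) = rev (tl xs)" by (simp add: take_rev drop_Suc)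
  show "tl (rev xs) = rev (take n xs)" using l
      by (metis butlast_conv_take butlast_rev diff_Suc_1 rev_rev_ident)
qed

definition headF :: "('a multiset \<Rightarrow> real) \<Rightarrow> nat \<Rightarrow> 'a \<Rightarrow> real" where
  "headF F n x = nx (n - 1) x (\<lambda>ys. winF F n (x # ys))"

lemma sx_hd_window:
  assumes "0 < n"
  shows "sx n (\<lambda>xs. f (hd xs) * winF F n xs) = ip f (headF F n)"
  using assms by (cases n) (auto simp: sx_Suc nx_cmult ip_def headF_def mult.assoc)

lemma winF_rev: "length xs = n \<Longrightarrow> winF F n (rev xs) = winF F n xs"
  by (simp add: winF_def)

lemma headF_energy:
  assumes n: "0 < n"
  shows "energy (headF F n) (headF F n) \<le> real n * dirF F n / 2"
proof -
  define h where "h = headF F n"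
  have r: "winF F n (rev xs) = winF F n (tl xs)" "winF F n (tl (rev xs)) = winF F n xs"
    if "xs \<in> lists_of (Suc n)" for xs
    using that unfolding winF_def take_rev_window(2)[OF that] take_rev_window(1)[OF that]
    by (simp_all add: lists_of_def)
  have 1: "sx (Suc n) (\<lambda>xs. h (hd xs) * winF F n xs) = ip h h"
  proof -
    have "sx (Suc n) (\<lambda>xs. h (hd xs) * winF F n xs)
        = sx (Suc n) (\<lambda>xs. h (hd (take n xs)) * winF F n (take n xs))"
      using n by (intro sx_cong) (simp add: winF_def hd_take)
    also have "\<dots> = sx n (\<lambda>xs. h (hd xs) * winF F n xs)"
      using n by (intro sx_take[where \<Phi> = "\<lambda>xs. h (hd xs) * winF F n xs"]) auto
    finally show ?thesis using sx_hd_window[OF n] by (simp add: h_def)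
  qed
  have 2: "sx (Suc n) (\<lambda>xs. h (hd xs) * winF F n (tl xs)) = ip h (pop h)"
  proof -
    obtain k where k: "n = Suc k" using n by (cases n) auto
    have "nx n x (\<lambda>ys. winF F n ys) = pop h x" for x
      unfolding k nx_Suc pop_def h_def headF_def by simp
    then show ?thesis by (simp add: sx_Suc nx_cmult ip_def mult.assoc)
  qed
  have E: "energy h h = sx (Suc n) (\<lambda>xs. h (hd xs) * diffF F n xs)"
    unfolding diffF_def right_diff_distrib sx_diff 1 2 energy_pop ..
  have "sx (Suc n) (\<lambda>xs. h (hd xs) * diffF F n xs) = sx (Suc n) (\<lambda>xs. h (hd (rev xs)) * diffF F n (rev xs))"
    by (rule sx_rev[symmetric]) simp
  also have "\<dots> = sx (Suc n) (\<lambda>xs. - (h (last xs) * diffF F n xs))"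
  proof (rule sx_cong)
    fix xs assume xs: "xs \<in> lists_of (Suc n)"
    then have "xs \<noteq> []" by (auto simp: lists_of_def)
    then show "h (hd (rev xs)) * diffF F n (rev xs) = - (h (last xs) * diffF F n xs)"
      by (simp add: diffF_def r[OF xs] hd_rev algebra_simps)
  qed
  finally have "2 * energy h h = sx (Suc n) (\<lambda>xs. h (hd xs) * diffF F n xs + - (h (last xs) * diffF F n xs))"
    unfolding sx_add using E by simp
  \<comment> \<open>The Young weight is chosen so that \<open>sx_ends\<close> turns the first term
    into exactly one \<open>energy h h\<close>, half of the left side.\<close>
  also have "\<dots> \<le> sx (Suc n) (\<lambda>xs. 1 / (2 * real n) * (h (hd xs) - h (last xs))\<^sup>2
      + real n / 2 * (diffF F n xs)\<^sup>2)"
  proof (rule sx_mono)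
    fix xs
    define a where "a = h (hd xs) - h (last xs)"
    define b where "b = diffF F n xs"
    have "0 \<le> (a - real n * b)\<^sup>2 / (2 * real n)" by simp
    also have "\<dots> = 1 / (2 * real n) * a\<^sup>2 + real n / 2 * b\<^sup>2 - a * b"
      using n by (simp add: power2_eq_square field_simps)
    finally show "h (hd xs) * diffF F n xs + - (h (last xs) * diffF F n xs) \<le>
        1 / (2 * real n) * (h (hd xs) - h (last xs))\<^sup>2 + real n / 2 * (diffF F n xs)\<^sup>2"
      unfolding a_def b_def by (simp add: algebra_simps)
  qed simp
  also have "\<dots> = 1 / (2 * real n) * sx (Suc n) (\<lambda>xs. (h (hd xs) - h (last xs))\<^sup>2) + real n / 2 * dirF F n"
    by (simp only: sx_add sx_cmult dirF_def)
  also have "\<dots> \<le> 1 / (2 * real n) * (2 * real n * energy h h) + real n / 2 * dirF F n"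
    by (intro add_right_mono mult_left_mono sx_ends) auto
  also have "\<dots> = energy h h + real n / 2 * dirF F n" using n by simp
  finally show ?thesis unfolding h_def by simp
qed

lemma sx_disjoint_windows:
  assumes n: "0 < n"
  shows "sx (n + n) (\<lambda>xs. (winF F n xs - winF F n (drop n xs))\<^sup>2) \<le> (real n)\<^sup>2 * dirF F n"
proof -
  have "sx (n + n) (\<lambda>xs. (winF F n xs - winF F n (drop n xs))\<^sup>2) \<le>
     sx (n + n) (\<lambda>xs. real n * (\<Sum>i<n. (diffF F n (take (Suc n) (drop i xs)))\<^sup>2))"
  proof (rule sx_mono)
    fix xs assume xs: "xs \<in> lists_of (n + n)"
    have "diffF F n (take (Suc n) (drop i xs)) = winF F n (drop i xs) - winF F n (drop (Suc i) xs)" for i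
    proof -
      have "tl (take (Suc n) (drop i xs)) = take n (drop (Suc i) xs)" by (simp add: tl_take tl_drop drop_Suc)
      then show ?thesis by (simp add: diffF_def winF_def min_absorb1)
    qed
    then have "(\<Sum>i<n. diffF F n (take (Suc n) (drop i xs))) = winF F n xs - winF F n (drop n xs)"
      using sum_lessThan_telescope'[of "\<lambda>i. winF F n (drop i xs)" n] by simp
    then show "(winF F n xs - winF F n (drop n xs))\<^sup>2
        \<le> real n * (\<Sum>i<n. (diffF F n (take (Suc n) (drop i xs)))\<^sup>2)"
      using sum_sq_le[of "\<lambda>i. diffF F n (take (Suc n) (drop i xs))" n] by simp
  qed (use n in simp)
  also have "\<dots> = real n * (\<Sum>i<n. dirF F n)"
    unfolding sx_cmult sx_sum dirF_def
    by (intro arg_cong2[where f = "(*)"] refl sum.cong sx_window[where \<Phi> = "\<lambda>xs. (diffF F n xs)\<^sup>2"]) auto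
  also have "\<dots> = (real n)\<^sup>2 * dirF F n" by (simp add: power2_eq_square)
  finally show ?thesis .
qed

text \<open>Markov property at the border of two adjacent windows. The conditional mean of the left
  window given its last entry is again \<open>headF\<close>, because reversal preserves the
  counts.\<close>

lemma sx_product_windows:
  assumes n: "0 < n"
  shows "sx (n + n) (\<lambda>xs. winF F n xs * winF F n (drop n xs)) = ip (headF F n) (pop (headF F n))"
proof -
  define h where "h = headF F n"
  obtain k where k: "n = Suc k" using n by (cases n) auto
  have nxn: "nx n x (winF F n) = pop h x" for x
    unfolding k nx_Suc pop_def h_def headF_def by simp
  have "sx (Suc k + n) (\<lambda>xs. winF F n xs * winF F n (drop n xs)) =
      sx (Suc k) (\<lambda>us. winF F n us * pop h (last us))"
    unfolding add_Suc sx_Suc nx_append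
  proof (intro sum.cong refl arg_cong2[where f = "(*)"] nx_cong)
    fix x us assume us: "us \<in> lists_of k"
    have "nx n (last (x # us)) (\<lambda>vs. winF F n (x # us @ vs) * winF F n (drop n (x # us @ vs))) =
       nx n (last (x # us)) (\<lambda>vs. winF F n (x # us) * winF F n vs)"
      by (rule nx_cong) (use us in \<open>simp add: lists_of_def winF_def k\<close>)
    then show "nx n (last (x # us)) (\<lambda>vs. winF F n (x # us @ vs) * winF F n (drop n (x # us @ vs))) =
      winF F n (x # us) * pop h (last (x # us))" by (simp only: nx_cmult nxn)
  qed
  also have "\<dots> = sx n (\<lambda>us. winF F n (rev us) * pop h (last (rev us)))"
    unfolding k[symmetric] by (rule sx_rev[OF n, symmetric])
  also have "\<dots> = sx n (\<lambda>us. pop h (hd us) * winF F n us)"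
    by (rule sx_cong) (use n in \<open>auto simp: lists_of_def winF_rev last_rev\<close>)
  also have "\<dots> = ip (pop h) h" unfolding sx_hd_window[OF n] h_def ..
  finally show ?thesis by (simp add: k[symmetric] h_def ip_sym)
qed

lemma mean_headF: "0 < n \<Longrightarrow> mean (headF F n) = sx n (winF F n)"
  by (cases n) (auto simp: mean_def headF_def sx_Suc)

lemma winF_shift: "winF (\<lambda>k. F k - c) n xs = winF F n xs - c"
  by (simp add: winF_def)

lemma dirF_shift: "dirF (\<lambda>k. F k - c) n = dirF F n"
  by (simp add: dirF_def diffF_def winF_shift)

text \<open>For centred \<open>F\<close> the variance is half the mean square difference of two
  adjacent windows plus their covariance \<open>ip h (pop h)\<close>. The latter is at most
  \<open>ip h h\<close>, which the gap controls by the energy of \<open>h\<close>.\<close>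

lemma varF_short:
  assumes n: "0 < n" and g: "0 < g" and gap: "\<And>f. g * vari f \<le> energy f f"
  shows "varF F n \<le> ((real n)\<^sup>2 / 2 + real n / (2 * g)) * dirF F n"
proof -
  define G where "G = (\<lambda>k. F k - sx n (winF F n))"
  have D: "dirF G n = dirF F n" unfolding G_def by (rule dirF_shift)
  have z: "sx n (winF G n) = 0"
    unfolding G_def winF_shift sx_diff by (simp add: sx_const[OF n])
  have V: "varF F n = sx n (\<lambda>xs. (winF G n xs)\<^sup>2)" by (simp add: varF_def G_def winF_shift)
  define h where "h = headF G n"
  have E: "energy h h \<le> real n * dirF F n / 2" using headF_energy[OF n, of G] D by (simp add: h_def)
  have "mean h = 0" using mean_headF[OF n] z by (simp add: h_def)
  then have hh: "g * ip h h \<le> energy h h" using gap[of h] by (simp add: vari_def)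
  have "sx (n + n) (\<lambda>xs. (winF G n xs - winF G n (drop n xs))\<^sup>2) =
    sx (n + n) (\<lambda>xs. (winF G n xs)\<^sup>2 + (winF G n (drop n xs))\<^sup>2 - 2 * (winF G n xs * winF G n (drop n xs)))"
    by (rule sx_cong) (simp add: power2_diff)
  also have "\<dots> = varF F n + varF F n - 2 * ip h (pop h)"
  proof -
    have "sx (n + n) (\<lambda>xs. (winF G n xs)\<^sup>2) = sx (n + n) (\<lambda>xs. (winF G n (take n xs))\<^sup>2)"
      by (simp add: winF_def)
    also have "\<dots> = varF F n" unfolding V using n by (intro sx_take[where \<Phi> = "\<lambda>xs. (winF G n xs)\<^sup>2"]) auto
    finally show ?thesis
      unfolding sx_diff sx_add sx_cmult sx_product_windows[OF n] h_def
      by (simp add: V sx_drop[OF n, where \<Phi> = "\<lambda>xs. (winF G n xs)\<^sup>2"])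
  qed
  finally have "2 * varF F n \<le> (real n)\<^sup>2 * dirF F n + 2 * ip h (pop h)"
    using sx_disjoint_windows[OF n, of G] D by simp
  moreover have "ip h (pop h) \<le> ip h h" using energy_nonneg[of h] by (simp add: energy_pop)
  moreover have "ip h h \<le> real n * dirF F n / (2 * g)"
    using order_trans[OF hh E] g by (simp add: field_simps)
  ultimately show ?thesis by (simp add: algebra_simps)
qed

end

context rev_chain
begin

subsection \<open>Expected hitting times\<close>

lemma two_point_vari:
  assumes y: "y \<in> S" and z: "z \<in> S" and "y \<noteq> z"
  shows "(f y - f z)\<^sup>2 \<le> (1 / \<pi> y + 1 / \<pi> z) * vari f"
proof -
  define a where "a = f y - mean f"
  define b where "b = f z - mean f"
  have py: "0 < \<pi> y" and pz: "0 < \<pi> z" using y z pi_pos by auto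
  have "(\<Sum>x\<in>{y, z}. \<pi> x * (f x - mean f) * (f x - mean f)) \<le> vari f"
    unfolding ip_mean_shift[symmetric] ip_def
    by (rule sum_mono2[OF fin_S]) (use y z pi_pos in \<open>auto simp: mult.assoc less_imp_le\<close>)
  then have v: "\<pi> y * a\<^sup>2 + \<pi> z * b\<^sup>2 \<le> vari f"
    using assms(3) by (simp add: a_def b_def power2_eq_square mult.assoc)
  have "0 \<le> (\<pi> y * a + \<pi> z * b)\<^sup>2 / (\<pi> y * \<pi> z)" using py pz by simp
  also have "\<dots> = (1 / \<pi> y + 1 / \<pi> z) * (\<pi> y * a\<^sup>2 + \<pi> z * b\<^sup>2) - (a - b)\<^sup>2"
    using py pz by (simp add: power2_eq_square field_simps)
  also have "\<dots> \<le> (1 / \<pi> y + 1 / \<pi> z) * vari f - (a - b)\<^sup>2"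
    using v py pz by (intro diff_right_mono mult_left_mono) auto
  finally show ?thesis by (simp add: a_def b_def)
qed

text \<open>Truncated Green function of the chain killed at \<open>z\<close>: the expected number of
  visits to \<open>y\<close> at times below \<open>t\<close> and before \<open>z\<close> is
  hit.\<close>

primrec green :: "'a \<Rightarrow> 'a \<Rightarrow> nat \<Rightarrow> 'a \<Rightarrow> real" where
  "green z y 0 = (\<lambda>_. 0)"
| "green z y (Suc t) = (\<lambda>x. if x = z then 0 else (if x = y then 1 else 0) + pop (green z y t) x)"

lemma pop_mono: "x \<in> S \<Longrightarrow> (\<And>y. y \<in> S \<Longrightarrow> f y \<le> g y) \<Longrightarrow> pop f x \<le> pop g x"
  unfolding pop_def by (intro sum_mono mult_left_mono p_nonneg) auto

lemma pop_const: "x \<in> S \<Longrightarrow> pop (\<lambda>_. c) x = c"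
  by (simp add: pop_def sum_distrib_right[symmetric] p_row)

lemma green_z: "green z y t z = 0"
  by (cases t) auto

lemma green_nonneg: "x \<in> S \<Longrightarrow> 0 \<le> green z y t x"
proof (induction t arbitrary: x)
  case (Suc t)
  have "pop (\<lambda>_. 0) x \<le> pop (green z y t) x" using Suc by (intro pop_mono) auto
  then show ?case using Suc.prems by (simp add: pop_const)
qed simp

lemma green_mono: "x \<in> S \<Longrightarrow> green z y t x \<le> green z y (Suc t) x"
proof (induction t arbitrary: x)
  case 0
  then show ?case using green_nonneg[of x z y "Suc 0"] by simp
next
  case (Suc t)
  have "pop (green z y t) x \<le> pop (green z y (Suc t)) x" using Suc by (intro pop_mono) auto
  then show ?case by simp
qed

lemma green_max: "x \<in> S \<Longrightarrow> y \<in> S \<Longrightarrow> green z y t x \<le> green z y t y"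
proof (induction t arbitrary: x)
  case (Suc t)
  show ?case
  proof (cases "x = y \<or> x = z")
    case True
    then show ?thesis using green_nonneg[OF Suc.prems(2), of z y "Suc t"] by auto
  next
    case False
    have "pop (green z y t) x \<le> pop (\<lambda>_. green z y t y) x"
      using Suc by (intro pop_mono) auto
    also have "\<dots> = green z y t y" using Suc.prems by (simp add: pop_const)
    also have "\<dots> \<le> green z y (Suc t) y" by (rule green_mono[OF Suc.prems(2)])
    finally show ?thesis using False by simp
  qed
qed simp

text \<open>Monotonicity in \<open>t\<close> makes the truncated function a subsolution of the
  equation for the full Green function off \<open>z\<close>, and it vanishes at \<open>z\<close>;
  the bound results from pairing it with itself.\<close>

lemma green_energy: 
  assumes y: "y \<in> S"
  shows "energy (green z y t) (green z y t) \<le> \<pi> y * green z y t y"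
proof -
  define f where "f = green z y t"
  have le: "f x * f x \<le> f x * ((if x = y then 1 else 0) + pop f x)" if x: "x \<in> S" for x
  proof (cases t)
    case 0 then show ?thesis by (simp add: f_def)
  next
    case (Suc s)
    have "pop (green z y s) x \<le> pop f x"
      unfolding f_def Suc using x green_mono by (intro pop_mono) auto
    then have "f x \<le> (if x = y then 1 else 0) + pop f x" if "x \<noteq> z"
      using that unfolding f_def Suc by simp
    moreover have "f x = 0" if "x = z" using that by (simp add: f_def green_z)
    moreover have "0 \<le> f x" using green_nonneg[OF x] by (simp add: f_def)
    ultimately show ?thesis by (cases "x = z") (auto intro: mult_left_mono)
  qed
  have "ip f f \<le> (\<Sum>x\<in>S. \<pi> x * (f x * ((if x = y then 1 else 0) + pop f x)))"
    unfolding ip_def mult.assoc by (intro sum_mono mult_left_mono le less_imp_le[OF pi_pos])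
  also have "\<dots> = (\<Sum>x\<in>S. (if x = y then \<pi> x * f x else 0) + \<pi> x * f x * pop f x)"
    by (rule sum.cong) (auto simp: algebra_simps)
  also have "\<dots> = \<pi> y * f y + ip f (pop f)"
    using y fin_S by (simp add: sum.distrib ip_def)
  finally show ?thesis unfolding f_def[symmetric] by (simp add: energy_pop)
qed

text \<open>The energy bound is linear in \<open>f y\<close>, while the two-point bound, with
  \<open>f z = 0\<close>, is quadratic in it. Together they bound \<open>f y\<close>, and the
  maximum principle extends this to all \<open>x\<close>.\<close>

lemma green_bound:
  assumes y: "y \<in> S" and z: "z \<in> S" and yz: "y \<noteq> z" and x: "x \<in> S"
    and g: "0 < g" and gap: "\<And>f. g * vari f \<le> energy f f"
  shows "green z y t x \<le> (1 + \<pi> y / \<pi> z) / g"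
proof -
  define f where "f = green z y t"
  have py: "0 < \<pi> y" and pz: "0 < \<pi> z" using y z pi_pos by auto
  have f0: "0 \<le> f y" using green_nonneg[OF y] by (simp add: f_def)
  have "g * vari f \<le> \<pi> y * f y" using gap[of f] green_energy[OF y, of z t] by (simp add: f_def)
  then have v: "vari f \<le> \<pi> y * f y / g" using g by (simp add: field_simps)
  have "f y * f y = (f y - f z)\<^sup>2" by (simp add: f_def green_z power2_eq_square)
  also have "\<dots> \<le> (1 / \<pi> y + 1 / \<pi> z) * vari f" by (rule two_point_vari[OF y z yz])
  also have "\<dots> \<le> (1 / \<pi> y + 1 / \<pi> z) * (\<pi> y * f y / g)"
    using v py pz by (intro mult_left_mono) auto
  also have "\<dots> = (1 + \<pi> y / \<pi> z) / g * f y" using py pz g by (simp add: field_simps)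
  finally have "f y * f y \<le> (1 + \<pi> y / \<pi> z) / g * f y" .
  then have "f y \<le> (1 + \<pi> y / \<pi> z) / g"
    using f0 py pz g by (cases "f y = 0") (auto intro: mult_right_le_imp_le)
  moreover have "f x \<le> f y" using green_max[OF x y] by (simp add: f_def)
  ultimately show ?thesis by (simp add: f_def)
qed

text \<open>Up to the upper bound \<open>\<tau>\<close>, this characterizes the expected hitting time of \<open>z\<close>.\<close>

definition potential :: "'a \<Rightarrow> real \<Rightarrow> ('a \<Rightarrow> real) \<Rightarrow> bool" where
  "potential z \<tau> \<phi> \<longleftrightarrow> \<phi> z = 0 \<and>
     (\<forall>x\<in>S. 0 \<le> \<phi> x \<and> \<phi> x \<le> \<tau> \<and> (x \<noteq> z \<longrightarrow> \<phi> x = 1 + pop \<phi> x))"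

lemma potentialD:
  assumes "potential z \<tau> \<phi>"
  shows "\<phi> z = 0" "\<And>x. x \<in> S \<Longrightarrow> 0 \<le> \<phi> x" "\<And>x. x \<in> S \<Longrightarrow> \<phi> x \<le> \<tau>"
    "\<And>x. x \<in> S \<Longrightarrow> x \<noteq> z \<Longrightarrow> \<phi> x = 1 + pop \<phi> x"
  using assms by (auto simp: potential_def)

text \<open>The hitting time is the sum of the Green functions over \<open>y \<noteq> z\<close>,
  with the truncation removed by monotone convergence. Summing \<open>1 + \<pi> y / \<pi> z\<close>
  over \<open>y\<close> produces \<open>card S + 1 / \<pi> z\<close>.\<close>

lemma hitting_potential:
  assumes z: "z \<in> S" and g: "0 < g" and gap: "\<And>f. g * vari f \<le> energy f f"
  obtains \<phi> where "potential z ((real (card S) + 1 / \<pi> z) / g) \<phi>"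
proof -
  define s where "s t x = (\<Sum>y\<in>S - {z}. green z y t x)" for t x
  define K where "K = (real (card S) + 1 / \<pi> z) / g"
  have pz: "0 < \<pi> z" using z pi_pos by auto
  have nn: "0 \<le> s t x" if "x \<in> S" for t x unfolding s_def using that by (intro sum_nonneg green_nonneg)
  have K: "s t x \<le> K" if x: "x \<in> S" for t x
  proof -
    have "s t x \<le> (\<Sum>y\<in>S - {z}. (1 + \<pi> y / \<pi> z) / g)"
      unfolding s_def by (intro sum_mono green_bound[OF _ z _ x g gap]) auto
    also have "\<dots> \<le> (\<Sum>y\<in>S. (1 + \<pi> y / \<pi> z) / g)"
      by (rule sum_mono2[OF fin_S]) (use g pz pi_pos in \<open>auto intro!: divide_nonneg_pos add_nonneg_nonneg less_imp_le\<close>)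
    also have "\<dots> = K"
      unfolding K_def by (simp add: sum_divide_distrib[symmetric] sum.distrib pi_sum)
    finally show ?thesis .
  qed
  have step: "s (Suc t) x = 1 + pop (s t) x" if "x \<in> S" "x \<noteq> z" for t x
  proof -
    have "s (Suc t) x = (\<Sum>y\<in>S - {z}. if x = y then 1 else 0) + (\<Sum>y\<in>S - {z}. pop (green z y t) x)"
      using that by (simp add: s_def sum.distrib)
    also have "(\<Sum>y\<in>S - {z}. if x = y then 1 else (0::real)) = 1" using that fin_S by simp
    also have "(\<Sum>y\<in>S - {z}. pop (green z y t) x) = pop (s t) x"
      unfolding pop_def s_def sum_distrib_left by (rule sum.swap)
    finally show ?thesis .
  qed
  have "\<exists>l. (\<lambda>t. s t x) \<longlonglongrightarrow> l" if x: "x \<in> S" for x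
  proof -
    have "incseq (\<lambda>t. s t x)"
      unfolding incseq_Suc_iff s_def using green_mono[OF x] by (auto intro: sum_mono)
    then show ?thesis using incseq_convergent[of "\<lambda>t. s t x" K] K[OF x] by blast
  qed
  then obtain \<phi> where lim: "\<And>x. x \<in> S \<Longrightarrow> (\<lambda>t. s t x) \<longlonglongrightarrow> \<phi> x" by metis
  show thesis
  proof (rule that, unfold potential_def, intro conjI ballI impI)
    have "(\<lambda>t. s t z) \<longlonglongrightarrow> \<phi> z" by (rule lim[OF z])
    moreover have "(\<lambda>t. s t z) = (\<lambda>t. 0)" by (simp add: s_def green_z)
    ultimately show "\<phi> z = 0" by (metis LIMSEQ_unique tendsto_const)
    show "0 \<le> \<phi> x" if "x \<in> S" for x
      using lim[OF that] nn[OF that] by (intro LIMSEQ_le_const) auto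
    show "\<phi> x \<le> (real (card S) + 1 / \<pi> z) / g" if "x \<in> S" for x
      using lim[OF that] K[OF that] unfolding K_def by (intro LIMSEQ_le_const2) auto
    show "\<phi> x = 1 + pop \<phi> x" if x: "x \<in> S" "x \<noteq> z" for x
    proof -
      have "(\<lambda>t. 1 + pop (s t) x) \<longlonglongrightarrow> 1 + pop \<phi> x"
        unfolding pop_def by (intro tendsto_intros lim)
      then have "(\<lambda>t. s (Suc t) x) \<longlonglongrightarrow> 1 + pop \<phi> x" by (simp add: step[OF x])
      moreover have "(\<lambda>t. s (Suc t) x) \<longlonglongrightarrow> \<phi> x" using lim[OF x(1)] by (rule LIMSEQ_Suc)
      ultimately show ?thesis by (rule LIMSEQ_unique[rotated])
    qed
  qed
qed

definition varz :: "('a multiset \<Rightarrow> real) \<Rightarrow> nat \<Rightarrow> 'a \<Rightarrow> real" where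
  "varz F n z = nx (n - 1) z (\<lambda>ys. (winF F n (z # ys) - headF F n z)\<^sup>2)"

text \<open>The potential solves the Poisson equation
  \<open>(1 - P) \<phi> = 1 - delta z / \<pi> z\<close>, hence
  \<open>mean f - f z = ip \<phi> (f - pop f)\<close>. For \<open>f\<close> the conditional second
  moment about \<open>c\<close>, the right side is an expectation of \<open>\<phi>\<close> times an
  increment between consecutive windows.\<close>

lemma varF_le_varz:
  assumes n: "0 < n" and z: "z \<in> S"
    and pot: "potential z \<tau> \<phi>"
  shows "varF F n \<le> 2 * varz F n z + 4 * \<tau>\<^sup>2 * dirF F n"
proof -
  note \<phi> = potentialD[OF pot]
  define c where "c = headF F n z"
  define f where "f x = nx (n - 1) x (\<lambda>ys. (winF F n (x # ys) - c)\<^sup>2)" for x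
  define M where "M = sx n (\<lambda>xs. (winF F n xs - c)\<^sup>2)"
  obtain k where k: "n = Suc k" using n by (cases n) auto
  have fz: "f z = varz F n z" by (simp add: f_def varz_def c_def)
  have M: "M = mean f" unfolding M_def f_def mean_def k by (simp add: sx_Suc)
  have pop_f: "pop f x = nx n x (\<lambda>ys. (winF F n ys - c)\<^sup>2)" for x
    by (simp add: pop_def f_def k nx_Suc)
  have f_n: "f x = nx n x (\<lambda>ys. (winF F n (x # ys) - c)\<^sup>2)" if x: "x \<in> S" for x
  proof -
    have "nx n x (\<lambda>ys. (winF F n (x # ys) - c)\<^sup>2) = nx n x (\<lambda>ys. (winF F n (x # take k ys) - c)\<^sup>2)"
      by (simp add: winF_def k)
    also have "\<dots> = f x" unfolding f_def k
        using nx_take[OF x, of k "Suc k" "\<lambda>ys. (winF F (Suc k) (x # ys) - c)\<^sup>2"] by simp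
    finally show ?thesis by simp
  qed
  have id: "mean f = f z + (ip \<phi> f - ip \<phi> (pop f))"
  proof -
    have split: "(\<Sum>x\<in>S. \<pi> x * h x * (\<phi> x - pop \<phi> x))
        = (\<Sum>x\<in>S. \<pi> x * h x) - \<pi> z * h z - \<pi> z * h z * pop \<phi> z" for h
    proof -
      have "(\<Sum>x\<in>S. \<pi> x * h x * (\<phi> x - pop \<phi> x)) = \<pi> z * h z * (\<phi> z - pop \<phi> z)
          + (\<Sum>x\<in>S - {z}. \<pi> x * h x * (\<phi> x - pop \<phi> x))"
        by (rule sum.remove[OF fin_S z])
      also have "(\<Sum>x\<in>S - {z}. \<pi> x * h x * (\<phi> x - pop \<phi> x)) = (\<Sum>x\<in>S - {z}. \<pi> x * h x)"
        by (rule sum.cong) (use \<phi>(4) in auto)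
      also have "\<dots> = (\<Sum>x\<in>S. \<pi> x * h x) - \<pi> z * h z" using sum.remove[OF fin_S z, of "\<lambda>x. \<pi> x * h x"] by simp
      finally show ?thesis using \<phi>(1) by simp
    qed
    have "ip (\<lambda>_. 1) \<phi> - ip (\<lambda>_. 1) (pop \<phi>) = 0"
      unfolding pop_sym[of "\<lambda>_. 1"] by (simp add: ip_def pop_const)
    then have "(\<Sum>x\<in>S. \<pi> x * 1 * (\<phi> x - pop \<phi> x)) = 0"
      by (simp add: ip_def right_diff_distrib sum_subtractf)
    \<comment> \<open>Kac's formula: the mean return time \<open>1 + pop \<phi> z\<close> is
      \<open>1 / \<pi> z\<close>.\<close>
    then have e: "\<pi> z * pop \<phi> z = 1 - \<pi> z" unfolding split by (simp add: pi_sum)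
    have "ip \<phi> f - ip \<phi> (pop f) = (\<Sum>x\<in>S. \<pi> x * f x * (\<phi> x - pop \<phi> x))"
      unfolding pop_sym[of \<phi> f] by (simp add: ip_def algebra_simps sum_subtractf)
    also have "\<dots> = mean f - \<pi> z * f z - (\<pi> z * pop \<phi> z) * f z" unfolding split by (simp add: mean_def mult_ac)
    also have "\<dots> = mean f - f z" unfolding e by (simp add: algebra_simps)
    finally show ?thesis by simp
  qed
  have \<tau>0: "0 \<le> \<tau>" using \<phi>(3)[OF z] \<phi>(1) by simp
  have "ip \<phi> f - ip \<phi> (pop f)
      = sx (Suc n) (\<lambda>xs. \<phi> (hd xs) * ((winF F n xs - c)\<^sup>2 - (winF F n (tl xs) - c)\<^sup>2))"
    by (simp add: sx_Suc nx_cmult nx_diff pop_f f_n[symmetric] ip_def sum_subtractf[symmetric] algebra_simps)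
  \<comment> \<open>The coefficient \<open>1 / 2\<close> allows the second moment \<open>M\<close>
    to be absorbed into the left side at the end.\<close>
  also have "\<dots> \<le> sx (Suc n) (\<lambda>xs. 1 / 2 * (winF F n xs - c)\<^sup>2 + 2 * \<tau>\<^sup>2 * (diffF F n xs)\<^sup>2)"
  proof (rule sx_mono)
    fix xs assume xs: "xs \<in> lists_of (Suc n)"
    define u where "u = winF F n xs - c"
    define d where "d = diffF F n xs"
    have hd: "hd xs \<in> S" using xs by (auto elim: lists_of_SucE)
    have v: "winF F n (tl xs) - c = u - d" by (simp add: u_def d_def diffF_def)
    have "u\<^sup>2 - (u - d)\<^sup>2 \<le> 2 * (\<bar>u\<bar> * \<bar>d\<bar>)"
    proof -
      have "u\<^sup>2 - (u - d)\<^sup>2 = 2 * (u * d) - d\<^sup>2" by (simp add: power2_diff)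
      moreover have "u * d \<le> \<bar>u\<bar> * \<bar>d\<bar>" using abs_ge_self[of "u * d"] by (simp add: abs_mult)
      moreover have "0 \<le> d\<^sup>2" by simp
      ultimately show ?thesis by linarith
    qed
    then have "\<phi> (hd xs) * (u\<^sup>2 - (u - d)\<^sup>2) \<le> \<phi> (hd xs) * (2 * (\<bar>u\<bar> * \<bar>d\<bar>))"
      by (rule mult_left_mono) (rule \<phi>(2)[OF hd])
    also have "\<dots> \<le> \<tau> * (2 * (\<bar>u\<bar> * \<bar>d\<bar>))" using \<phi>(3)[OF hd] by (intro mult_right_mono) auto
    also have "\<dots> \<le> 1 / 2 * u\<^sup>2 + 2 * \<tau>\<^sup>2 * d\<^sup>2"
    proof -
      have "0 \<le> (\<bar>u\<bar> - 2 * \<tau> * \<bar>d\<bar>)\<^sup>2 / 2" by simp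
      also have "\<dots> = 1 / 2 * u\<^sup>2 + 2 * \<tau>\<^sup>2 * d\<^sup>2 - \<tau> * (2 * (\<bar>u\<bar> * \<bar>d\<bar>))"
        by (simp add: power2_diff power_mult_distrib field_simps)
      finally show ?thesis by simp
    qed
    finally show "\<phi> (hd xs) * ((winF F n xs - c)\<^sup>2 - (winF F n (tl xs) - c)\<^sup>2) \<le>
        1 / 2 * (winF F n xs - c)\<^sup>2 + 2 * \<tau>\<^sup>2 * (diffF F n xs)\<^sup>2"
      unfolding v unfolding u_def d_def .
  qed simp
  also have "\<dots> = 1 / 2 * sx (Suc n) (\<lambda>xs. (winF F n xs - c)\<^sup>2) + 2 * \<tau>\<^sup>2 * dirF F n"
    by (simp only: sx_add sx_cmult dirF_def)
  also have "sx (Suc n) (\<lambda>xs. (winF F n xs - c)\<^sup>2) = M"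
    unfolding M_def using sx_take[OF n, of "Suc n" "\<lambda>xs. (winF F n xs - c)\<^sup>2"] by (simp add: winF_def)
  finally have "M \<le> f z + (1 / 2 * M + 2 * \<tau>\<^sup>2 * dirF F n)" using id M by simp
  moreover have "varF F n \<le> M" unfolding M_def by (rule varF_le[OF n])
  ultimately show ?thesis by (simp add: fz)
qed

subsection \<open>Excursions from a fixed state\<close>

text \<open>
  In \<open>run\<close> and \<open>sq\<close> the chain extends the list \<open>w\<close> at its front, until it hits \<open>z\<close> or has made
  \<open>i\<close> steps. By reversibility, such an extension of a path started in \<open>z\<close> is again a path.
\<close>

primrec run :: "('a multiset \<Rightarrow> real) \<Rightarrow> nat \<Rightarrow> 'a \<Rightarrow> real \<Rightarrow> nat \<Rightarrow> 'a \<Rightarrow> 'a list \<Rightarrow> real" where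
  "run F n z c 0 x w = (winF F n w - c)\<^sup>2"
| "run F n z c (Suc i) x w =
     (if x = z then (winF F n w - c)\<^sup>2 else \<Sum>y\<in>S. p x y * run F n z c i y (y # w))"

primrec sq :: "('a multiset \<Rightarrow> real) \<Rightarrow> nat \<Rightarrow> 'a \<Rightarrow> nat \<Rightarrow> 'a \<Rightarrow> 'a list \<Rightarrow> real" where
  "sq F n z 0 x w = 0"
| "sq F n z (Suc i) x w =
     (if x = z then 0 else \<Sum>y\<in>S. p x y * ((diffF F n (y # w))\<^sup>2 + sq F n z i y (y # w)))"

text \<open>An excursion starts in \<open>z\<close>, where \<open>sq\<close> would stop at once, so
  its first step is forced.\<close>

definition sq0 :: "('a multiset \<Rightarrow> real) \<Rightarrow> nat \<Rightarrow> 'a \<Rightarrow> nat \<Rightarrow> 'a list \<Rightarrow> real" where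
  "sq0 F n z i w =
     (case i of 0 \<Rightarrow> 0 | Suc i \<Rightarrow> \<Sum>y\<in>S. p z y * ((diffF F n (y # w))\<^sup>2 + sq F n z i y (y # w)))"

text \<open>
  A Hardy inequality along an excursion: \<open>1 + \<phi> x / \<tau>\<close> serves as a Bellman potential.
\<close>

lemma run_le_sq:
  assumes \<tau>: "0 < \<tau>" and x: "x \<in> S"
    and pot: "potential z \<tau> \<phi>"
  shows "run F n z c i x w \<le> (1 + \<phi> x / \<tau>) * (winF F n w - c)\<^sup>2 + (4 * \<tau> + 2) * sq F n z i x w"
  using x
proof (induction i arbitrary: x w)
  case (0 x)
  have "0 \<le> \<phi> x / \<tau> * (winF F n w - c)\<^sup>2" using potentialD(2)[OF pot 0] \<tau> by simp
  then show ?case by (simp add: algebra_simps)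
next
  case (Suc i)
  note \<phi> = potentialD[OF pot]
  show ?case
  proof (cases "x = z")
    case True
    then show ?thesis using \<phi>(1) by simp
  next
    case False
    \<comment> \<open>With this \<open>C\<close> a step raises the coefficient of
      \<open>A\<^sup>2\<close> by \<open>1 / \<tau>\<close>; averaging over \<open>y\<close> and
      \<open>\<phi> x = 1 + pop \<phi> x\<close> restore it to
      \<open>1 + \<phi> x / \<tau>\<close>.\<close>
    define C where "C = 4 * \<tau> + 2"
    define A where "A = winF F n w - c"
    define d where "d y = diffF F n (y # w)" for y
    have "run F n z c (Suc i) x w = (\<Sum>y\<in>S. p x y * run F n z c i y (y # w))" using False by simp
    also have "\<dots> \<le> (\<Sum>y\<in>S. p x y * ((1 + \<phi> y / \<tau> + 1 / \<tau>) * A\<^sup>2 + C * ((d y)\<^sup>2 + sq F n z i y (y # w))))"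
    proof (intro sum_mono mult_left_mono p_nonneg Suc.prems)
      fix y assume y: "y \<in> S"
      have e: "winF F n (y # w) - c = A + d y" by (simp add: A_def d_def diffF_def)
      have "run F n z c i y (y # w) \<le> (1 + \<phi> y / \<tau>) * (A + d y)\<^sup>2 + C * sq F n z i y (y # w)"
        using Suc.IH[OF y, of "y # w"] unfolding e C_def .
      also have "(1 + \<phi> y / \<tau>) * (A + d y)\<^sup>2 \<le> (1 + \<phi> y / \<tau> + 4 / (C - 2)) * A\<^sup>2 + C * (d y)\<^sup>2"
        by (rule square_shift_le) (use \<phi>(2,3)[OF y] \<tau> in \<open>auto simp: C_def\<close>)
      finally show "run F n z c i y (y # w) \<le>
          (1 + \<phi> y / \<tau> + 1 / \<tau>) * A\<^sup>2 + C * ((d y)\<^sup>2 + sq F n z i y (y # w))"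
        using \<tau> by (simp add: C_def algebra_simps)
    qed
    also have "\<dots> = (\<Sum>y\<in>S. p x y * (1 + \<phi> y / \<tau> + 1 / \<tau>)) * A\<^sup>2 + C * sq F n z (Suc i) x w"
      using False by (simp add: d_def sum.distrib sum_distrib_left sum_distrib_right algebra_simps)
    also have "(\<Sum>y\<in>S. p x y * (1 + \<phi> y / \<tau> + 1 / \<tau>)) = (\<Sum>y\<in>S. p x y * (1 + 1 / \<tau>) + p x y * \<phi> y / \<tau>)"
      by (rule sum.cong) (auto simp: algebra_simps)
    also have "\<dots> = 1 + 1 / \<tau> + pop \<phi> x / \<tau>"
      by (simp add: sum.distrib sum_distrib_right[symmetric] p_row[OF Suc.prems] pop_def sum_divide_distrib)
    also have "\<dots> = 1 + \<phi> x / \<tau>" using \<phi>(4)[OF Suc.prems False] \<tau> by (simp add: field_simps)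
    finally show ?thesis by (simp add: A_def C_def)
  qed
qed

text \<open>Centred at the window of \<open>w\<close> itself, the deviation after the first step is
  a single \<open>diffF\<close>, so nothing beyond \<open>sq0\<close> is left.\<close>

lemma run_start_le_sq0:
  assumes \<tau>: "0 < \<tau>" and z: "z \<in> S"
    and pot: "potential z \<tau> \<phi>"
  shows "(\<Sum>y\<in>S. p z y * run F n z (winF F n w) i y (y # w)) \<le> (4 * \<tau> + 2) * sq0 F n z (Suc i) w"
proof -
  note \<phi> = potentialD[OF pot]
  have "(\<Sum>y\<in>S. p z y * run F n z (winF F n w) i y (y # w)) \<le>
      (\<Sum>y\<in>S. p z y * ((4 * \<tau> + 2) * ((diffF F n (y # w))\<^sup>2 + sq F n z i y (y # w))))"
  proof (intro sum_mono mult_left_mono p_nonneg z)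
    fix y assume y: "y \<in> S"
    define d where "d = diffF F n (y # w)"
    have "run F n z (winF F n w) i y (y # w) \<le> (1 + \<phi> y / \<tau>) * d\<^sup>2 + (4 * \<tau> + 2) * sq F n z i y (y # w)"
      using run_le_sq[OF \<tau> y pot, of F n "winF F n w" i "y # w"] by (simp add: d_def diffF_def)
    also have "(1 + \<phi> y / \<tau>) * d\<^sup>2 \<le> (4 * \<tau> + 2) * d\<^sup>2"
    proof (rule mult_right_mono)
      have "\<phi> y / \<tau> \<le> 1" using \<phi>(3)[OF y] \<tau> by simp
      then show "1 + \<phi> y / \<tau> \<le> 4 * \<tau> + 2" using \<tau> by linarith
    qed simp
    finally show "run F n z (winF F n w) i y (y # w) \<le>
        (4 * \<tau> + 2) * ((diffF F n (y # w))\<^sup>2 + sq F n z i y (y # w))"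
      by (simp add: d_def algebra_simps)
  qed
  then show ?thesis by (simp add: sq0_def sum_distrib_left mult.left_commute)
qed

text \<open>Here \<open>q\<close> is the part of the window seen so far and \<open>l\<close> the
  number of missing entries. The value is the mean squared deviation from \<open>c\<close> of the
  conditional mean of \<open>F\<close> at the first visit to \<open>z\<close> from now on, or of
  \<open>F\<close> itself if the window ends before.\<close>

primrec renew :: "('a multiset \<Rightarrow> real) \<Rightarrow> nat \<Rightarrow> 'a \<Rightarrow> real \<Rightarrow> nat \<Rightarrow> 'a list \<Rightarrow> 'a \<Rightarrow> real" where
  "renew F n z c 0 q x = (winF F n q - c)\<^sup>2"
| "renew F n z c (Suc l) q x =
     (if x = z then (nx (Suc l) z (\<lambda>ys. winF F n (q @ ys)) - c)\<^sup>2
      else \<Sum>y\<in>S. p x y * renew F n z c l (q @ [y]) y)"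

text \<open>The expected sum, over the visits to \<open>z\<close> in the rest of the window, of the
  excursion cost \<open>sq0\<close>, where each excursion is limited to the entries still
  missing.\<close>

primrec visits :: "('a multiset \<Rightarrow> real) \<Rightarrow> nat \<Rightarrow> 'a \<Rightarrow> nat \<Rightarrow> 'a list \<Rightarrow> 'a \<Rightarrow> real" where
  "visits F n z 0 q x = (if x = z then sq0 F n z 0 q else 0)"
| "visits F n z (Suc l) q x = (if x = z then nx (Suc l) z (\<lambda>ys. sq0 F n z (Suc l) (q @ ys)) else 0)
     + (\<Sum>y\<in>S. p x y * visits F n z l (q @ [y]) y)"

text \<open>Here the symmetry of \<open>F\<close> enters the exchange argument: \<open>renew\<close>
  appends the new entries to \<open>q\<close> in time order, \<open>run\<close> puts them in front
  of \<open>u\<close> in reverse, and the counts agree.\<close>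

lemma winF_cong: "mset u = mset q \<Longrightarrow> length u \<le> n \<Longrightarrow> winF F n (u @ w) = winF F n (q @ w)"
proof -
  assume m: "mset u = mset q" and l: "length u \<le> n"
  have "length q = length u" using m by (metis size_mset)
  then show ?thesis using m l by (simp add: winF_def)
qed

text \<open>
  Replacing the expectation over a fresh path by the fresh path \<open>\<omega>\<close> itself (Jensen) turns the
  variance of the conditional expectation at the next visit into \<open>run\<close>.
\<close>

lemma renew_le_run:
  assumes z: "z \<in> S" and x: "x \<in> S" and "l \<le> L" and "mset u = mset q" and "length q + l = n"
  shows "renew F n z (nx L z \<Psi>) l q x \<le> nx L z (\<lambda>\<omega>. run F n z (\<Psi> \<omega>) l x (u @ \<omega>))"
  using x assms(3-5)
proof (induction l arbitrary: x u q)
  case 0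
  have "length u = length q" using 0(3) by (metis size_mset)
  then have "winF F n (u @ \<omega>) = winF F n q" for \<omega> using 0 by (simp add: winF_def)
  then show ?case using nx_cs[OF z, of L \<Psi> "winF F n q"] by (simp add: power2_commute)
next
  case (Suc l)
  show ?case
  proof (cases "x = z")
    case True
    have lu: "length u = length q" using Suc(4) by (metis size_mset)
    have "nx (Suc l) z (\<lambda>ys. winF F n (q @ ys)) = nx (Suc l) z (\<lambda>ys. winF F n (u @ ys))"
      using Suc lu by (intro nx_cong winF_cong) auto
    also have "\<dots> = nx L z (\<lambda>\<omega>. winF F n (u @ take (Suc l) \<omega>))" by (rule nx_take[OF z Suc(3), symmetric])
    also have "n - length u = Suc l" using Suc(5) lu by linarith
    then have "nx L z (\<lambda>\<omega>. winF F n (u @ take (Suc l) \<omega>)) = nx L z (\<lambda>\<omega>. winF F n (u @ \<omega>))"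
      by (simp add: winF_def)
    finally have "renew F n z (nx L z \<Psi>) (Suc l) q x = (nx L z (\<lambda>\<omega>. winF F n (u @ \<omega>) - \<Psi> \<omega>) - 0)\<^sup>2"
      using True by (simp add: nx_diff)
    also have "\<dots> \<le> nx L z (\<lambda>\<omega>. (winF F n (u @ \<omega>) - \<Psi> \<omega> - 0)\<^sup>2)" by (rule nx_cs[OF z])
    finally show ?thesis using True by simp
  next
    case False
    have "renew F n z (nx L z \<Psi>) (Suc l) q x = (\<Sum>y\<in>S. p x y * renew F n z (nx L z \<Psi>) l (q @ [y]) y)"
      using False by simp
    also have "\<dots> \<le> (\<Sum>y\<in>S. p x y * nx L z (\<lambda>\<omega>. run F n z (\<Psi> \<omega>) l y ((y # u) @ \<omega>)))"
      using Suc.prems by (intro sum_mono mult_left_mono p_nonneg Suc.IH) auto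
    also have "\<dots> = nx L z (\<lambda>\<omega>. run F n z (\<Psi> \<omega>) (Suc l) x (u @ \<omega>))"
      using False by (simp add: nx_sum nx_cmult)
    finally show ?thesis .
  qed
qed

text \<open>
  The martingale decomposition of the variance along the visits to \<open>z\<close>, with \<open>renew\<close> accounting
  for the part up to the first visit.
\<close>

lemma variance_visits:
  assumes \<tau>: "0 < \<tau>" and z: "z \<in> S" and x: "x \<in> S"
    and pot: "potential z \<tau> \<phi>"
    and l: "length q + l = n"
  shows "nx l x (\<lambda>ys. (winF F n (q @ ys) - c)\<^sup>2) \<le> (4 * \<tau> + 2) * visits F n z l q x + renew F n z c l q x"
  using x l
proof (induction l arbitrary: x q c)
  case 0
  then show ?case by (simp add: sq0_def)
next
  case (Suc l)
  define C where "C = 4 * \<tau> + 2"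
  have step: "nx (Suc l) x (\<lambda>ys. (winF F n (q @ ys) - c)\<^sup>2) \<le>
      C * (\<Sum>y\<in>S. p x y * visits F n z l (q @ [y]) y) + (\<Sum>y\<in>S. p x y * renew F n z c l (q @ [y]) y)" for c
  proof -
    have "nx (Suc l) x (\<lambda>ys. (winF F n (q @ ys) - c)\<^sup>2) =
        (\<Sum>y\<in>S. p x y * nx l y (\<lambda>ys. (winF F n ((q @ [y]) @ ys) - c)\<^sup>2))" by (simp add: nx_Suc)
    also have "\<dots> \<le> (\<Sum>y\<in>S. p x y * (C * visits F n z l (q @ [y]) y + renew F n z c l (q @ [y]) y))"
      unfolding C_def using Suc.prems by (intro sum_mono mult_left_mono p_nonneg Suc.IH) auto
    finally show ?thesis by (simp add: algebra_simps sum.distrib sum_distrib_left)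
  qed
  show ?case
  proof (cases "x = z")
    case False
    then show ?thesis using step[of c] by (simp add: C_def)
  next
    case True
    \<comment> \<open>The conditional mean of \<open>F\<close> given \<open>q\<close>. The second
      moment about \<open>c\<close> is that about \<open>h\<close> plus
      \<open>(h - c)\<^sup>2\<close>, which is the \<open>renew\<close> term at \<open>z\<close>;
      the \<open>renew\<close> terms about \<open>h\<close> are the share of one excursion.\<close>
    define h where "h = nx (Suc l) z (\<lambda>ys. winF F n (q @ ys))"
    have "(\<Sum>y\<in>S. p z y * renew F n z h l (q @ [y]) y) \<le>
       (\<Sum>y\<in>S. p z y * nx (Suc l) z (\<lambda>\<omega>. run F n z (winF F n (q @ \<omega>)) l y ((y # q) @ \<omega>)))"
      unfolding h_def using Suc.prems
      by (intro sum_mono mult_left_mono p_nonneg renew_le_run z) auto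
    also have "\<dots> = nx (Suc l) z (\<lambda>\<omega>. \<Sum>y\<in>S. p z y * run F n z (winF F n (q @ \<omega>)) l y (y # (q @ \<omega>)))"
      by (simp add: nx_sum nx_cmult)
    also have "\<dots> \<le> nx (Suc l) z (\<lambda>\<omega>. C * sq0 F n z (Suc l) (q @ \<omega>))"
      unfolding C_def by (intro nx_mono z run_start_le_sq0[OF \<tau> z pot])
    finally have r: "(\<Sum>y\<in>S. p z y * renew F n z h l (q @ [y]) y)
        \<le> C * nx (Suc l) z (\<lambda>\<omega>. sq0 F n z (Suc l) (q @ \<omega>))"
      by (simp add: nx_cmult)
    have "nx (Suc l) x (\<lambda>ys. (winF F n (q @ ys) - c)\<^sup>2) =
        nx (Suc l) x (\<lambda>ys. (winF F n (q @ ys) - h)\<^sup>2) + (h - c)\<^sup>2"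
      unfolding h_def True by (rule nx_sq[OF z])
    then show ?thesis using step[of h] r True by (simp add: C_def h_def algebra_simps)
  qed
qed

text \<open>Term \<open>j\<close> is the step that puts entry \<open>j + 1\<close> in front of
  \<open>w\<close>. The step into \<open>z\<close> still counts, so only the entries before it must
  avoid \<open>z\<close>, hence \<open>butlast\<close>.\<close>

lemma first_step_sum:
  fixes F n z
  defines "t \<equiv> \<lambda>w ys. if z \<in> set (butlast ys) then 0 else (diffF F n (rev ys @ w))\<^sup>2"
  shows "(\<Sum>j<Suc i. nx (Suc j) x (t w)) =
    (\<Sum>y\<in>S. p x y * ((diffF F n (y # w))\<^sup>2 + (if y = z then 0 else \<Sum>j<i. nx (Suc j) y (t (y # w)))))"
proof -
  have "(\<Sum>j<Suc i. nx (Suc j) x (t w)) = nx (Suc 0) x (t w) + (\<Sum>j<i. nx (Suc (Suc j)) x (t w))"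
    by (rule sum.lessThan_Suc_shift)
  also have "nx (Suc 0) x (t w) = (\<Sum>y\<in>S. p x y * (diffF F n (y # w))\<^sup>2)" by (simp add: nx_Suc t_def)
  also have "(\<Sum>j<i. nx (Suc (Suc j)) x (t w)) = (\<Sum>j<i. \<Sum>y\<in>S. p x y * (if y = z then 0
      else nx (Suc j) y (t (y # w))))"
  proof (intro sum.cong refl)
    fix j
    have "nx (Suc j) y (\<lambda>ys. t w (y # ys)) = (if y = z then 0 else nx (Suc j) y (t (y # w)))" for y
    proof -
      have "nx (Suc j) y (\<lambda>ys. t w (y # ys)) = nx (Suc j) y (\<lambda>ys. if y = z then 0 else t (y # w) ys)"
        by (rule nx_cong) (auto simp: lists_of_def t_def)
      then show ?thesis by (simp add: nx_def)
    qed
    then show "nx (Suc (Suc j)) x (t w) = (\<Sum>y\<in>S. p x y * (if y = z then 0 else nx (Suc j) y (t (y # w))))"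
      by (subst nx_Suc) simp
  qed
  also have "\<dots> = (\<Sum>y\<in>S. p x y * (if y = z then 0 else \<Sum>j<i. nx (Suc j) y (t (y # w))))"
    by (subst sum.swap) (auto intro!: sum.cong simp: sum_distrib_left)
  finally show ?thesis by (simp add: sum.distrib distrib_left)
qed

lemma sq_explicit:
  "sq F n z i x w = (if x = z then 0 else
     \<Sum>j<i. nx (Suc j) x (\<lambda>ys. if z \<in> set (butlast ys) then 0 else (diffF F n (rev ys @ w))\<^sup>2))"
  by (induction i arbitrary: x w) (simp_all add: first_step_sum del: sum.lessThan_Suc)

lemma sq0_explicit:
  "sq0 F n z i w =
     (\<Sum>j<i. nx (Suc j) z (\<lambda>ys. if z \<in> set (butlast ys) then 0 else (diffF F n (rev ys @ w))\<^sup>2))"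
  by (cases i) (simp_all add: sq0_def first_step_sum sq_explicit del: sum.lessThan_Suc)

lemma visits_explicit:
  "visits F n z l q x = nx l x (\<lambda>ys. \<Sum>k\<le>l. if (x # ys) ! k = z then sq0 F n z (l - k) (q @ ys) else 0)"
proof (induction l arbitrary: q x)
  case (Suc l)
  let ?s = "\<lambda>l q x ys k. if (x # ys) ! k = z then sq0 F n z (l - k) (q @ ys) else 0"
  have "nx (Suc l) x (\<lambda>ys. \<Sum>k\<le>Suc l. ?s (Suc l) q x ys k) =
     nx (Suc l) x (\<lambda>ys. ?s (Suc l) q x ys 0 + (\<Sum>k\<le>l. ?s (Suc l) q x ys (Suc k)))"
    by (simp only: sum.atMost_Suc_shift)
  also have "\<dots> = nx (Suc l) x (\<lambda>ys. ?s (Suc l) q x ys 0)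
      + nx (Suc l) x (\<lambda>ys. \<Sum>k\<le>l. ?s (Suc l) q x ys (Suc k))"
    by (rule nx_add)
  also have "nx (Suc l) x (\<lambda>ys. ?s (Suc l) q x ys 0) = (if x = z
      then nx (Suc l) z (\<lambda>ys. sq0 F n z (Suc l) (q @ ys)) else 0)"
    by (auto simp: nx_def)
  also have "nx (Suc l) x (\<lambda>ys. \<Sum>k\<le>l. ?s (Suc l) q x ys (Suc k)) = (\<Sum>y\<in>S. p x y * visits F n z l (q @ [y]) y)"
    unfolding Suc nx_Suc by (simp cong: if_cong)
  finally show ?case by simp
qed (simp add: sq0_def)

lemma varz_le_visits:
  assumes \<tau>: "0 < \<tau>" and z: "z \<in> S" and n: "0 < n"
    and pot: "potential z \<tau> \<phi>"
  shows "varz F n z \<le> (4 * \<tau> + 2) * visits F n z (n - 1) [z] z"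
proof -
  have "renew F n z (headF F n z) (n - 1) [z] z = 0"
    by (cases "n - 1") (auto simp: headF_def)
  then show ?thesis
    using variance_visits[OF \<tau> z z pot, of "[z]" "n - 1" n F "headF F n z"] n by (simp add: varz_def)
qed

text \<open>Given the state \<open>z\<close> at time \<open>J\<close>, past and future of the
  stationary chain are independent paths out of \<open>z\<close>, the past read backwards. So an
  excursion attached at the front becomes an initial piece of a stationary path.\<close>

lemma sx_split_at:
  assumes z: "z \<in> S" and n: "0 < n"
  shows "\<pi> z * nx (n - 1) z (\<lambda>zs. nx J z (\<lambda>ys. \<Psi> (rev ys @ z # zs))) =
    sx (J + n) (\<lambda>xs. if xs ! J = z then \<Psi> xs else 0)"
proof -
  obtain k where k: "n = Suc k" using n by (cases n) auto
  let ?w = "\<lambda>xs. \<pi> (hd xs) * wt xs"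
  have "sx (J + n) (\<lambda>xs. if xs ! J = z then \<Psi> xs else 0) =
    (\<Sum>us\<in>lists_of J. \<Sum>v\<in>S. \<Sum>zs\<in>lists_of k. if v = z then ?w (us @ z # zs) * \<Psi> (us @ z # zs) else 0)"
    unfolding sx_def sum_lists_add k sum_lists_Suc
    by (intro sum.cong refl) (auto simp: lists_of_def nth_append)
  also have "\<dots> = (\<Sum>us\<in>lists_of J. \<Sum>zs\<in>lists_of k. ?w (us @ z # zs) * \<Psi> (us @ z # zs))"
  proof (rule sum.cong[OF refl])
    fix us
    have "(\<Sum>v\<in>S. \<Sum>zs\<in>lists_of k. if v = z then ?w (us @ z # zs) * \<Psi> (us @ z # zs) else 0) =
      (\<Sum>v\<in>S. if v = z then \<Sum>zs\<in>lists_of k. ?w (us @ z # zs) * \<Psi> (us @ z # zs) else 0)"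
      by (rule sum.cong) auto
    then show "(\<Sum>v\<in>S. \<Sum>zs\<in>lists_of k. if v = z then ?w (us @ z # zs) * \<Psi> (us @ z # zs) else 0) =
      (\<Sum>zs\<in>lists_of k. ?w (us @ z # zs) * \<Psi> (us @ z # zs))"
      using z fin_S by simp
  qed
  also have "\<dots> = (\<Sum>ys\<in>lists_of J. \<Sum>zs\<in>lists_of k. ?w (rev ys @ z # zs) * \<Psi> (rev ys @ z # zs))"
    by (rule sum_lists_rev[symmetric])
  also have "\<dots> = (\<Sum>ys\<in>lists_of J. \<Sum>zs\<in>lists_of k. \<pi> z * wt (z # zs) * (wt (z # ys) * \<Psi> (rev ys @ z # zs)))"
  proof (intro sum.cong refl)
    fix ys zs assume ys: "ys \<in> lists_of J"
    have "wt (rev ys @ z # zs) = wt (rev ys @ [z]) * wt (z # zs)"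
      using wt_append[of "rev ys @ [z]" zs] by simp
    moreover have "\<pi> (hd (rev ys @ [z])) * wt (rev ys @ [z]) = \<pi> z * wt (z # ys)"
      using wt_rev[of "z # ys"] ys z by (cases ys rule: rev_cases) (auto simp: lists_of_def)
    moreover have "hd (rev ys @ z # zs) = hd (rev ys @ [z])" by (cases ys rule: rev_cases) auto
    ultimately show "?w (rev ys @ z # zs) * \<Psi> (rev ys @ z # zs) =
        \<pi> z * wt (z # zs) * (wt (z # ys) * \<Psi> (rev ys @ z # zs))" by simp
  qed
  also have "\<dots> = (\<Sum>zs\<in>lists_of k. \<Sum>ys\<in>lists_of J. \<pi> z * wt (z # zs) * (wt (z # ys) * \<Psi> (rev ys @ z # zs)))"
    by (rule sum.swap)
  also have "\<dots> = \<pi> z * nx (n - 1) z (\<lambda>zs. nx J z (\<lambda>ys. \<Psi> (rev ys @ z # zs)))"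
    by (simp add: nx_def k sum_distrib_left mult_ac)
  finally show ?thesis by simp
qed

text \<open>The times 1 to \<open>n - 1\<close> are those shared by the two windows of a path of
  length \<open>n + 1\<close>.\<close>

definition occ :: "nat \<Rightarrow> 'a \<Rightarrow> 'a list \<Rightarrow> nat set" where
  "occ n z xs = {i. 1 \<le> i \<and> i < n \<and> xs ! i = z}"

lemma finite_occ: "finite (occ n z xs)"
  by (simp add: occ_def)

lemma diffF_take: "diffF F n (take (Suc n) xs) = diffF F n xs"
proof -
  have "take n (tl (take (Suc n) xs)) = take n (tl xs)" by (cases xs) auto
  moreover have "take n (take (Suc n) xs) = take n xs" by (simp add: min_def)
  ultimately show ?thesis by (simp only: diffF_def winF_def)
qed

text \<open>
  Here \<open>Suc j\<close> is the first visit to \<open>z\<close> after time \<open>0\<close>, so it is determined by the path.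
\<close>

lemma pairs_le_occ:
  assumes "length xs = Suc n"
  shows "card {(k, j). k < n \<and> j < n - 1 - k \<and> xs ! Suc j = z \<and> xs ! (Suc j + k) = z
     \<and> z \<notin> set (take j (tl xs))} \<le> card (occ n z xs)" (is "card ?A \<le> _")
proof (rule card_inj_on_le[OF _ _ finite_occ])
  have first: "False" if "j < j'" "j' < n" "xs ! Suc j = z" "z \<notin> set (take j' (tl xs))" for j j'
  proof -
    have "tl xs ! j = z" using that assms by (simp add: nth_tl)
    moreover have "j < length (take j' (tl xs))" using that assms by simp
    ultimately show False using that(1,4) by (metis nth_mem nth_take)
  qed
  show "inj_on (\<lambda>(k, j). Suc j + k) ?A"
  proof (rule inj_onI)
    fix a b assume ab: "a \<in> ?A" "b \<in> ?A" "(\<lambda>(k, j). Suc j + k) a = (\<lambda>(k, j). Suc j + k) b"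
    obtain k j k' j' where e: "a = (k, j)" "b = (k', j')" by (cases a; cases b)
    have "j < n" "j' < n" using ab e by auto
    then have "j = j'" using first[of j j'] first[of j' j] ab e by (cases j j' rule: linorder_cases) auto
    then show "a = b" using ab e by simp
  qed
  show "(\<lambda>(k, j). Suc j + k) ` ?A \<subseteq> occ n z xs" by (auto simp: occ_def)
qed

text \<open>After gluing, visit \<open>k\<close> and excursion step \<open>j\<close> belong to a
  stationary path whose first visit to \<open>z\<close> after time 0 is at \<open>Suc j\<close> and
  which is in \<open>z\<close> at \<open>Suc j + k\<close>. On each path these pairs are at most as
  many as the visits.\<close>

lemma visits_le_occ:
  assumes z: "z \<in> S" and n: "0 < n"
  shows "\<pi> z * visits F n z (n - 1) [z] z \<le>
     sx (Suc n) (\<lambda>xs. (diffF F n xs)\<^sup>2 * real (card (occ n z xs)))"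
proof -
  define \<Psi> where "\<Psi> k j xs = (if xs ! (Suc j + k) = z \<and> z \<notin> set (take j (tl xs)) then (diffF F n xs)\<^sup>2
      else 0)"
    for k j xs
  have "visits F n z (n - 1) [z] z =
    nx (n - 1) z (\<lambda>zs. \<Sum>k\<le>n - 1. \<Sum>j<n - 1 - k. nx (Suc j) z (\<lambda>ys. \<Psi> k j (rev ys @ z # zs)))"
    unfolding visits_explicit
  proof (intro nx_cong sum.cong refl)
    fix zs k assume zs: "zs \<in> lists_of (n - 1)" and k: "k \<in> {..n - 1}"
    show "(if (z # zs) ! k = z then sq0 F n z (n - 1 - k) ([z] @ zs) else 0) =
       (\<Sum>j<n - 1 - k. nx (Suc j) z (\<lambda>ys. \<Psi> k j (rev ys @ z # zs)))"
    proof (cases "(z # zs) ! k = z")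
      case True
      have "nx (Suc j) z (\<lambda>ys. if z \<in> set (butlast ys) then 0 else (diffF F n (rev ys @ z # zs))\<^sup>2) =
          nx (Suc j) z (\<lambda>ys. \<Psi> k j (rev ys @ z # zs))" for j
      proof (rule nx_cong)
        fix ys assume ys: "ys \<in> lists_of (Suc j)"
        then have l: "length (rev ys) = Suc j" by (simp add: lists_of_def)
        then have "(rev ys @ z # zs) ! (Suc j + k) = (z # zs) ! k"
            by (simp only: nth_append_length_plus[of "rev ys", unfolded l])
        moreover have "take j (tl (rev ys @ z # zs)) = rev (butlast ys)"
          using l by (cases ys rule: rev_cases) auto
        ultimately show "(if z \<in> set (butlast ys) then 0 else (diffF F n (rev ys @ z # zs))\<^sup>2) =
            \<Psi> k j (rev ys @ z # zs)" using True by (simp add: \<Psi>_def)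
      qed
      then show ?thesis using True by (simp add: sq0_explicit)
    next
      case False
      have "nx (Suc j) z (\<lambda>ys. \<Psi> k j (rev ys @ z # zs)) = nx (Suc j) z (\<lambda>ys. 0)" for j
      proof (rule nx_cong)
        fix ys assume ys: "ys \<in> lists_of (Suc j)"
        then have l: "length (rev ys) = Suc j" by (simp add: lists_of_def)
        then have "(rev ys @ z # zs) ! (Suc j + k) = (z # zs) ! k"
            by (simp only: nth_append_length_plus[of "rev ys", unfolded l])
        then show "\<Psi> k j (rev ys @ z # zs) = 0" using False by (simp add: \<Psi>_def)
      qed
      then show ?thesis using False by (simp add: nx_const[OF z])
    qed
  qed
  then have "\<pi> z * visits F n z (n - 1) [z] z =
     (\<Sum>k\<le>n - 1. \<Sum>j<n - 1 - k. \<pi> z * nx (n - 1) z (\<lambda>zs. nx (Suc j) z (\<lambda>ys. \<Psi> k j (rev ys @ z # zs))))"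
    by (simp add: nx_sum sum_distrib_left)
  also have "\<dots> = (\<Sum>k\<le>n - 1. \<Sum>j<n - 1 - k. sx (Suc n) (\<lambda>xs. if xs ! Suc j = z then \<Psi> k j xs else 0))"
  proof (intro sum.cong refl)
    fix k j assume kj: "k \<in> {..n - 1}" "j \<in> {..<n - 1 - k}"
    have "\<pi> z * nx (n - 1) z (\<lambda>zs. nx (Suc j) z (\<lambda>ys. \<Psi> k j (rev ys @ z # zs))) =
       sx (Suc j + n) (\<lambda>xs. if xs ! Suc j = z then \<Psi> k j xs else 0)" by (rule sx_split_at[OF z n])
    \<comment> \<open>The summand depends on entries up to \<open>Suc j + k < n\<close> and on
      \<open>diffF\<close>, so the glued path can be cut to length \<open>n + 1\<close>.\<close>
    also have "\<dots> = sx (Suc j + n) (\<lambda>xs. if take (Suc n) xs ! Suc j = z then \<Psi> k j (take (Suc n) xs) else 0)"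
    proof (rule sx_cong)
      fix xs assume xs: "xs \<in> lists_of (Suc j + n)"
      have "take j (tl (take (Suc n) xs)) = take j (tl xs)"
        using kj by (cases xs) (auto simp: min_def)
      then show "(if xs ! Suc j = z then \<Psi> k j xs else 0) =
          (if take (Suc n) xs ! Suc j = z then \<Psi> k j (take (Suc n) xs) else 0)"
        using kj by (simp add: \<Psi>_def diffF_take)
    qed
    also have "\<dots> = sx (Suc n) (\<lambda>xs. if xs ! Suc j = z then \<Psi> k j xs else 0)"
      by (rule sx_take) auto
    finally show "\<pi> z * nx (n - 1) z (\<lambda>zs. nx (Suc j) z (\<lambda>ys. \<Psi> k j (rev ys @ z # zs))) =
       sx (Suc n) (\<lambda>xs. if xs ! Suc j = z then \<Psi> k j xs else 0)" .
  qed
  also have "\<dots> = sx (Suc n) (\<lambda>xs. \<Sum>k\<le>n - 1. \<Sum>j<n - 1 - k. if xs ! Suc j = z then \<Psi> k j xs else 0)"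
    by (simp only: sx_sum)
  also have "\<dots> \<le> sx (Suc n) (\<lambda>xs. (diffF F n xs)\<^sup>2 * real (card (occ n z xs)))"
  proof (rule sx_mono)
    fix xs assume xs: "xs \<in> lists_of (Suc n)"
    define A where "A = {(k, j). k < n \<and> j < n - 1 - k \<and> xs ! Suc j = z \<and> xs ! (Suc j + k) = z
       \<and> z \<notin> set (take j (tl xs))}"
    define B where "B = (SIGMA k:{..n - 1}. {..<n - 1 - k})"
    have AB: "A \<subseteq> B" "finite B" using n by (auto simp: A_def B_def)
    have "(\<Sum>k\<le>n - 1. \<Sum>j<n - 1 - k. if xs ! Suc j = z then \<Psi> k j xs else 0) =
      (\<Sum>(k, j)\<in>B. if xs ! Suc j = z then \<Psi> k j xs else 0)"
      unfolding B_def by (rule sum.Sigma) auto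
    also have "\<dots> = (\<Sum>kj\<in>B. if kj \<in> A then (diffF F n xs)\<^sup>2 else 0)"
      by (rule sum.cong) (use n in \<open>auto simp: A_def B_def \<Psi>_def split: if_splits\<close>)
    also have "\<dots> = (diffF F n xs)\<^sup>2 * real (card A)"
      using AB by (simp add: sum.If_cases Int_absorb1 mult.commute)
    also have "\<dots> \<le> (diffF F n xs)\<^sup>2 * real (card (occ n z xs))"
      unfolding A_def using xs by (intro mult_left_mono of_nat_mono pairs_le_occ) (auto simp: lists_of_def)
    finally show "(\<Sum>k\<le>n - 1. \<Sum>j<n - 1 - k. if xs ! Suc j = z then \<Psi> k j xs else 0) \<le>
        (diffF F n xs)\<^sup>2 * real (card (occ n z xs))" .
  qed simp
  finally show ?thesis .
qed

lemma occ_total: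
  assumes "A \<subseteq> S" shows "(\<Sum>z\<in>A. real (card (occ n z xs))) \<le> real n"
proof -
  have "(\<Sum>z\<in>A. card (occ n z xs)) = card (\<Union>z\<in>A. occ n z xs)"
    using finite_subset[OF assms fin_S] by (intro card_UN_disjoint[symmetric]) (auto simp: occ_def)
  also have "\<dots> \<le> card {..<n}" by (rule card_mono) (auto simp: occ_def)
  finally show ?thesis by (simp flip: of_nat_sum)
qed

lemma varF_long:
  assumes n: "0 < n" and m: "2 \<le> card S" and g: "0 < g" "g \<le> 2" and gap: "\<And>f. g * vari f \<le> energy f f"
  defines "\<rho> \<equiv> real (card S) / g"
  shows "varF F n \<le> (56 * \<rho> * real n + 36 * \<rho>\<^sup>2) * dirF F n"
proof -
  define A where "A = {z \<in> S. 1 / (2 * real (card S)) \<le> \<pi> z}"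
  define \<tau> where "\<tau> = 3 * \<rho>"
  have m0: "0 < real (card S)" using m by simp
  have \<rho>1: "1 \<le> \<rho>" unfolding \<rho>_def using m g by (simp add: field_simps)
  have \<tau>0: "0 < \<tau>" using \<rho>1 by (simp add: \<tau>_def)
  have AS: "A \<subseteq> S" by (auto simp: A_def)
  have fA: "finite A" by (rule finite_subset[OF AS fin_S])
  have half: "1 / 2 \<le> (\<Sum>z\<in>A. \<pi> z)"
  proof -
    have "(\<Sum>z\<in>S - A. \<pi> z) \<le> (\<Sum>z\<in>S - A. 1 / (2 * real (card S)))"
      by (intro sum_mono) (auto simp: A_def)
    also have "\<dots> \<le> (\<Sum>z\<in>S. 1 / (2 * real (card S)))"
      by (rule sum_mono2[OF fin_S]) auto
    also have "\<dots> = 1 / 2" using m0 by simp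
    finally show ?thesis using sum.subset_diff[OF AS fin_S, of \<pi>] pi_sum by simp
  qed
  have A1: "(\<Sum>z\<in>A. \<pi> z) \<le> 1"
    unfolding pi_sum[symmetric] by (rule sum_mono2[OF fin_S AS]) (auto simp: pi_pos less_imp_le)
  have each: "\<pi> z * varF F n \<le> 2 * (4 * \<tau> + 2) * sx (Suc n) (\<lambda>xs. (diffF F n xs)\<^sup>2 * real (card (occ n z xs)))
     + \<pi> z * (4 * \<tau>\<^sup>2 * dirF F n)" if zA: "z \<in> A" for z
  proof -
    have z: "z \<in> S" and pz: "1 / (2 * real (card S)) \<le> \<pi> z" using zA by (auto simp: A_def)
    have "1 / \<pi> z \<le> 2 * real (card S)"
      using pz m0 pi_pos[OF z] by (simp add: field_simps)
    then have b: "(real (card S) + 1 / \<pi> z) / g \<le> \<tau>"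
      unfolding \<tau>_def \<rho>_def using g by (simp add: divide_right_mono)
    obtain \<phi> where "potential z ((real (card S) + 1 / \<pi> z) / g) \<phi>"
      using hitting_potential[OF z g(1) gap] by blast
    then have pot: "potential z \<tau> \<phi>" using b by (fastforce simp: potential_def)
    have "varF F n \<le> 2 * varz F n z + 4 * \<tau>\<^sup>2 * dirF F n"
      by (rule varF_le_varz[OF n z pot])
    also have "\<dots> \<le> 2 * ((4 * \<tau> + 2) * visits F n z (n - 1) [z] z) + 4 * \<tau>\<^sup>2 * dirF F n"
      using varz_le_visits[OF \<tau>0 z n pot, of F] by simp
    finally have "\<pi> z * varF F n \<le> \<pi> z * (2 * ((4 * \<tau> + 2) * visits F n z (n - 1) [z] z)
        + 4 * \<tau>\<^sup>2 * dirF F n)"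
      using pi_pos[OF z] by simp
    also have "\<dots> = 2 * (4 * \<tau> + 2) * (\<pi> z * visits F n z (n - 1) [z] z) + \<pi> z * (4 * \<tau>\<^sup>2 * dirF F n)"
      by (simp add: algebra_simps)
    also have "\<dots> \<le> 2 * (4 * \<tau> + 2) * sx (Suc n) (\<lambda>xs. (diffF F n xs)\<^sup>2 * real (card (occ n z xs)))
        + \<pi> z * (4 * \<tau>\<^sup>2 * dirF F n)"
      using \<tau>0 by (intro add_right_mono mult_left_mono visits_le_occ[OF z n]) auto
    finally show ?thesis .
  qed
  have "(\<Sum>z\<in>A. \<pi> z) * varF F n \<le> (\<Sum>z\<in>A. 2 * (4 * \<tau>
      + 2) * sx (Suc n) (\<lambda>xs. (diffF F n xs)\<^sup>2 * real (card (occ n z xs)))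
     + \<pi> z * (4 * \<tau>\<^sup>2 * dirF F n))"
    unfolding sum_distrib_right by (rule sum_mono) (rule each)
  also have "\<dots> = 2 * (4 * \<tau> + 2) * sx (Suc n) (\<lambda>xs. (diffF F n xs)\<^sup>2 * (\<Sum>z\<in>A. real (card (occ n z xs))))
     + (\<Sum>z\<in>A. \<pi> z) * (4 * \<tau>\<^sup>2 * dirF F n)"
    by (simp add: sum.distrib sum_distrib_left sum_distrib_right sx_sum)
  finally have le: "(\<Sum>z\<in>A. \<pi> z) * varF F n \<le>
    2 * (4 * \<tau> + 2) * sx (Suc n) (\<lambda>xs. (diffF F n xs)\<^sup>2 * (\<Sum>z\<in>A. real (card (occ n z xs))))
     + (\<Sum>z\<in>A. \<pi> z) * (4 * \<tau>\<^sup>2 * dirF F n)" .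
  have "sx (Suc n) (\<lambda>xs. (diffF F n xs)\<^sup>2 * (\<Sum>z\<in>A. real (card (occ n z xs))))
      \<le> sx (Suc n) (\<lambda>xs. real n * (diffF F n xs)\<^sup>2)"
  proof (rule sx_mono)
    fix xs
    have "(diffF F n xs)\<^sup>2 * (\<Sum>z\<in>A. real (card (occ n z xs))) \<le> (diffF F n xs)\<^sup>2 * real n"
      by (intro mult_left_mono occ_total[OF AS]) auto
    then show "(diffF F n xs)\<^sup>2 * (\<Sum>z\<in>A. real (card (occ n z xs))) \<le> real n * (diffF F n xs)\<^sup>2"
      by (simp add: mult.commute)
  qed simp
  also have "\<dots> = real n * dirF F n" by (simp add: sx_cmult dirF_def)
  finally have "2 * (4 * \<tau> + 2) * sx (Suc n) (\<lambda>xs. (diffF F n xs)\<^sup>2 * (\<Sum>z\<in>A. real (card (occ n z xs)))) \<le>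
      2 * (4 * \<tau> + 2) * (real n * dirF F n)" using \<tau>0 by (intro mult_left_mono) auto
  then have main: "(\<Sum>z\<in>A. \<pi> z) * (varF F n - 4 * \<tau>\<^sup>2 * dirF F n) \<le> 2 * (4 * \<tau> + 2) * (real n * dirF F n)"
    using le unfolding right_diff_distrib by linarith
  have D: "0 \<le> dirF F n" by (rule dirF_nonneg)
  have nD: "0 \<le> real n * dirF F n" using D by simp
  have "varF F n - 4 * \<tau>\<^sup>2 * dirF F n \<le> 4 * (4 * \<tau> + 2) * (real n * dirF F n)"
  \<comment> \<open>The mass of \<open>A\<close> can be replaced by its lower bound
    \<open>1 / 2\<close> only in front of a nonnegative quantity.\<close>
  proof (cases "0 \<le> varF F n - 4 * \<tau>\<^sup>2 * dirF F n")
    case True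
    have "1 / 2 * (varF F n - 4 * \<tau>\<^sup>2 * dirF F n) \<le> (\<Sum>z\<in>A. \<pi> z) * (varF F n - 4 * \<tau>\<^sup>2 * dirF F n)"
      by (rule mult_right_mono[OF half True])
    then have "varF F n - 4 * \<tau>\<^sup>2 * dirF F n \<le> 2 * (2 * (4 * \<tau> + 2) * (real n * dirF F n))" using main by simp
    then show ?thesis by (simp add: algebra_simps)
  next
    case False
    have "0 \<le> 4 * (4 * \<tau> + 2) * (real n * dirF F n)" using \<tau>0 nD by simp
    then show ?thesis using False by linarith
  qed
  \<comment> \<open>\<open>4 * (4 * \<tau> + 2) = 48 * \<rho> + 8\<close>, and
    \<open>\<rho> \<ge> 1\<close>; the other term \<open>4 * \<tau>\<^sup>2\<close> is
    \<open>36 * \<rho>\<^sup>2\<close>.\<close>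
  also have "\<dots> \<le> 4 * (14 * \<rho>) * (real n * dirF F n)"
    by (rule mult_right_mono[OF _ nD]) (use \<rho>1 in \<open>simp add: \<tau>_def\<close>)
  finally show ?thesis by (simp add: \<tau>_def power_mult_distrib algebra_simps)
qed

text \<open>The two regimes meet at \<open>n = \<rho>\<close>: below it
  \<open>n\<^sup>2 \<le> \<rho> * n\<close>, above it
  \<open>\<rho>\<^sup>2 \<le> \<rho> * n\<close>. They give constants at most 2 and 92, so 540 is
  generous.\<close>

lemma varF_bound:
  assumes n: "0 < n" and m: "2 \<le> card S" and g: "0 < g" "g \<le> 2" and gap: "\<And>f. g * vari f \<le> energy f f"
  shows "varF F n \<le> 540 * real (card S) * real n / g * dirF F n"
proof -
  define \<rho> where "\<rho> = real (card S) / g"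
  have D: "0 \<le> dirF F n" by (rule dirF_nonneg)
  have \<rho>1: "1 \<le> \<rho>" unfolding \<rho>_def using m g by (simp add: field_simps)
  have "varF F n \<le> 540 * (\<rho> * real n) * dirF F n"
  proof (cases "real n \<le> \<rho>")
    case True
    have "1 / g \<le> \<rho>" unfolding \<rho>_def using m g by (simp add: divide_right_mono)
    then have "real n / (2 * g) \<le> \<rho> * real n"
      using mult_right_mono[of "1 / g" \<rho> "real n"] \<rho>1 g by (simp add: field_simps)
    moreover have "(real n)\<^sup>2 / 2 \<le> \<rho> * real n"
    proof -
      have "real n * real n \<le> \<rho> * real n" by (rule mult_right_mono[OF True]) simp
      moreover have "0 \<le> real n * real n" by simp
      ultimately show ?thesis unfolding power2_eq_square by linarith
    qed
    ultimately have "(real n)\<^sup>2 / 2 + real n / (2 * g) \<le> 540 * (\<rho> * real n)"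
      using \<rho>1 by (smt (verit) mult_nonneg_nonneg of_nat_0_le_iff)
    then have "((real n)\<^sup>2 / 2 + real n / (2 * g)) * dirF F n \<le> 540 * (\<rho> * real n) * dirF F n"
      using D by (rule mult_right_mono)
    then show ?thesis using varF_short[OF n g(1) gap, of F] by linarith
  next
    case False
    have "\<rho>\<^sup>2 \<le> \<rho> * real n" using False \<rho>1 by (simp add: power2_eq_square mult_left_mono)
    moreover have "0 \<le> \<rho> * real n" using \<rho>1 by simp
    ultimately have "56 * \<rho> * real n + 36 * \<rho>\<^sup>2 \<le> 540 * (\<rho> * real n)" by simp
    then have "(56 * \<rho> * real n + 36 * \<rho>\<^sup>2) * dirF F n \<le> 540 * (\<rho> * real n) * dirF F n"
      using D by (rule mult_right_mono)
    then show ?thesis using varF_long[OF n m g gap, of F] by (simp add: \<rho>_def)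
  qed
  then show ?thesis by (simp add: \<rho>_def)
qed

end

subsection \<open>The count kernel\<close>

lemma window_count_eq: "t + n \<le> length xs \<Longrightarrow> window_count n t xs = mset (take n (drop t xs))"
proof (induction n)
  case (Suc n)
  have "take (Suc n) (drop t xs) = take n (drop t xs) @ [xs ! (t + n)]"
    using Suc.prems by (simp add: take_Suc_conv_app_nth)
  then show ?case using Suc by (simp add: window_count_def)
qed (simp add: window_count_def)

lemma pmf_expectation: "pmf M a = measure_pmf.expectation M (\<lambda>x. if x = a then 1 else 0)"
  by (subst integral_measure_pmf_real[of "{a}"]) (auto split: if_splits)

locale pmf_chain =
  fixes \<Omega> :: "'a set" and P :: "'a \<Rightarrow> 'a pmf" and \<pi>P :: "'a pmf"
  assumes irr: "irreducible_reversible \<Omega> P \<pi>P"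
begin

lemma fin_Omega: "finite \<Omega>"
  using irr by (simp add: irreducible_reversible_def markov_kernel_def)

lemma P_sub: "x \<in> \<Omega> \<Longrightarrow> set_pmf (P x) \<subseteq> \<Omega>"
  using irr by (simp add: irreducible_reversible_def markov_kernel_def)

lemma pi_sub: "set_pmf \<pi>P \<subseteq> \<Omega>"
  using irr by (simp add: irreducible_reversible_def stationary_law_def)

lemma db: "x \<in> \<Omega> \<Longrightarrow> y \<in> \<Omega> \<Longrightarrow> pmf \<pi>P x * pmf (P x) y = pmf \<pi>P y * pmf (P y) x"
  using irr by (simp add: irreducible_reversible_def reversible_kernel_def)

lemma reach: "x \<in> \<Omega> \<Longrightarrow> y \<in> \<Omega> \<Longrightarrow> (x, y) \<in> {(a, b). a \<in> \<Omega> \<and> b \<in> \<Omega> \<and> pmf (P a) b > 0}\<^sup>*"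
  using irr by (simp add: irreducible_reversible_def irreducible_kernel_def)

lemma pi_positive: assumes "y \<in> \<Omega>" shows "0 < pmf \<pi>P y"
proof -
  obtain x where x: "x \<in> set_pmf \<pi>P" using set_pmf_not_empty[of \<pi>P] by blast
  then have "(x, y) \<in> {(a, b). a \<in> \<Omega> \<and> b \<in> \<Omega> \<and> pmf (P a) b > 0}\<^sup>*"
    using reach pi_sub assms by auto
  then show ?thesis
  proof (induction rule: rtrancl_induct)
    case base
    then show ?case using x by (simp add: pmf_positive)
  next
    case (step a b)
    then have "0 < pmf \<pi>P a * pmf (P a) b" by simp
    also have "\<dots> = pmf \<pi>P b * pmf (P b) a" using step by (intro db) auto
    finally show ?case by (auto simp: zero_less_mult_iff)
  qed
qed

sublocale rev_chain \<Omega> "\<lambda>x y. pmf (P x) y" "pmf \<pi>P"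
proof
  show "\<Omega> \<noteq> {}" using pi_sub set_pmf_not_empty[of \<pi>P] by blast
qed (auto simp: fin_Omega db pi_positive sum_pmf_eq_1 P_sub pi_sub)

lemma connected_energy: assumes "energy f f = 0" shows "vari f = 0"
proof -
  have nn: "0 \<le> pmf \<pi>P x * pmf (P x) y * (f x - f y)\<^sup>2" for x y by simp
  have "(\<Sum>x\<in>\<Omega>. \<Sum>y\<in>\<Omega>. pmf \<pi>P x * pmf (P x) y * (f x - f y)\<^sup>2) = 0"
    using assms by (simp add: energy_eq)
  then have z: "pmf \<pi>P x * pmf (P x) y * (f x - f y)\<^sup>2 = 0" if "x \<in> \<Omega>" "y \<in> \<Omega>" for x y
    using that fin_Omega by (auto simp add: sum_nonneg_eq_0_iff sum_nonneg)
  have const: "f x = f y" if "x \<in> \<Omega>" "y \<in> \<Omega>" for x y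
    using reach[OF that]
  proof (induction rule: rtrancl_induct)
    case (step a b)
    then show ?case using z[of a b] pi_positive[of a] by auto
  qed simp
  obtain a where a: "a \<in> \<Omega>" using ne_S by blast
  have "vari f \<le> ip (\<lambda>x. f x - f a) (\<lambda>x. f x - f a)" by (rule vari_le)
  also have "\<dots> = 0" unfolding ip_def by (rule sum.neutral) (use const[OF _ a] in auto)
  finally show ?thesis using vari_nonneg[of f] by simp
qed

definition gapP :: real where
  "gapP = right_gap \<Omega> (\<lambda>x y. pmf (P x) y)"

lemma gapP_eq: "gapP = right_gap \<Omega> kern"
  unfolding gapP_def by (rule right_gap_cong) (simp add: kern_eq)

lemma gapP_poincare: "gapP * vari f \<le> energy f f"
  unfolding gapP_eq by (rule right_gap_poincare)

lemma gapP_pos: "2 \<le> card \<Omega> \<Longrightarrow> 0 < gapP"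
  unfolding gapP_eq by (rule right_gap_pos) (auto intro: connected_energy)

lemma gapP_le_2: "gapP \<le> 2"
  unfolding gapP_eq by (rule right_gap_le_2)

lemma finite_path_from: "x \<in> \<Omega> \<Longrightarrow> finite (set_pmf (path_from P n x))"
proof (induction n arbitrary: x)
  case (Suc n)
  have "finite (set_pmf (P x))" using P_sub[OF Suc.prems] fin_Omega by (rule finite_subset)
  then show ?case using Suc.IH P_sub[OF Suc.prems] by auto
qed simp

lemma expectation_path_from:
  "x \<in> \<Omega> \<Longrightarrow> measure_pmf.expectation (path_from P n x) \<Phi> = nx n x (\<lambda>ys. \<Phi> (x # ys))"
proof (induction n arbitrary: x \<Phi>)
  case (Suc n)
  have "measure_pmf.expectation (path_from P (Suc n) x) \<Phi> =
    measure_pmf.expectation (bind_pmf (P x) (path_from P n)) (\<lambda>xs. \<Phi> (x # xs))" by simp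
  also have "\<dots> = (\<Sum>y\<in>\<Omega>. pmf (P x) y *\<^sub>R measure_pmf.expectation (path_from P n y) (\<lambda>xs. \<Phi> (x # xs)))"
    using fin_Omega finite_path_from P_sub[OF Suc.prems] by (rule pmf_expectation_bind)
  also have "\<dots> = nx (Suc n) x (\<lambda>ys. \<Phi> (x # ys))"
    unfolding nx_Suc by (intro sum.cong refl) (simp add: Suc.IH)
  finally show ?case .
qed simp

lemma expectation_chain_law: "measure_pmf.expectation (chain_law P \<pi>P n) \<Phi> = sx (Suc n) \<Phi>"
proof -
  have "measure_pmf.expectation (chain_law P \<pi>P n) \<Phi> =
    (\<Sum>x\<in>\<Omega>. pmf \<pi>P x *\<^sub>R measure_pmf.expectation (path_from P n x) \<Phi>)"
    unfolding chain_law_def using fin_Omega finite_path_from pi_sub by (rule pmf_expectation_bind)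
  then show ?thesis unfolding sx_Suc by (simp add: expectation_path_from cong: sum.cong)
qed

lemma finite_chain_law: "finite (set_pmf (chain_law P \<pi>P n))"
proof -
  have "finite (set_pmf \<pi>P)" using pi_sub fin_Omega by (rule finite_subset)
  then show ?thesis unfolding chain_law_def using finite_path_from pi_sub by auto
qed

lemma expectation_joint:
  "measure_pmf.expectation (count_joint_law P \<pi>P n) h =
     sx (Suc n) (\<lambda>xs. h (mset (take n xs), mset (take n (tl xs))))"
proof -
  have "measure_pmf.expectation (count_joint_law P \<pi>P n) h =
    sx (Suc n) (\<lambda>xs. h (window_count n 0 xs, window_count n 1 xs))"
    by (simp add: count_joint_law_def expectation_chain_law)
  also have "\<dots> = sx (Suc n) (\<lambda>xs. h (mset (take n xs), mset (take n (tl xs))))"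
    by (rule sx_cong) (auto simp: window_count_eq lists_of_def drop_Suc)
  finally show ?thesis .
qed

lemma expectation_count_law:
  assumes "0 < n"
  shows "measure_pmf.expectation (count_law P \<pi>P n) h = sx n (\<lambda>xs. h (mset (take n xs)))"
proof -
  have "measure_pmf.expectation (count_law P \<pi>P n) h = sx (Suc n) (\<lambda>xs. h (window_count n 0 xs))"
    by (simp add: count_law_def expectation_chain_law)
  also have "\<dots> = sx (Suc n) (\<lambda>xs. h (mset (take n (take n xs))))"
    by (rule sx_cong) (auto simp: window_count_eq lists_of_def)
  also have "\<dots> = sx n (\<lambda>xs. h (mset (take n xs)))"
    using assms by (intro sx_take[where \<Phi> = "\<lambda>xs. h (mset (take n xs))"]) auto
  finally show ?thesis .
qed

text \<open>Reversing the path interchanges the two windows up to the order of their entries; this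
  is the reversibility of the count kernel.\<close>

lemma sx_reverse_joint:
  "sx (Suc n) (\<lambda>xs. h (mset (take n xs)) (mset (take n (tl xs)))) =
   sx (Suc n) (\<lambda>xs. h (mset (take n (tl xs))) (mset (take n xs)))"
proof -
  have "sx (Suc n) (\<lambda>xs. h (mset (take n xs)) (mset (take n (tl xs)))) =
     sx (Suc n) (\<lambda>xs. h (mset (take n (rev xs))) (mset (take n (tl (rev xs)))))"
    by (rule sx_rev[symmetric]) simp
  also have "\<dots> = sx (Suc n) (\<lambda>xs. h (mset (take n (tl xs))) (mset (take n xs)))"
  proof (rule sx_cong)
    fix xs assume xs: "xs \<in> lists_of (Suc n)"
    then have l: "length xs = Suc n" by (simp add: lists_of_def)
    show "h (mset (take n (rev xs))) (mset (take n (tl (rev xs))))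
        = h (mset (take n (tl xs))) (mset (take n xs))"
      unfolding take_rev_window[OF xs] using l by simp
  qed
  finally show ?thesis .
qed

lemma joint_sym: "pmf (count_joint_law P \<pi>P n) (k, l) = pmf (count_joint_law P \<pi>P n) (l, k)"
  unfolding pmf_expectation[of "count_joint_law P \<pi>P n"] expectation_joint
  using sx_reverse_joint[of n "\<lambda>a b. if (a, b) = (k, l) then 1 else 0"] by (simp add: conj_commute)

lemma joint_fst: "map_pmf fst (count_joint_law P \<pi>P n) = count_law P \<pi>P n"
  by (simp add: count_joint_law_def count_law_def pmf.map_comp o_def)

lemma joint_set: "set_pmf (count_joint_law P \<pi>P n) \<subseteq> count_states P \<pi>P n \<times> count_states P \<pi>P n"
proof
  fix kl assume kl: "kl \<in> set_pmf (count_joint_law P \<pi>P n)"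
  obtain k l where e: "kl = (k, l)" by (cases kl)
  have fst: "a \<in> count_states P \<pi>P n" if "(a, b) \<in> set_pmf (count_joint_law P \<pi>P n)" for a b
    using that unfolding count_states_def joint_fst[symmetric] by force
  have "(l, k) \<in> set_pmf (count_joint_law P \<pi>P n)"
    using kl e joint_sym[of n k l] by (simp add: set_pmf_iff)
  then show "kl \<in> count_states P \<pi>P n \<times> count_states P \<pi>P n" using fst kl e by auto
qed

lemma finite_count_states: "finite (count_states P \<pi>P n)"
  by (simp add: count_states_def count_law_def finite_chain_law)

abbreviation "KS n \<equiv> count_states P \<pi>P n"
abbreviation "KJ n k l \<equiv> pmf (count_joint_law P \<pi>P n) (k, l)"
abbreviation "K\<mu> n \<equiv> pmf (count_law P \<pi>P n)"

lemma count_rev_form: "rev_form (KS n) (KJ n) (K\<mu> n)"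
proof
  show "finite (KS n)" by (rule finite_count_states)
  show "KS n \<noteq> {}" by (simp add: count_states_def set_pmf_not_empty)
  show "0 < K\<mu> n x" if "x \<in> KS n" for x
    using that by (simp add: count_states_def pmf_positive)
  show "sum (K\<mu> n) (KS n) = 1"
    by (rule sum_pmf_eq_1[OF finite_count_states]) (simp add: count_states_def)
  show "(\<Sum>l\<in>KS n. KJ n k l) = K\<mu> n k" for k
  proof -
    have "K\<mu> n k = measure_pmf.expectation (count_joint_law P \<pi>P n) (\<lambda>x. if fst x = k then 1 else 0)"
      unfolding joint_fst[symmetric] pmf_expectation by simp
    also have "\<dots> = (\<Sum>a\<in>{k} \<times> KS n. (if fst a = k then 1 else 0) * pmf (count_joint_law P \<pi>P n) a)"
      by (rule integral_measure_pmf_real) (use joint_set finite_count_states in \<open>auto split: if_splits\<close>)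
    also have "\<dots> = (\<Sum>l\<in>KS n. KJ n k l)"
      by (simp add: sum.cartesian_product')
    finally show ?thesis ..
  qed
qed (auto intro: joint_sym)

lemma count_energy:
  "rev_form.energy (KS n) (KJ n) (K\<mu> n) F F =
     dirF F n / 2"
proof -
  let ?S = "KS n" and ?J = "count_joint_law P \<pi>P n"
  have "dirF F n = measure_pmf.expectation ?J (\<lambda>(k, l). (F k - F l)\<^sup>2)"
    by (simp add: expectation_joint dirF_def diffF_def winF_def)
  also have "\<dots> = (\<Sum>a\<in>?S \<times> ?S. (case a of (k, l) \<Rightarrow> (F k - F l)\<^sup>2) * pmf ?J a)"
    by (rule integral_measure_pmf_real) (use joint_set finite_count_states in auto)
  also have "\<dots> = (\<Sum>k\<in>?S. \<Sum>l\<in>?S. pmf ?J (k, l) * (F k - F l)\<^sup>2)"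
    by (subst sum.cartesian_product) (simp add: case_prod_unfold mult.commute)
  finally show ?thesis by (simp add: rev_form.energy_eq[OF count_rev_form])
qed

lemma count_mean:
  assumes "0 < n"
  shows "(\<Sum>k\<in>KS n. K\<mu> n k * h k) = sx n (\<lambda>xs. h (mset (take n xs)))"
proof -
  have "measure_pmf.expectation (count_law P \<pi>P n) h = (\<Sum>k\<in>KS n. h k * K\<mu> n k)"
    by (rule integral_measure_pmf_real) (auto simp: finite_count_states, simp add: count_states_def)
  then show ?thesis by (simp add: expectation_count_law[OF assms] mult.commute)
qed

lemma count_vari:
  assumes "0 < n"
  shows "rev_form.vari (KS n) (K\<mu> n) F = varF F n"
proof -
  have "varF F n = sx n (\<lambda>xs. (winF F n xs)\<^sup>2) - (sx n (winF F n))\<^sup>2"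
    using sx_sq[OF assms, of "winF F n" 0] by (simp add: varF_def)
  moreover have "rev_form.mean (KS n) (K\<mu> n) F = sx n (winF F n)"
    unfolding rev_form.mean_def[OF count_rev_form] count_mean[OF assms] by (simp add: winF_def[abs_def])
  moreover have "rev_form.ip (KS n) (K\<mu> n) F F = sx n (\<lambda>xs. (winF F n xs)\<^sup>2)"
    unfolding rev_form.ip_def[OF count_rev_form] using count_mean[OF assms, of "\<lambda>k. (F k)\<^sup>2"]
    by (simp add: winF_def power2_eq_square mult.assoc)
  ultimately show ?thesis unfolding rev_form.vari_def[OF count_rev_form] by simp
qed

definition gapK :: "nat \<Rightarrow> real" where
  "gapK n = right_gap (count_states P \<pi>P n) (count_kernel P \<pi>P n)"

lemma gapK_eq: "gapK n = right_gap (count_states P \<pi>P n)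
   (rev_form.kern (KJ n) (K\<mu> n))"
  unfolding gapK_def
  by (rule right_gap_cong) (simp add: rev_form.kern_def[OF count_rev_form] count_kernel_def)

lemma gapK_le: "0 < n \<Longrightarrow> gapK n * varF F n \<le> dirF F n / 2"
  using rev_form.right_gap_poincare[OF count_rev_form, of n F]
  by (simp add: gapK_eq count_energy count_vari)

text \<open>1080 is twice 540, because the energy of the count form is \<open>dirF / 2\<close>. A
  one-element count space has gap 1 by convention, and \<open>gapP \<le> 2\<close> suffices
  there.\<close>

lemma gapK_ge:
  assumes n: "0 < n" and m: "2 \<le> card \<Omega>"
  shows "gapP / (1080 * real (card \<Omega>) * real n) \<le> gapK n"
proof (cases "2 \<le> card (count_states P \<pi>P n)")
  case True
  have g: "0 < gapP" by (rule gapP_pos[OF m])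
  define c where "c = gapP / (1080 * real (card \<Omega>) * real n)"
  have "0 < card \<Omega>" using m by linarith
  then have c: "0 < c" using g n by (simp add: c_def)
  have "c * varF F n \<le> dirF F n / 2" for F
  proof -
    have "c * varF F n \<le> c * (540 * real (card \<Omega>) * real n / gapP * dirF F n)"
      using c varF_bound[OF n m g gapP_le_2 gapP_poincare, of F] by (intro mult_left_mono) auto
    also have "\<dots> = dirF F n / 2" unfolding c_def using g n \<open>0 < card \<Omega>\<close> by (simp add: field_simps)
    finally show ?thesis .
  qed
  then have "c \<le> gapK n" unfolding gapK_eq
    using c True by (intro rev_form.right_gap_ge[OF count_rev_form])
        (auto simp: count_energy count_vari[OF n])
  then show ?thesis by (simp add: c_def)
next
  case False
  have "0 < card (count_states P \<pi>P n)"
    using finite_count_states set_pmf_not_empty by (auto simp: card_gt_0_iff count_states_def)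
  then have "is_singleton (count_states P \<pi>P n)" using False by (simp add: is_singleton_altdef)
  then have "gapK n = 1" by (simp add: gapK_def right_gap_def)
  moreover have "gapP / (1080 * real (card \<Omega>) * real n) \<le> 1"
  proof -
    have "1 \<le> real (card \<Omega>) * real n" using n m by (metis One_nat_def Suc_leI le_trans
        mult_le_mono nat_mult_1 of_nat_1 of_nat_le_iff of_nat_mult one_le_numeral)
    then show ?thesis using gapP_le_2 by (simp add: field_simps)
  qed
  ultimately show ?thesis by simp
qed

lemma gap_ratio_ge:
  assumes n: "0 < n" and m: "2 \<le> card \<Omega>"
  shows "1 / (1080 * real (card \<Omega>)) \<le> gap_ratio \<Omega> P \<pi>P n"
proof -
  have g: "0 < gapP" by (rule gapP_pos[OF m])
  have "1 / (1080 * real (card \<Omega>)) = real n * (gapP / (1080 * real (card \<Omega>) * real n)) / gapP"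
    using g n by (simp add: field_simps)
  also have "\<dots> \<le> real n * gapK n / gapP"
    using g gapK_ge[OF n m] by (intro divide_right_mono mult_left_mono) auto
  finally show ?thesis by (simp add: gap_ratio_def gapK_def gapP_def)
qed

lemma gap_ratio_le:
  assumes n: "0 < n" and V: "0 < varF F n" and g: "0 < g" "g \<le> gapP"
  shows "gap_ratio \<Omega> P \<pi>P n \<le> real n * (dirF F n / 2) / (g * varF F n)"
proof -
  have "gapK n \<le> dirF F n / 2 / varF F n"
    using gapK_le[OF n, of F] V by (simp add: field_simps)
  moreover have "0 \<le> dirF F n / 2 / varF F n" using dirF_nonneg V by (intro divide_nonneg_nonneg) auto
  ultimately have "real n * gapK n / gapP \<le> real n * (dirF F n / 2 / varF F n) / g"
    using g by (intro frac_le mult_left_mono mult_nonneg_nonneg) auto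
  then show ?thesis by (simp add: gap_ratio_def gapK_def gapP_def mult.commute)
qed

end

subsection \<open>Two facts on sequences\<close>

lemma affine_recursion_tendsto:
  fixes u s :: "nat \<Rightarrow> real"
  assumes a: "0 \<le> a" "a < 1" and u: "\<And>t. u (Suc t) = a * u t + s t" and s: "s \<longlonglongrightarrow> L"
  shows "u \<longlonglongrightarrow> L / (1 - a)"
proof (rule LIMSEQ_I)
  fix r :: real assume r: "0 < r"
  define e where "e t = u t - L / (1 - a)" for t
  have eS: "e (Suc t) = a * e t + (s t - L)" for t
    using a by (simp add: e_def u field_simps)
  have "0 < r * (1 - a) / 2" using r a by simp
  then obtain T where T: "\<And>t. T \<le> t \<Longrightarrow> \<bar>s t - L\<bar> < r * (1 - a) / 2"
    using LIMSEQ_D[OF s] by (metis real_norm_def)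
  have b: "\<bar>e (T + k)\<bar> \<le> a ^ k * \<bar>e T\<bar> + r / 2" for k
  proof (induction k)
    case (Suc k)
    have "\<bar>e (T + Suc k)\<bar> \<le> a * \<bar>e (T + k)\<bar> + \<bar>s (T + k) - L\<bar>"
      using eS[of "T + k"] a abs_triangle_ineq[of "a * e (T + k)" "s (T + k) - L"] by (simp add: abs_mult)
    also have "\<dots> \<le> a * (a ^ k * \<bar>e T\<bar> + r / 2) + r * (1 - a) / 2"
      using Suc a T[of "T + k"] by (intro add_mono mult_left_mono) auto
    also have "\<dots> = a ^ Suc k * \<bar>e T\<bar> + r / 2" by (simp add: field_simps)
    finally show ?case .
  qed (use r in simp)
  have "(\<lambda>k. a ^ k * \<bar>e T\<bar>) \<longlonglongrightarrow> 0 * \<bar>e T\<bar>"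
    using a by (intro tendsto_intros LIMSEQ_realpow_zero) auto
  then have "eventually (\<lambda>k. a ^ k * \<bar>e T\<bar> < r / 2) sequentially"
    using r by (intro order_tendstoD(2)) auto
  then obtain K where K: "\<And>k. K \<le> k \<Longrightarrow> a ^ k * \<bar>e T\<bar> < r / 2"
    by (auto simp: eventually_sequentially)
  have "norm (u t - L / (1 - a)) < r" if "T + K \<le> t" for t
  proof -
    obtain k where k: "t = T + k" "K \<le> k" using \<open>T + K \<le> t\<close> by (metis add.assoc le_add1 le_iff_add)
    show ?thesis using b[of k] K[OF k(2)] by (simp add: k e_def)
  qed
  then show "\<exists>no. \<forall>n\<ge>no. norm (u n - L / (1 - a)) < r" by blast
qed

lemma cesaro_mean:
  fixes s :: "nat \<Rightarrow> real"
  assumes s: "s \<longlonglongrightarrow> L"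
  shows "(\<lambda>n. (\<Sum>i<n. s i) / real n) \<longlonglongrightarrow> L"
proof (rule LIMSEQ_I)
  fix r :: real assume r: "0 < r"
  obtain T where T: "\<And>t. T \<le> t \<Longrightarrow> \<bar>s t - L\<bar> < r / 2"
    using LIMSEQ_D[OF s, of "r / 2"] r by auto
  define C where "C = (\<Sum>i<T. \<bar>s i - L\<bar>)"
  obtain N :: nat where N: "2 * C / r < real N" using reals_Archimedean2 by blast
  have "norm ((\<Sum>i<n. s i) / real n - L) < r" if n: "max (Suc N) T \<le> n" for n
  proof -
    have n0: "0 < real n" and nN: "real N < real n" using n by auto
    have "\<bar>(\<Sum>i<n. s i) - real n * L\<bar> = \<bar>\<Sum>i<n. s i - L\<bar>" by (simp add: sum_subtractf)
    also have "\<dots> \<le> (\<Sum>i<n. \<bar>s i - L\<bar>)" by (rule sum_abs)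
    also have "\<dots> \<le> (\<Sum>i<n. (if i < T then \<bar>s i - L\<bar> else 0) + r / 2)"
      using T r by (intro sum_mono) (auto simp: not_less less_imp_le)
    also have "\<dots> = C + real n * (r / 2)"
    proof -
      have "(\<Sum>i<n. if i < T then \<bar>s i - L\<bar> else 0) = (\<Sum>i\<in>{..<n} \<inter> {i. i < T}. \<bar>s i - L\<bar>)"
        by (simp add: sum.If_cases)
      also have "{..<n} \<inter> {i. i < T} = {..<T}" using n by auto
      finally show ?thesis by (simp add: sum.distrib C_def)
    qed
    also have "C < real n * (r / 2)"
    proof -
      have "2 * C < real N * r" using N r by (simp add: field_simps)
      also have "\<dots> < real n * r" using nN r by simp
      finally show ?thesis by simp
    qed
    finally have X: "\<bar>(\<Sum>i<n. s i) - real n * L\<bar> < real n * r" by (simp add: mult.commute[of r])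
    have "(\<Sum>i<n. s i) / real n - L = ((\<Sum>i<n. s i) - real n * L) / real n"
      using n0 by (simp add: field_simps)
    then have "norm ((\<Sum>i<n. s i) / real n - L) = \<bar>(\<Sum>i<n. s i) - real n * L\<bar> / real n"
      using n0 by (simp add: abs_divide)
    also have "\<dots> < r" unfolding pos_divide_less_eq[OF n0] using X by (simp only: mult.commute[of r])
    finally show ?thesis .
  qed
  then show "\<exists>no. \<forall>n\<ge>no. norm ((\<Sum>i<n. s i) / real n - L) < r" by blast
qed

subsection \<open>A chain on a path with rare upward steps\<close>

definition stay :: "nat \<Rightarrow> real \<Rightarrow> real \<Rightarrow> nat \<Rightarrow> real" where
  "stay M \<epsilon> \<delta> x = 1 - (if x < M then \<epsilon> else 0) - (if 0 < x then \<delta> else 0)"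

text \<open>The guard \<open>0 < x\<close> keeps the downward term away from \<open>x = 0\<close>,
  where truncated subtraction gives \<open>x - 1 = x\<close>.\<close>

definition bdk :: "nat \<Rightarrow> real \<Rightarrow> real \<Rightarrow> nat \<Rightarrow> nat \<Rightarrow> real" where
  "bdk M \<epsilon> \<delta> x y = (if y = Suc x \<and> x < M then \<epsilon> else 0) + (if y = x - 1 \<and> 0 < x then \<delta> else 0)
     + (if y = x then stay M \<epsilon> \<delta> x else 0)"

definition bdZ :: "nat \<Rightarrow> real \<Rightarrow> real \<Rightarrow> real" where
  "bdZ M \<epsilon> \<delta> = (\<Sum>j\<le>M. (\<epsilon> / \<delta>) ^ j)"

definition bdpi :: "nat \<Rightarrow> real \<Rightarrow> real \<Rightarrow> nat \<Rightarrow> real" where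
  "bdpi M \<epsilon> \<delta> x = (\<epsilon> / \<delta>) ^ x / bdZ M \<epsilon> \<delta>"

lemma bdk_sum:
  assumes "x \<le> M"
  shows "(\<Sum>y\<le>M. bdk M \<epsilon> \<delta> x y * h y) = (if x < M then \<epsilon> * h (Suc x) else 0)
     + (if 0 < x then \<delta> * h (x - 1) else 0) + stay M \<epsilon> \<delta> x * h x"
proof -
  have "(\<Sum>y\<le>M. bdk M \<epsilon> \<delta> x y * h y) = (\<Sum>y\<le>M. (if y = Suc x then (if x < M then \<epsilon> * h (Suc x) else 0) else 0)
     + (if y = x - 1 then (if 0 < x then \<delta> * h (x - 1) else 0) else 0)
     + (if y = x then stay M \<epsilon> \<delta> x * h x else 0))"
    by (rule sum.cong) (auto simp: bdk_def algebra_simps)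
  also have "\<dots> = (if x < M then \<epsilon> * h (Suc x) else 0)
     + (if 0 < x then \<delta> * h (x - 1) else 0) + stay M \<epsilon> \<delta> x * h x"
    using assms less_imp_diff_less[of x "Suc M" 1] by (simp add: sum.distrib less_Suc_eq_le)
  finally show ?thesis .
qed

lemma bdk_nonneg: "0 \<le> \<epsilon> \<Longrightarrow> 0 \<le> \<delta> \<Longrightarrow> \<epsilon> + \<delta> \<le> 1 \<Longrightarrow> 0 \<le> bdk M \<epsilon> \<delta> x y"
  by (auto simp: bdk_def stay_def)

lemma bdk_balance:
  assumes "0 < \<delta>" and that: "x \<le> M" "y \<le> M"
  shows "(\<epsilon> / \<delta>) ^ x * bdk M \<epsilon> \<delta> x y = (\<epsilon> / \<delta>) ^ y * bdk M \<epsilon> \<delta> y x"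
proof -
  have 1: "(\<epsilon> / \<delta>) ^ x * bdk M \<epsilon> \<delta> x (Suc x) = (\<epsilon> / \<delta>) ^ Suc x * bdk M \<epsilon> \<delta> (Suc x) x" if "x < M" for x
  proof -
    have "Suc x \<noteq> x - 1" by linarith
    then have "bdk M \<epsilon> \<delta> x (Suc x) = \<epsilon>" "bdk M \<epsilon> \<delta> (Suc x) x = \<delta>" using that by (auto simp: bdk_def)
    then show ?thesis using assms by simp
  qed
  consider "y = x" | "y = Suc x" | "x = Suc y" | "y \<noteq> x \<and> y \<noteq> Suc x \<and> x \<noteq> Suc y" by blast
  then show ?thesis
  proof cases
    case 4
    then have "bdk M \<epsilon> \<delta> x y = 0" "bdk M \<epsilon> \<delta> y x = 0" by (auto simp: bdk_def)
    then show ?thesis by simp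
  qed (use 1[of x] 1[of y] that in auto)
qed

lemma pmf_exists:
  assumes "finite A" "\<And>x. x \<in> A \<Longrightarrow> 0 \<le> f x" "\<And>x. x \<notin> A \<Longrightarrow> f x = 0" "(\<Sum>x\<in>A. f x) = 1"
  obtains q where "\<And>x. pmf q x = f x"
proof -
  have nn: "0 \<le> f x" for x using assms(2,3)[of x] by (cases "x \<in> A") auto
  have "(\<integral>\<^sup>+x. ennreal (f x) \<partial>count_space UNIV) = (\<Sum>x\<in>A. ennreal (f x))"
    by (rule nn_integral_count_space') (use assms in auto)
  also have "\<dots> = 1" using assms by (subst sum_ennreal) auto
  finally have "pmf (embed_pmf f) x = f x" for x using nn by (intro pmf_embed_pmf) auto
  then show thesis by (rule that)
qed

lemma bd_exists:
  assumes e: "0 < \<epsilon>" and d: "0 < \<delta>" and ed: "\<epsilon> + \<delta> \<le> 1"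
  obtains P \<pi> where "irreducible_reversible {..M} P \<pi>"
    "\<And>x y. x \<le> M \<Longrightarrow> y \<le> M \<Longrightarrow> pmf (P x) y = bdk M \<epsilon> \<delta> x y"
    "\<And>x. x \<le> M \<Longrightarrow> pmf \<pi> x = bdpi M \<epsilon> \<delta> x"
proof -
  have Z: "0 < bdZ M \<epsilon> \<delta>" unfolding bdZ_def using e d by (intro sum_pos) auto
  have row: "(\<Sum>y\<le>M. bdk M \<epsilon> \<delta> x y) = 1" if "x \<le> M" for x
    using bdk_sum[OF that, of \<epsilon> \<delta> "\<lambda>_. 1"] that by (auto simp: stay_def)
  have "\<forall>x. \<exists>q. x \<le> M \<longrightarrow> (\<forall>y. pmf q y = (if y \<le> M then bdk M \<epsilon> \<delta> x y else 0))"
  proof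
    fix x
    show "\<exists>q. x \<le> M \<longrightarrow> (\<forall>y. pmf q y = (if y \<le> M then bdk M \<epsilon> \<delta> x y else 0))"
    proof (cases "x \<le> M")
      case True
      obtain q where "\<And>y. pmf q y = (if y \<le> M then bdk M \<epsilon> \<delta> x y else 0)"
        by (rule pmf_exists[of "{..M}" "\<lambda>y. if y \<le> M then bdk M \<epsilon> \<delta> x y else 0"])
           (use e d ed row[OF True] in \<open>auto intro: bdk_nonneg\<close>)
      then show ?thesis by blast
    qed simp
  qed
  then obtain P where P: "\<And>x y. x \<le> M \<Longrightarrow> pmf (P x) y = (if y \<le> M then bdk M \<epsilon> \<delta> x y else 0)" by metis
  obtain \<pi> where pi: "\<And>x. pmf \<pi> x = (if x \<le> M then bdpi M \<epsilon> \<delta> x else 0)"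
  proof (rule pmf_exists[of "{..M}" "\<lambda>x. if x \<le> M then bdpi M \<epsilon> \<delta> x else 0"])
    show "(\<Sum>x\<le>M. if x \<le> M then bdpi M \<epsilon> \<delta> x else 0) = 1"
      using Z by (simp add: bdpi_def sum_divide_distrib[symmetric]) (simp add: bdZ_def)
  qed (use e d Z in \<open>auto simp: bdpi_def\<close>)
  have bal: "pmf \<pi> x * pmf (P x) y = pmf \<pi> y * pmf (P y) x" if "x \<le> M" "y \<le> M" for x y
    using bdk_balance[OF d that, of \<epsilon>] that by (simp add: P pi bdpi_def)
  have sub: "set_pmf (P x) \<subseteq> {..M}" if "x \<le> M" for x
    using that by (auto simp: set_pmf_iff P split: if_splits)
  have subpi: "set_pmf \<pi> \<subseteq> {..M}" by (auto simp: set_pmf_iff pi split: if_splits)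
  let ?R = "{(a, b). a \<in> {..M} \<and> b \<in> {..M} \<and> pmf (P a) b > 0}"
  have edge: "(x, Suc x) \<in> ?R" "(Suc x, x) \<in> ?R" if "Suc x \<le> M" for x
    using that e d ed by (auto simp: P bdk_def)
  have up: "(0, x) \<in> ?R\<^sup>*" "(x, 0) \<in> ?R\<^sup>*" if "x \<le> M" for x
    using that
  proof (induction x)
    case (Suc x)
    { case 1 then show ?case using Suc edge[of x] by (meson Suc_leD rtrancl.rtrancl_into_rtrancl) }
    { case 2 then show ?case using Suc edge[of x] by (meson Suc_leD converse_rtrancl_into_rtrancl) }
  qed auto
  have "irreducible_reversible {..M} P \<pi>"
    unfolding irreducible_reversible_def
  proof (intro conjI)
    show "markov_kernel {..M} P" using sub by (auto simp: markov_kernel_def)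
    show "irreducible_kernel {..M} P" unfolding irreducible_kernel_def
      using up by (blast intro: rtrancl_trans)
    show "reversible_kernel {..M} P \<pi>" using bal by (auto simp: reversible_kernel_def)
    show "stationary_law {..M} P \<pi>" unfolding stationary_law_def
    proof (intro conjI subpi pmf_eqI)
      fix y
      have "pmf (bind_pmf \<pi> P) y = (\<Sum>x\<le>M. pmf (P x) y * pmf \<pi> x)"
        unfolding pmf_bind by (rule integral_measure_pmf_real) (use subpi in auto)
      also have "\<dots> = pmf \<pi> y"
      proof (cases "y \<le> M")
        case True
        have "(\<Sum>x\<le>M. pmf (P x) y * pmf \<pi> x) = (\<Sum>x\<le>M. pmf \<pi> y * bdk M \<epsilon> \<delta> y x)"
          using True bal[of _ y] by (intro sum.cong refl) (simp add: mult.commute P)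
        then show ?thesis using row[OF True] by (simp add: sum_distrib_left[symmetric])
      qed (simp add: P pi)
      finally show "pmf (bind_pmf \<pi> P) y = pmf \<pi> y" .
    qed
  qed
  then show thesis by (rule that) (auto simp: P pi)
qed

locale bd_chain = pmf_chain "{..M}" P \<pi>P for M :: nat and P \<pi>P +
  fixes \<epsilon> \<delta> :: real
  assumes M1: "1 \<le> M" and eps: "0 < \<epsilon>" and del: "0 < \<delta>" and sum1: "\<epsilon> + \<delta> \<le> 1"
    and P_eq: "\<And>x y. x \<le> M \<Longrightarrow> y \<le> M \<Longrightarrow> pmf (P x) y = bdk M \<epsilon> \<delta> x y"
    and pi_eq: "\<And>x. x \<le> M \<Longrightarrow> pmf \<pi>P x = bdpi M \<epsilon> \<delta> x"
begin

abbreviation \<eta> :: real where "\<eta> \<equiv> \<epsilon> / \<delta>"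

lemma P_sum:
  "x \<le> M \<Longrightarrow> (\<Sum>y\<le>M. pmf (P x) y * h y) = (if x < M then \<epsilon> * h (Suc x) else 0)
     + (if 0 < x then \<delta> * h (x - 1) else 0) + stay M \<epsilon> \<delta> x * h x"
  using bdk_sum[of x M \<epsilon> \<delta> h] by (simp add: P_eq)

lemma pi_Suc: "Suc x \<le> M \<Longrightarrow> pmf \<pi>P (Suc x) = \<eta> * pmf \<pi>P x"
  by (simp add: pi_eq bdpi_def)

lemma bd_energy: "energy f f = (\<Sum>x<M. pmf \<pi>P (Suc x) * \<delta> * (f (Suc x) - f x)\<^sup>2)"
proof -
  define a where "a x = pmf \<pi>P (Suc x) * \<delta> * (f (Suc x) - f x)\<^sup>2" for x
  have "(\<Sum>y\<le>M. pmf \<pi>P x * pmf (P x) y * (f x - f y)\<^sup>2) = (if x < M then a x else 0) + (if 0 < x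
      then a (x - 1) else 0)"
    if x: "x \<le> M" for x
  proof -
    have "(\<Sum>y\<le>M. pmf \<pi>P x * pmf (P x) y * (f x - f y)\<^sup>2) = pmf \<pi>P x * (\<Sum>y\<le>M. pmf (P x) y * (f x - f y)\<^sup>2)"
      by (simp add: sum_distrib_left mult.assoc)
    also have "\<dots> = pmf \<pi>P x * ((if x < M then \<epsilon> * (f x - f (Suc x))\<^sup>2 else 0)
       + (if 0 < x then \<delta> * (f x - f (x - 1))\<^sup>2 else 0))"
      unfolding P_sum[OF x] by simp
    also have "\<dots> = (if x < M then a x else 0) + (if 0 < x then a (x - 1) else 0)"
      using del x by (auto simp: a_def pi_Suc algebra_simps power2_commute[of "f x" "f (Suc x)"]
          power2_commute[of "f 0" "f (Suc 0)"])
    finally show ?thesis .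
  qed
  then have "2 * energy f f = (\<Sum>x\<le>M. (if x < M then a x else 0) + (if 0 < x then a (x - 1) else 0))"
    by (simp add: energy_eq)
  also have "\<dots> = (\<Sum>x\<le>M. if x < M then a x else 0) + (\<Sum>x\<le>M. if 0 < x then a (x - 1) else 0)"
    by (rule sum.distrib)
  also have "(\<Sum>x\<le>M. if x < M then a x else 0) = (\<Sum>x<M. a x)"
  proof -
    have "{..M} \<inter> {x. x < M} = {..<M}" by auto
    then show ?thesis by (simp add: sum.If_cases)
  qed
  also have "(\<Sum>x\<le>M. if 0 < x then a (x - 1) else 0) = (\<Sum>x<M. a x)"
  proof -
    obtain k where k: "M = Suc k" using M1 by (cases M) auto
    show ?thesis unfolding k sum.atMost_Suc_shift by (simp add: lessThan_Suc_atMost)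
  qed
  finally show ?thesis by (simp add: a_def)
qed

text \<open>Hardy inequality for \<open>f - f 0\<close>: masses shrink by the factor
  \<open>\<eta>\<close> per level, so shifting the squares down one level bounds \<open>V\<close> by
  \<open>(1 + s) * \<eta> * V\<close> plus the energy term, and \<open>V\<close> is
  absorbed.\<close>

lemma bd_poincare:
  assumes s: "0 < s" and that: "(1 + s) * \<eta> < 1"
  shows "\<delta> * (1 - (1 + s) * \<eta>) / (1 + 1 / s) * vari f \<le> energy f f"
proof -
  define V where "V = (\<Sum>x<M. pmf \<pi>P (Suc x) * (f (Suc x) - f 0)\<^sup>2)"
  have eta: "0 < \<eta>" using eps del by simp
  have shift: "(\<Sum>x\<le>M. pmf \<pi>P x * (f x - f 0)\<^sup>2) = V"
  proof -
    obtain k where k: "M = Suc k" using M1 by (cases M) auto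
    show ?thesis unfolding V_def k sum.atMost_Suc_shift by (simp add: lessThan_Suc_atMost)
  qed
  have vV: "vari f \<le> V" unfolding shift[symmetric] using vari_le[of f "f 0"]
    by (simp add: ip_def power2_eq_square mult.assoc)
  have "V \<le> (\<Sum>x<M. pmf \<pi>P (Suc x) * ((1 + s) * (f x - f 0)\<^sup>2 + (1 + 1 / s) * (f (Suc x) - f x)\<^sup>2))"
    unfolding V_def
  proof (intro sum_mono mult_left_mono)
    fix x
    define A where "A = f x - f 0"
    define a where "a = f (Suc x) - f x"
    have "0 \<le> (s * A - a)\<^sup>2 / s" using s by simp
    also have "\<dots> = (1 + s) * A\<^sup>2 + (1 + 1 / s) * a\<^sup>2 - (A + a)\<^sup>2"
      using s by (simp add: power2_eq_square field_simps)
    finally show "(f (Suc x) - f 0)\<^sup>2 \<le> (1 + s) * (f x - f 0)\<^sup>2 + (1 + 1 / s) * (f (Suc x) - f x)\<^sup>2"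
      by (simp add: A_def a_def)
  qed simp
  also have "\<dots> = (1 + s) * (\<Sum>x<M. pmf \<pi>P (Suc x) * (f x - f 0)\<^sup>2)
     + (1 + 1 / s) * (\<Sum>x<M. pmf \<pi>P (Suc x) * (f (Suc x) - f x)\<^sup>2)"
    by (simp only: distrib_left sum.distrib sum_distrib_left mult.left_commute)
  also have "(\<Sum>x<M. pmf \<pi>P (Suc x) * (f (Suc x) - f x)\<^sup>2) = energy f f / \<delta>"
    using del by (simp add: bd_energy sum_divide_distrib)
  finally have V1: "V \<le> (1 + s) * (\<Sum>x<M. pmf \<pi>P (Suc x) * (f x - f 0)\<^sup>2) + (1 + 1 / s) * (energy f f / \<delta>)" .
  have "(\<Sum>x<M. pmf \<pi>P (Suc x) * (f x - f 0)\<^sup>2) = \<eta> * (\<Sum>x<M. pmf \<pi>P x * (f x - f 0)\<^sup>2)"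
    unfolding sum_distrib_left by (rule sum.cong) (auto simp: pi_Suc)
  also have "\<dots> \<le> \<eta> * V"
    unfolding shift[symmetric] using eta by (intro mult_left_mono sum_mono2) auto
  finally have "(1 + s) * (\<Sum>x<M. pmf \<pi>P (Suc x) * (f x - f 0)\<^sup>2) \<le> (1 + s) * (\<eta> * V)"
    using s by (intro mult_left_mono) auto
  with V1 have "V \<le> (1 + s) * (\<eta> * V) + (1 + 1 / s) * (energy f f / \<delta>)" by linarith
  then have V2: "(1 - (1 + s) * \<eta>) * V \<le> (1 + 1 / s) * (energy f f / \<delta>)" by (simp add: algebra_simps)
  define K where "K = 1 + 1 / s"
  have K: "0 < K" using s by (simp add: K_def add_pos_pos)
  have "\<delta> * (1 - (1 + s) * \<eta>) / K * vari f \<le> \<delta> * (1 - (1 + s) * \<eta>) / K * V"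
    using vV del K that by (intro mult_left_mono) auto
  also have "\<dots> = \<delta> / K * ((1 - (1 + s) * \<eta>) * V)" by simp
  also have "\<dots> \<le> \<delta> / K * (K * (energy f f / \<delta>))"
    using V2 del K unfolding K_def[symmetric] by (intro mult_left_mono) auto
  also have "\<dots> = energy f f" using del K by simp
  finally show ?thesis unfolding K_def .
qed

text \<open>\<open>s = 1 / sqrt \<eta>\<close> makes both losses, \<open>s * \<eta>\<close> and
  \<open>1 / s\<close>, equal to \<open>sqrt \<eta>\<close>; the bound tends to
  \<open>\<delta>\<close> as \<open>\<epsilon> \<rightarrow> 0\<close>.\<close>

lemma bd_gap:
  assumes "\<eta> + sqrt \<eta> < 1"
  shows "\<delta> * (1 - \<eta> - sqrt \<eta>) / (1 + sqrt \<eta>) \<le> gapP"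
proof -
  have eta: "0 < \<eta>" using eps del by simp
  define s where "s = 1 / sqrt \<eta>"
  have s: "0 < s" using eta by (simp add: s_def)
  have e: "(1 + s) * \<eta> = \<eta> + sqrt \<eta>"
  proof -
    have "s * \<eta> = sqrt \<eta>" proof -
      have "\<eta> / sqrt \<eta> = sqrt \<eta>" using eta by (intro real_div_sqrt) simp
      then show ?thesis unfolding s_def by (simp only: times_divide_eq_left mult_1_left)
    qed
    then show ?thesis by (simp only: distrib_right mult_1_left)
  qed
  have "0 < \<delta> * (1 - (1 + s) * \<eta>) / (1 + 1 / s)" using del s e assms by (simp add: add_pos_pos)
  then have "\<delta> * (1 - (1 + s) * \<eta>) / (1 + 1 / s) \<le> gapP"
    unfolding gapP_eq using M1 bd_poincare[OF s] e assms by (intro right_gap_ge) auto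
  moreover have "1 / s = sqrt \<eta>" by (simp add: s_def)
  ultimately show ?thesis unfolding e by (simp only: diff_diff_eq)
qed

end

text \<open>
  \<open>tW\<close> and \<open>tY\<close> are the tilted kernels \<open>tiltW\<close> and \<open>tiltY\<close> below, the latter divided by
  \<open>\<epsilon>\<^bsup>M-x\<^esup>\<close>, the probability scale of a climb from \<open>x\<close> to \<open>M\<close>. They are polynomials in \<open>\<epsilon>\<close>,
  so that the limit \<open>\<epsilon> \<rightarrow> 0\<close> amounts to putting \<open>\<epsilon> = 0\<close>.
\<close>

primrec tW :: "nat \<Rightarrow> real \<Rightarrow> (nat \<Rightarrow> real) \<Rightarrow> nat \<Rightarrow> nat \<Rightarrow> real \<Rightarrow> nat \<Rightarrow> real" where
  "tW M \<delta> b i 0 \<epsilon> = (\<lambda>x. if x = i then 1 else 0)"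
| "tW M \<delta> b i (Suc t) \<epsilon> = (\<lambda>x. (b x)\<^sup>2 * ((if x < M then \<epsilon> * tW M \<delta> b i t \<epsilon> (Suc x) else 0)
     + (if 0 < x then \<delta> * tW M \<delta> b i t \<epsilon> (x - 1) else 0) + stay M \<epsilon> \<delta> x * tW M \<delta> b i t \<epsilon> x))"

primrec tY :: "nat \<Rightarrow> real \<Rightarrow> (nat \<Rightarrow> real) \<Rightarrow> nat \<Rightarrow> nat \<Rightarrow> real \<Rightarrow> nat \<Rightarrow> real" where
  "tY M \<delta> b i 0 \<epsilon> = (\<lambda>x. 0)"
| "tY M \<delta> b i (Suc t) \<epsilon> = (\<lambda>x. if x = M then tW M \<delta> b i (Suc t) \<epsilon> M else
     (b x)\<^sup>2 * (tY M \<delta> b i t \<epsilon> (Suc x) + (if 0 < x then \<delta> * \<epsilon> * tY M \<delta> b i t \<epsilon> (x - 1) else 0)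
       + stay M \<epsilon> \<delta> x * tY M \<delta> b i t \<epsilon> x))"

text \<open>This is \<open>jump\<close> below divided by \<open>\<epsilon> ^ (M - j)\<close>. The
  stationary mass of \<open>j\<close> supplies the missing \<open>\<epsilon> ^ j\<close>, so all
  levels enter at the same order \<open>\<epsilon> ^ M\<close>.\<close>

definition flux :: "nat \<Rightarrow> real \<Rightarrow> (nat \<Rightarrow> real) \<Rightarrow> nat \<Rightarrow> nat \<Rightarrow> real \<Rightarrow> nat \<Rightarrow> real" where
  "flux M \<delta> b i t \<epsilon> j = (b j - b i)\<^sup>2 * ((if j < M then tY M \<delta> b i t \<epsilon> (Suc j) else 0)
       + \<delta> * \<epsilon> * tY M \<delta> b i t \<epsilon> (j - 1) + stay M \<epsilon> \<delta> j * tY M \<delta> b i t \<epsilon> j)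
     + (if j = M then (b M)\<^sup>2 * (\<delta> * (tW M \<delta> b i t \<epsilon> (M - 1) - \<epsilon> * tY M \<delta> b i t \<epsilon> (M - 1))) else 0)"

definition numer :: "nat \<Rightarrow> real \<Rightarrow> (nat \<Rightarrow> real) \<Rightarrow> nat \<Rightarrow> real \<Rightarrow> real" where
  "numer M \<delta> b t \<epsilon> = (\<Sum>j\<le>M. \<Sum>i<j. (1 / \<delta>) ^ j * flux M \<delta> b i t \<epsilon> j)"

lemma tendsto_cond:
  "(C \<Longrightarrow> (f \<longlongrightarrow> a) F) \<Longrightarrow> (\<not> C \<Longrightarrow> (g \<longlongrightarrow> c) F) \<Longrightarrow>
     ((\<lambda>\<epsilon>. if C then f \<epsilon> else g \<epsilon>) \<longlongrightarrow> (if C then a else c)) F"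
  by simp

lemma tendsto_stay: "((\<lambda>\<epsilon>. stay M \<epsilon> \<delta> x) \<longlongrightarrow> stay M 0 \<delta> x) (at_right 0)"
  unfolding stay_def by (intro tendsto_intros tendsto_cond)

lemma tendsto_tW: "((\<lambda>\<epsilon>. tW M \<delta> b i t \<epsilon> x) \<longlongrightarrow> tW M \<delta> b i t 0 x) (at_right 0)"
proof (induction t arbitrary: x)
  case (Suc t)
  show ?case unfolding tW.simps by (intro tendsto_intros tendsto_cond tendsto_stay Suc)
qed simp

lemma tendsto_tY: "((\<lambda>\<epsilon>. tY M \<delta> b i t \<epsilon> x) \<longlongrightarrow> tY M \<delta> b i t 0 x) (at_right 0)"
proof (induction t arbitrary: x)
  case (Suc t)
  show ?case unfolding tY.simps by (intro tendsto_intros tendsto_cond tendsto_stay tendsto_tW Suc)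
qed simp

lemma tendsto_numer: "((\<lambda>\<epsilon>. numer M \<delta> b t \<epsilon>) \<longlongrightarrow> numer M \<delta> b t 0) (at_right 0)"
  unfolding numer_def flux_def by (intro tendsto_intros tendsto_cond tendsto_stay tendsto_tW tendsto_tY)

context bd_chain
begin

subsection \<open>A multiplicative test function\<close>

definition wprod :: "(nat \<Rightarrow> real) \<Rightarrow> nat list \<Rightarrow> real" where
  "wprod b xs = prod_list (map b xs)"

definition topF :: "(nat \<Rightarrow> real) \<Rightarrow> nat multiset \<Rightarrow> real" where
  "topF b K = (if M \<in># K then prod_mset (image_mset b K) else 0)"

lemma wprod_simps [simp]: "wprod b [] = 1" "wprod b (x # xs) = b x * wprod b xs"
  "wprod b (xs @ ys) = wprod b xs * wprod b ys"
  by (simp_all add: wprod_def)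

lemma topF_mset: "topF b (mset xs) = (if M \<in> set xs then wprod b xs else 0)"
proof -
  have "prod_mset (image_mset b (mset xs)) = wprod b xs" by (induction xs) auto
  then show ?thesis by (simp add: topF_def)
qed

text \<open>The weight omits the final entry \<open>i\<close>: for \<open>t = n - 1\<close> it runs
  over the entries common to two consecutive windows, \<open>i\<close> being the new one.\<close>

definition tiltW :: "(nat \<Rightarrow> real) \<Rightarrow> nat \<Rightarrow> nat \<Rightarrow> nat \<Rightarrow> real" where
  "tiltW b i t x = nx t x (\<lambda>ys. if last (x # ys) = i then (wprod b (butlast (x # ys)))\<^sup>2 else 0)"

definition tiltY :: "(nat \<Rightarrow> real) \<Rightarrow> nat \<Rightarrow> nat \<Rightarrow> nat \<Rightarrow> real" where
  "tiltY b i t x = nx t x (\<lambda>ys. if last (x # ys) = i \<and> M \<in> set (butlast (x # ys))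
     then (wprod b (butlast (x # ys)))\<^sup>2 else 0)"

lemma tiltW_Suc: "tiltW b i (Suc t) x = (b x)\<^sup>2 * (\<Sum>y\<le>M. pmf (P x) y * tiltW b i t y)"
proof -
  have "nx t y (\<lambda>ys. if last (x # y # ys) = i then (wprod b (butlast (x # y # ys)))\<^sup>2 else 0) =
     (b x)\<^sup>2 * tiltW b i t y" for y
    unfolding tiltW_def nx_cmult[symmetric] by (rule nx_cong) (auto simp: power_mult_distrib)
  then show ?thesis by (simp add: tiltW_def nx_Suc sum_distrib_left mult.left_commute)
qed

lemma tiltY_Suc: "tiltY b i (Suc t) x = (b x)\<^sup>2 * (\<Sum>y\<le>M. pmf (P x) y * (if x = M then tiltW b i t y
    else tiltY b i t y))"
proof -
  have "nx t y (\<lambda>ys. if last (x # y # ys) = i \<and> M \<in> set (butlast (x # y # ys))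
      then (wprod b (butlast (x # y # ys)))\<^sup>2 else 0) =
     (b x)\<^sup>2 * (if x = M then tiltW b i t y else tiltY b i t y)" for y
    by (auto simp: tiltW_def tiltY_def nx_cmult[symmetric] power_mult_distrib intro!: nx_cong)
  then show ?thesis by (simp add: tiltY_def nx_Suc sum_distrib_left mult.left_commute)
qed

text \<open>The mean squared increment when \<open>j\<close> leaves the window and
  \<open>i < j\<close> enters. If \<open>M\<close> is among the common entries, their product is
  multiplied by \<open>b j - b i\<close>; if \<open>M\<close> is only the leaving entry, the test
  function drops to 0.\<close>

definition jump :: "(nat \<Rightarrow> real) \<Rightarrow> nat \<Rightarrow> nat \<Rightarrow> nat \<Rightarrow> real" where
  "jump b i t j = (b j - b i)\<^sup>2 * (\<Sum>y\<le>M. pmf (P j) y * tiltY b i t y)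
     + (if j = M then (b M)\<^sup>2 * (\<Sum>y\<le>M. pmf (P M) y * (tiltW b i t y - tiltY b i t y)) else 0)"

text \<open>Path reversal exchanges the entering and the leaving entry and flips the sign of the
  increment, which is 0 for equal entries. So the pairs \<open>i < j\<close> carry half of the
  total.\<close>

lemma dirF_tilt:
  assumes n: "0 < n"
  shows "dirF (topF b) n / 2 = (\<Sum>j\<le>M. \<Sum>i<j. pmf \<pi>P j * jump b i (n - 1) j)"
proof -
  obtain k where k: "n = Suc k" using n by (cases n) auto
  define d where "d = diffF (topF b) n"
  define e where "e xs = (if last xs < hd xs then (d xs)\<^sup>2 else 0)" for xs
  have rev: "(d (rev xs))\<^sup>2 = (d xs)\<^sup>2" "hd xs = last xs \<Longrightarrow> d xs = 0" if "xs \<in> lists_of (Suc n)" for xs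
  proof -
    have l: "length xs = Suc n" using that by (simp add: lists_of_def)
    show "(d (rev xs))\<^sup>2 = (d xs)\<^sup>2"
      unfolding d_def diffF_def winF_def take_rev_window[OF that] using l by (simp add: power2_commute)
    assume h: "hd xs = last xs"
    obtain x ys where xs: "xs = x # ys" "length ys = n" using l by (cases xs) auto
    have ne: "ys \<noteq> []" using xs n by auto
    then have "last ys = x" using h xs by simp
    then have "mset ys = mset (butlast ys @ [x])" using append_butlast_last_id[OF ne] by simp
    moreover have "take n xs = x # butlast ys" using xs by (simp add: k butlast_conv_take)
    ultimately have "mset (take n xs) = mset ys" by simp
    then show "d xs = 0" using xs by (simp add: d_def diffF_def winF_def)
  qed
  have "dirF (topF b) n = sx (Suc n) (\<lambda>xs. e xs + e (rev xs))"
    unfolding dirF_def d_def[symmetric]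
  proof (rule sx_cong)
    fix xs assume xs: "xs \<in> lists_of (Suc n)"
    then have "xs \<noteq> []" by (auto simp: lists_of_def)
    then show "(d xs)\<^sup>2 = e xs + e (rev xs)" unfolding e_def
      using rev[OF xs] by (cases "last xs" "hd xs" rule: linorder_cases) (simp_all add: hd_rev last_rev)
  qed
  also have "\<dots> = 2 * sx (Suc n) e" using sx_rev[of "Suc n" e] by (simp add: sx_add)
  finally have "dirF (topF b) n / 2 = (\<Sum>j\<le>M. pmf \<pi>P j * nx n j (\<lambda>zs. e (j # zs)))"
    by (simp add: sx_Suc)
  also have "\<dots> = (\<Sum>j\<le>M. pmf \<pi>P j * (\<Sum>i<j. jump b i (n - 1) j))"
  proof (rule sum.cong[OF refl], rule arg_cong2[where f = "(*)"], rule refl)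
    fix j assume j: "j \<in> {..M}"
    define u where "u i zs = (if last zs = i then (wprod b (butlast zs))\<^sup>2 else 0)" for i zs
    define v where "v i zs = (if last zs = i \<and> M \<in> set (butlast zs) then (wprod b (butlast zs))\<^sup>2
        else 0)" for i zs
    define a where "a = (if j = M then (b M)\<^sup>2 else 0)"
    have "nx n j (\<lambda>zs. e (j # zs)) = nx n j (\<lambda>zs. \<Sum>i<j. (b j - b i)\<^sup>2 * v i zs + a * (u i zs - v i zs))"
    proof (rule nx_cong)
      fix zs assume zs: "zs \<in> lists_of n"
      have l: "length zs = n" "zs \<noteq> []" using zs n by (auto simp: lists_of_def)
      let ?R = "\<lambda>i. (b j - b i)\<^sup>2 * v i zs + a * (u i zs - v i zs)"
      have "(\<Sum>i<j. ?R i) = (\<Sum>i<j. if i = last zs then ?R (last zs) else 0)"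
        by (rule sum.cong) (auto simp: u_def v_def)
      also have "\<dots> = (if last zs < j then ?R (last zs) else 0)" by simp
      also have "\<dots> = e (j # zs)"
      proof (cases "last zs < j")
        case True
        have "winF (topF b) n (j # zs) = topF b (mset (j # butlast zs))"
          using l by (simp add: winF_def k butlast_conv_take)
        moreover have "winF (topF b) n (tl (j # zs)) = topF b (mset (butlast zs @ [last zs]))"
          using l by (simp add: winF_def)
        moreover have "last zs \<noteq> M" using True j by auto
        ultimately have "d (j # zs) = wprod b (butlast zs) *
            (if M \<in> set (butlast zs) then b j - b (last zs) else if j = M then b M else 0)"
          unfolding d_def diffF_def topF_mset by (simp add: right_diff_distrib mult.commute)
        then show ?thesis using True l
          by (simp add: e_def u_def v_def a_def power_mult_distrib)
      qed (use l in \<open>simp add: e_def\<close>)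
      finally show "e (j # zs) = (\<Sum>i<j. ?R i)" ..
    qed
    also have "\<dots> = (\<Sum>i<j. (b j - b i)\<^sup>2 * nx n j (v i) + a * (nx n j (u i) - nx n j (v i)))"
      by (simp only: nx_sum nx_add nx_cmult nx_diff)
    also have "\<dots> = (\<Sum>i<j. jump b i (n - 1) j)"
    proof (rule sum.cong[OF refl])
      fix i
      have "nx n j (u i) = (\<Sum>y\<le>M. pmf (P j) y * tiltW b i k y)"
        "nx n j (v i) = (\<Sum>y\<le>M. pmf (P j) y * tiltY b i k y)"
        unfolding k nx_Suc tiltW_def tiltY_def u_def v_def by (rule refl)+
      then show "(b j - b i)\<^sup>2 * nx n j (v i) + a * (nx n j (u i) - nx n j (v i)) = jump b i (n - 1) j"
        by (cases "j = M") (simp_all add: jump_def a_def k right_diff_distrib sum_subtractf)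
    qed
    finally show "nx n j (\<lambda>zs. e (j # zs)) = (\<Sum>i<j. jump b i (n - 1) j)" .
  qed
  finally show ?thesis by (simp add: sum_distrib_left)
qed

lemma sx_cauchy_schwarz:
  assumes "0 < n" shows "(sx n (\<lambda>xs. f xs * g xs))\<^sup>2 \<le> sx n (\<lambda>xs. (f xs)\<^sup>2) * sx n (\<lambda>xs. (g xs)\<^sup>2)"
proof -
  define w where "w xs = sqrt (pmf \<pi>P (hd xs) * wt xs)" for xs
  have w: "pmf \<pi>P (hd xs) * wt xs = w xs * w xs" if "xs \<in> lists_of n" for xs
    using sx_weight_nonneg[OF assms that] by (simp add: w_def)
  have "sx n (\<lambda>xs. f xs * g xs) = (\<Sum>xs\<in>lists_of n. (w xs * f xs) * (w xs * g xs))"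
    unfolding sx_def by (intro sum.cong refl) (simp add: w mult_ac)
  moreover have "sx n (\<lambda>xs. (h xs)\<^sup>2) = (\<Sum>xs\<in>lists_of n. (w xs * h xs)\<^sup>2)" for h
    unfolding sx_def by (intro sum.cong refl) (simp add: w power2_eq_square mult_ac)
  ultimately show ?thesis by (simp only: Cauchy_Schwarz_ineq_sum)
qed

text \<open>The test function vanishes on windows that miss \<open>M\<close>, so by Cauchy-Schwarz
  its squared mean is at most \<open>n * pmf \<pi>P M\<close> times its second moment. The latter is
  bounded below by the paths from 0 to 0 alone.\<close>

lemma varF_tilt:
  assumes n: "0 < n" and small: "real n * pmf \<pi>P M \<le> 1"
  shows "pmf \<pi>P 0 * tiltY b 0 (n - 1) 0 * (b 0)\<^sup>2 * (1 - real n * pmf \<pi>P M) \<le> varF (topF b) n"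
proof -
  define G where "G = winF (topF b) n"
  define Q where "Q = sx n (\<lambda>xs. (G xs)\<^sup>2)"
  obtain k where k: "n = Suc k" using n by (cases n) auto
  have Q0: "0 \<le> Q" unfolding Q_def by (rule sx_nonneg[OF n]) auto
  have V: "varF (topF b) n = Q - (sx n G)\<^sup>2"
    using sx_sq[OF n, of G 0] by (simp add: varF_def G_def Q_def)
  have "(sx n G)\<^sup>2 = (sx n (\<lambda>xs. G xs * (if M \<in> set xs then 1 else 0)))\<^sup>2"
    by (rule arg_cong[where f = "\<lambda>x. x\<^sup>2"], rule sx_cong) (auto simp: G_def winF_def lists_of_def topF_mset)
  also have "\<dots> \<le> Q * sx n (\<lambda>xs. (if M \<in> set xs then 1 else 0)\<^sup>2)"
    unfolding Q_def by (rule sx_cauchy_schwarz[OF n])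
  also have "\<dots> \<le> Q * (real n * pmf \<pi>P M)"
  proof (rule mult_left_mono[OF _ Q0])
    have "sx n (\<lambda>xs. (if M \<in> set xs then 1 else 0)\<^sup>2) \<le> sx n (\<lambda>xs. \<Sum>i<n. if hd (take 1 (drop i xs)) = M
        then 1 else 0)"
    proof (rule sx_mono[OF n])
      fix xs assume xs: "xs \<in> lists_of n"
      show "(if M \<in> set xs then 1 else 0)\<^sup>2 \<le> (\<Sum>i<n. if hd (take 1 (drop i xs)) = M then 1 else (0::real))"
      proof (cases "M \<in> set xs")
        case True
        then obtain i where i: "i < n" "xs ! i = M" using xs by (auto simp: in_set_conv_nth lists_of_def)
        then have "hd (take 1 (drop i xs)) = M" using xs by (simp add: lists_of_def hd_drop_conv_nth)
        then have "(1::real) \<le> (\<Sum>i\<in>{i}. if hd (take 1 (drop i xs)) = M then 1 else 0)" by simp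
        also have "\<dots> \<le> (\<Sum>i<n. if hd (take 1 (drop i xs)) = M then 1 else 0)"
          using i by (intro sum_mono2) auto
        finally show ?thesis using True by simp
      qed (simp add: sum_nonneg)
    qed
    also have "\<dots> = (\<Sum>i<n. sx 1 (\<lambda>xs. if hd xs = M then 1 else 0))"
    proof -
      have "sx n (\<lambda>xs. if hd (take 1 (drop i xs)) = M then 1 else 0) = sx 1 (\<lambda>xs. if hd xs = M then 1 else 0)"
        if "i < n" for i
        by (rule sx_window[of 1 i n "\<lambda>xs. if hd xs = M then 1 else 0"]) (use that in auto)
      then show ?thesis by (simp only: sx_sum) simp
    qed
    also have "\<dots> = real n * pmf \<pi>P M"
      using sx_hd[of 1 "\<lambda>x. if x = M then 1 else 0"] by (simp add: mean_def mult_delta_right)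
    finally show "sx n (\<lambda>xs. (if M \<in> set xs then 1 else 0)\<^sup>2) \<le> real n * pmf \<pi>P M" .
  qed
  finally have "Q * (1 - real n * pmf \<pi>P M) \<le> varF (topF b) n" by (simp add: V right_diff_distrib)
  moreover have "pmf \<pi>P 0 * tiltY b 0 (n - 1) 0 * (b 0)\<^sup>2 \<le> Q"
  proof -
    have "pmf \<pi>P 0 * tiltY b 0 k 0 * (b 0)\<^sup>2 = pmf \<pi>P 0 * nx k 0 (\<lambda>ys. if last (0 # ys)
        = 0 \<and> M \<in> set (butlast (0 # ys))
       then (wprod b (butlast (0 # ys)))\<^sup>2 * (b 0)\<^sup>2 else 0)"
      unfolding tiltY_def mult.assoc nx_def sum_distrib_right
      by (intro arg_cong2[where f = "(*)"] refl sum.cong) auto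
    also have "\<dots> \<le> pmf \<pi>P 0 * nx k 0 (\<lambda>ys. (G (0 # ys))\<^sup>2)"
    proof (intro mult_left_mono nx_mono)
      fix ys assume ys: "ys \<in> lists_of k"
      have "length (0 # ys) = n" using ys by (simp add: lists_of_def k)
      then have G: "G (0 # ys) = (if M \<in> set (0 # ys) then wprod b (0 # ys) else 0)"
        by (simp only: G_def winF_def topF_mset take_all)
      have e: "wprod b (0 # ys) = wprod b (butlast (0 # ys)) * b (last (0 # ys))"
      proof -
        have "wprod b (butlast (0 # ys) @ [last (0 # ys)]) = wprod b (butlast (0 # ys)) * b (last (0 # ys))"
          by (simp only: wprod_simps mult_1_right)
        then show ?thesis by (metis append_butlast_last_id list.distinct(1))
      qed
      show "(if last (0 # ys) = 0 \<and> M \<in> set (butlast (0 # ys)) then (wprod b (butlast (0 # ys)))\<^sup>2 * (b 0)\<^sup>2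
          else 0) \<le> (G (0 # ys))\<^sup>2"
      proof (cases "last (0 # ys) = 0 \<and> M \<in> set (butlast (0 # ys))")
        case True
        then have "M \<in> set (0 # ys)" by (metis in_set_butlastD)
        then show ?thesis using True unfolding G e
            by (simp add: power_mult_distrib del: butlast.simps last.simps)
      next
        case False
        show ?thesis unfolding if_not_P[OF False] by simp
      qed
    qed (use M1 in auto)
    also have "\<dots> \<le> (\<Sum>x\<le>M. pmf \<pi>P x * nx k x (\<lambda>ys. (G (x # ys))\<^sup>2))"
      by (rule member_le_sum[where f = "\<lambda>x. pmf \<pi>P x * nx k x (\<lambda>ys. (G (x # ys))\<^sup>2)"])
          (auto intro!: mult_nonneg_nonneg nx_nonneg)
    finally show ?thesis by (simp add: Q_def k sx_Suc)
  qed
  then have "pmf \<pi>P 0 * tiltY b 0 (n - 1) 0 * (b 0)\<^sup>2 * (1 - real n * pmf \<pi>P M) \<le> Q * (1 - real n * pmf \<pi>P M)"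
    using small by (intro mult_right_mono) auto
  ultimately show ?thesis by linarith
qed

lemma tiltW_eq: "x \<le> M \<Longrightarrow> tiltW b i t x = tW M \<delta> b i t \<epsilon> x"
proof (induction t arbitrary: x)
  case (Suc t)
  then show ?case by (auto simp: tiltW_Suc P_sum)
qed (simp add: tiltW_def)

text \<open>Each upward step of the climb costs \<open>\<epsilon>\<close>; a downward step before
  the top costs one factor more, as that step must be climbed again. Hence the
  \<open>\<delta> * \<epsilon>\<close> in \<open>tY\<close>.\<close>

lemma tiltY_eq: "x \<le> M \<Longrightarrow> tiltY b i t x = \<epsilon> ^ (M - x) * tY M \<delta> b i t \<epsilon> x"
proof (induction t arbitrary: x)
  case (Suc t)
  show ?case
  proof (cases "x = M")
    case True
    have "tiltY b i (Suc t) M = tiltW b i (Suc t) M" by (simp add: tiltY_Suc tiltW_Suc)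
    then show ?thesis using True tiltW_eq[of M b i "Suc t"] by simp
  next
    case False
    then have x: "x < M" using Suc.prems by simp
    have p1: "\<epsilon> ^ (M - x) = \<epsilon> * \<epsilon> ^ (M - Suc x)" using x by (metis Suc_diff_Suc power_Suc)
    have p2: "0 < x \<Longrightarrow> \<epsilon> ^ (M - (x - 1)) = \<epsilon> * \<epsilon> ^ (M - x)" using x
      by (metis One_nat_def Suc_diff_le Suc_pred diff_Suc_Suc less_imp_le power_Suc)
    have "tiltY b i (Suc t) x = (b x)\<^sup>2 * (\<epsilon> * (\<epsilon> ^ (M - Suc x) * tY M \<delta> b i t \<epsilon> (Suc x))
        + (if 0 < x then \<delta> * (\<epsilon> ^ (M - (x - 1)) * tY M \<delta> b i t \<epsilon> (x - 1)) else 0)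
        + stay M \<epsilon> \<delta> x * (\<epsilon> ^ (M - x) * tY M \<delta> b i t \<epsilon> x))"
      using False x by (simp add: tiltY_Suc P_sum Suc.IH)
    also have "\<dots> = \<epsilon> ^ (M - x) * tY M \<delta> b i (Suc t) \<epsilon> x"
      using False p2 unfolding p1 by (simp add: algebra_simps)
    finally show ?thesis .
  qed
qed (simp add: tiltY_def)

lemma tW_tY_top: "i < M \<Longrightarrow> tW M \<delta> b i t \<epsilon> M = tY M \<delta> b i t \<epsilon> M"
  by (cases t) auto

lemma Z_ge_1: "1 \<le> bdZ M \<epsilon> \<delta>"
proof -
  have "(\<Sum>j\<in>{0}. (\<epsilon> / \<delta>) ^ j) \<le> bdZ M \<epsilon> \<delta>"
    unfolding bdZ_def using eps del by (intro sum_mono2) auto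
  then show ?thesis by simp
qed

lemma dirF_numer:
  assumes n: "0 < n"
  shows "dirF (topF b) n / 2 = \<epsilon> ^ M / bdZ M \<epsilon> \<delta> * numer M \<delta> b (n - 1) \<epsilon>"
  unfolding dirF_tilt[OF n] numer_def sum_distrib_left
proof (intro sum.cong refl)
  fix j i assume ji: "j \<in> {..M}" "i \<in> {..<j}"
  define t where "t = n - 1"
  have j: "j \<le> M" "0 < j" "i < M" using ji by auto
  have p2: "\<epsilon> ^ (M - (j - 1)) = \<epsilon> * \<epsilon> ^ (M - j)" using j
    by (metis One_nat_def Suc_diff_le Suc_pred diff_Suc_Suc power_Suc)
  have p1: "j < M \<Longrightarrow> \<epsilon> ^ (M - j) = \<epsilon> * \<epsilon> ^ (M - Suc j)" by (metis Suc_diff_Suc power_Suc)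
  have w: "\<epsilon> ^ M / bdZ M \<epsilon> \<delta> * (1 / \<delta>) ^ j = pmf \<pi>P j * \<epsilon> ^ (M - j)"
  proof -
    have "\<epsilon> ^ M = \<epsilon> ^ j * \<epsilon> ^ (M - j)" using j by (simp flip: power_add)
    then show ?thesis using j by (simp add: pi_eq bdpi_def power_divide)
  qed
  have "(\<Sum>y\<le>M. pmf (P M) y * (tiltW b i t y - tiltY b i t y))
      = \<delta> * (tW M \<delta> b i t \<epsilon> (M - 1) - \<epsilon> * tY M \<delta> b i t \<epsilon> (M - 1))"
    using P_sum[of M "\<lambda>y. tiltW b i t y - tiltY b i t y"] M1 j tW_tY_top[OF j(3), of b t]
    by (simp add: tiltW_eq tiltY_eq)
  moreover have "(\<Sum>y\<le>M. pmf (P j) y * tiltY b i t y) = \<epsilon> ^ (M - j) * ((if j < M then tY M \<delta> b i t \<epsilon> (Suc j)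
      else 0)
         + \<delta> * \<epsilon> * tY M \<delta> b i t \<epsilon> (j - 1) + stay M \<epsilon> \<delta> j * tY M \<delta> b i t \<epsilon> j)"
  proof -
    have "(\<Sum>y\<le>M. pmf (P j) y * tiltY b i t y) = (if j < M
        then \<epsilon> * (\<epsilon> ^ (M - Suc j) * tY M \<delta> b i t \<epsilon> (Suc j)) else 0)
         + \<delta> * (\<epsilon> ^ (M - (j - 1)) * tY M \<delta> b i t \<epsilon> (j - 1)) + stay M \<epsilon> \<delta> j * (\<epsilon> ^ (M - j) * tY M \<delta> b i t \<epsilon> j)"
      unfolding P_sum[OF j(1)] using j by (simp add: tiltY_eq)
    then show ?thesis unfolding p2 by (auto simp: p1 algebra_simps)
  qed
  ultimately have "jump b i t j = \<epsilon> ^ (M - j) * flux M \<delta> b i t \<epsilon> j"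
    unfolding jump_def flux_def by (cases "j = M") (simp_all add: mult.left_commute)
  then show "pmf \<pi>P j * jump b i (n - 1) j = \<epsilon> ^ M / bdZ M \<epsilon> \<delta> * ((1 / \<delta>) ^ j * flux M \<delta> b i (n - 1) \<epsilon> j)"
    unfolding mult.assoc[symmetric] w t_def by simp
qed

lemma bd_ratio:
  assumes n: "0 < n" and b: "b 0 = 1" and V: "0 < tY M \<delta> b 0 (n - 1) \<epsilon> 0"
    and small: "real n * \<eta> < 1" "\<eta> + sqrt \<eta> < 1"
  shows "gap_ratio {..M} P \<pi>P n \<le>
     real n * numer M \<delta> b (n - 1) \<epsilon> / (\<delta> * (1 - \<eta> - sqrt \<eta>) / (1 + sqrt \<eta>)
         * (tY M \<delta> b 0 (n - 1) \<epsilon> 0 * (1 - real n * \<eta>)))"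
proof -
  \<comment> \<open>The vanishing scale \<open>\<epsilon> ^ M\<close> is common to energy and
    variance and cancels.\<close>
  define w where "w = \<epsilon> ^ M / bdZ M \<epsilon> \<delta>"
  define g where "g = \<delta> * (1 - \<eta> - sqrt \<eta>) / (1 + sqrt \<eta>)"
  define v where "v = tY M \<delta> b 0 (n - 1) \<epsilon> 0 * (1 - real n * \<eta>)"
  have eta: "0 < \<eta>" using eps del by simp
  have w: "0 < w" using eps Z_ge_1 by (simp add: w_def)
  have v: "0 < v" using V small by (simp add: v_def)
  have g: "0 < g" using del small eta unfolding g_def by (intro divide_pos_pos mult_pos_pos add_pos_pos) auto
  have eta1: "\<eta> \<le> 1" using small n eta by (smt (verit) real_sqrt_ge_zero)
  have piM: "pmf \<pi>P M \<le> \<eta>"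
  proof -
    have "pmf \<pi>P M \<le> \<eta> ^ M" using Z_ge_1 eps del by (simp add: pi_eq bdpi_def field_simps mult_left_le_one_le)
    also have "\<dots> \<le> \<eta> ^ 1" using eta eta1 M1 by (intro power_decreasing) auto
    finally show ?thesis by simp
  qed
  have npi: "real n * pmf \<pi>P M \<le> real n * \<eta>" by (intro mult_left_mono piM) auto
  have "w * v \<le> pmf \<pi>P 0 * tiltY b 0 (n - 1) 0 * (b 0)\<^sup>2 * (1 - real n * pmf \<pi>P M)"
  proof -
    have e: "pmf \<pi>P 0 * tiltY b 0 (n - 1) 0 = w * tY M \<delta> b 0 (n - 1) \<epsilon> 0"
      by (simp add: tiltY_eq pi_eq bdpi_def w_def)
    have "w * tY M \<delta> b 0 (n - 1) \<epsilon> 0 * (1 - real n * \<eta>)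
        \<le> w * tY M \<delta> b 0 (n - 1) \<epsilon> 0 * (1 - real n * pmf \<pi>P M)"
      using npi w V by (intro mult_left_mono) auto
    then show ?thesis unfolding e b v_def by (simp add: mult.assoc)
  qed
  also have "\<dots> \<le> varF (topF b) n" using npi small by (intro varF_tilt[OF n]) auto
  finally have var: "w * v \<le> varF (topF b) n" .
  have "gap_ratio {..M} P \<pi>P n \<le> real n * (dirF (topF b) n / 2) / (g * varF (topF b) n)"
    by (rule gap_ratio_le[OF n _ g])
        (use var w v bd_gap[OF small(2)] in \<open>auto simp: g_def intro: less_le_trans[OF mult_pos_pos]\<close>)
  also have "\<dots> \<le> real n * (dirF (topF b) n / 2) / (g * (w * v))"
    using var w v g dirF_nonneg[of "topF b" n] by (intro divide_left_mono mult_left_mono mult_pos_pos)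
        (auto intro: less_le_trans[OF mult_pos_pos])
  also have "\<dots> = real n * numer M \<delta> b (n - 1) \<epsilon> / (g * v)"
    unfolding dirF_numer[OF n] w_def[symmetric] using w by simp
  finally show ?thesis by (simp add: g_def v_def)
qed

end

section \<open>Bounds on the infimum over all chains\<close>

abbreviation ratios :: "nat \<Rightarrow> real set" where
  "ratios m \<equiv> {gap_ratio \<Omega> P \<pi> n | (\<Omega> :: nat set) P \<pi> n.
     card \<Omega> = m \<and> irreducible_reversible \<Omega> P \<pi> \<and> 2 \<le> n}"

lemma ratios_lower:
  assumes "2 \<le> m" "x \<in> ratios m"
  shows "1 / (1080 * real m) \<le> x"
proof -
  obtain \<Omega> :: "nat set" and P \<pi> n where x: "x = gap_ratio \<Omega> P \<pi> n" "card \<Omega> = m"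
    "irreducible_reversible \<Omega> P \<pi>" "2 \<le> n" using assms by blast
  then interpret pmf_chain \<Omega> P \<pi> by unfold_locales
  show ?thesis using gap_ratio_ge[of n] x assms by simp
qed

text \<open>An infimum of reals lies below the members only of a set bounded below, so the lower
  bound enters the upper one.\<close>

lemma c_star_le:
  assumes "1 \<le> M" "card \<Omega> = Suc M" "irreducible_reversible \<Omega> P \<pi>" "2 \<le> n"
  shows "c_star (Suc M) \<le> gap_ratio (\<Omega> :: nat set) P \<pi> n"
  unfolding c_star_def
proof (rule cInf_lower)
  show "bdd_below (ratios (Suc M))"
    by (rule bdd_belowI) (rule ratios_lower, use assms in auto)
qed (use assms in blast)

lemma c_star_lower:
  assumes "2 \<le> m"
  shows "1 / (1080 * real m) \<le> c_star m"
  unfolding c_star_def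
proof (rule cInf_greatest)
  obtain P \<pi> where "irreducible_reversible {..m - 1} P \<pi>"
    by (rule bd_exists[of "1/2" "1/2" "m - 1"]) auto
  then show "ratios m \<noteq> {}"
    using assms by (fastforce intro!: exI[of _ "{..m - 1}"])
qed (rule ratios_lower[OF assms])

lemma c_star_le_limit:
  assumes M: "1 \<le> M" and n: "2 \<le> n" and d: "0 < \<delta>" "\<delta> < 1" and b: "b 0 = 1"
    and V: "0 < tY M \<delta> b 0 (n - 1) 0 0"
  shows "c_star (Suc M) \<le> real n * numer M \<delta> b (n - 1) 0 / (\<delta> * tY M \<delta> b 0 (n - 1) 0 0)"
proof (rule tendsto_lowerbound)
  let ?f = "\<lambda>\<epsilon>. real n * numer M \<delta> b (n - 1) \<epsilon> / (\<delta> * (1 - \<epsilon> / \<delta> - sqrt (\<epsilon> / \<delta>)) / (1 + sqrt (\<epsilon> / \<delta>))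
      * (tY M \<delta> b 0 (n - 1) \<epsilon> 0 * (1 - real n * (\<epsilon> / \<delta>))))"
  have e0: "((\<lambda>\<epsilon>. \<epsilon> / \<delta>) \<longlongrightarrow> 0) (at_right 0)" using d by (auto intro!: tendsto_eq_intros)
  have s0: "((\<lambda>\<epsilon>. sqrt (\<epsilon> / \<delta>)) \<longlongrightarrow> 0) (at_right 0)" using tendsto_real_sqrt[OF e0] by simp
  have "(?f \<longlongrightarrow> real n * numer M \<delta> b (n - 1) 0 / (\<delta> * (1 - 0 - 0) / (1 + 0)
      * (tY M \<delta> b 0 (n - 1) 0 0 * (1 - real n * 0)))) (at_right 0)"
    by (intro tendsto_intros e0 s0 tendsto_numer tendsto_tY) (use d V in auto)
  then show "(?f \<longlongrightarrow> real n * numer M \<delta> b (n - 1) 0 / (\<delta> * tY M \<delta> b 0 (n - 1) 0 0)) (at_right 0)" by simp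
  have 1: "eventually (\<lambda>\<epsilon>. 0 < tY M \<delta> b 0 (n - 1) \<epsilon> 0) (at_right 0)"
    using order_tendstoD(1)[OF tendsto_tY V] .
  have 2: "eventually (\<lambda>\<epsilon>. real n * (\<epsilon> / \<delta>) < 1) (at_right 0)"
    by (rule order_tendstoD(2)[of _ "real n * 0"]) (intro tendsto_intros e0, simp)
  have 3: "eventually (\<lambda>\<epsilon>. \<epsilon> / \<delta> + sqrt (\<epsilon> / \<delta>) < 1) (at_right 0)"
    by (rule order_tendstoD(2)[of _ "0 + 0"]) (intro tendsto_intros e0 s0, simp)
  have 4: "eventually (\<lambda>\<epsilon>. 0 < \<epsilon> \<and> \<epsilon> < 1 - \<delta>) (at_right 0)"
    using eventually_at_right_real[of 0 "1 - \<delta>"] d by simp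
  show "eventually (\<lambda>\<epsilon>. c_star (Suc M) \<le> ?f \<epsilon>) (at_right 0)"
    using 1 2 3 4
  proof eventually_elim
    case (elim \<epsilon>)
    obtain P \<pi> where P: "irreducible_reversible {..M} P \<pi>"
      "\<And>x y. x \<le> M \<Longrightarrow> y \<le> M \<Longrightarrow> pmf (P x) y = bdk M \<epsilon> \<delta> x y"
      "\<And>x. x \<le> M \<Longrightarrow> pmf \<pi> x = bdpi M \<epsilon> \<delta> x"
      using bd_exists[of \<epsilon> \<delta> M] elim d by auto
    interpret bd_chain M P \<pi> \<epsilon> \<delta>
      by unfold_locales (use P M elim d in auto)
    have "c_star (Suc M) \<le> gap_ratio {..M} P \<pi> n" by (rule c_star_le[OF M _ P(1) n]) simp
    also have "\<dots> \<le> ?f \<epsilon>" by (rule bd_ratio) (use n b elim in auto)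
    finally show ?case .
  qed
qed simp

subsection \<open>The limits of long windows and small rates\<close>

lemma q_seq_bounds: "0 < q_seq r" "q_seq r \<le> 1 / 4"
proof (induction r)
  case (Suc r)
  { case 1 show ?case using Suc by simp }
  { case 2
    have "q_seq r * (1 - q_seq r) \<le> q_seq r * 1" using Suc by (intro mult_left_mono) auto
    then show ?case using Suc by (simp only: q_seq.simps mult_1_right) }
qed auto

text \<open>
  The exponents of the test function. The values \<open>q_seq (M - 1 - x)\<close> are the minimizers in
  \<open>q - q\<^sup>2 = min\<^sub>\<theta> (\<theta>\<^sup>2 + (1 - 2 \<theta>) q)\<close>; at the top state the exponent has to exceed \<open>1 / 2\<close>
  slightly, since the second moment there grows as \<open>1 / decay\<close>.
\<close>

definition expo :: "nat \<Rightarrow> real \<Rightarrow> nat \<Rightarrow> real" where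
  "expo M \<delta> x = (if x = M then 1 / 2 + \<delta> / 8 else q_seq (M - 1 - x))"

definition base :: "nat \<Rightarrow> real \<Rightarrow> nat \<Rightarrow> real" where
  "base M \<delta> x = (if x = 0 then 1 else 1 / (1 - \<delta> * expo M \<delta> x))"

text \<open>Since \<open>(1 - \<delta> * \<theta>)\<^sup>2 = 1 - \<delta> + \<delta> *
  decay\<close>, this is the margin by which the holding weight
  \<open>(b x)\<^sup>2 * (1 - \<delta>)\<close> stays below 1, in units of
  \<open>\<delta> * (b x)\<^sup>2\<close>.\<close>

definition decay :: "nat \<Rightarrow> real \<Rightarrow> nat \<Rightarrow> real" where
  "decay M \<delta> x = 1 - 2 * expo M \<delta> x + \<delta> * (expo M \<delta> x)\<^sup>2"

text \<open>The ratio for fixed \<open>\<delta>\<close> after the limits in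
  \<open>\<epsilon>\<close> and \<open>n\<close>. In the initial value,
  \<open>\<delta> / 8 + \<delta>\<^sup>2 / 64\<close> is the decay at the top divided by
  \<open>\<delta>\<close>, and the bracket is \<open>2 * b M - 1\<close>.\<close>

primrec qappr :: "real \<Rightarrow> nat \<Rightarrow> real" where
  "qappr \<delta> 0 = (1 / 2 + \<delta> / 8)\<^sup>2 + (\<delta> / 8 + \<delta>\<^sup>2 / 64) * (2 / (1 - \<delta> * (1 / 2 + \<delta> / 8)) - 1)"
| "qappr \<delta> (Suc r) = (q_seq r)\<^sup>2 + (1 - 2 * q_seq r + \<delta> * (q_seq r)\<^sup>2) * qappr \<delta> r"

lemma tendsto_qappr: "((\<lambda>\<delta>. qappr \<delta> r) \<longlongrightarrow> q_seq r) (at_right 0)"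
proof (induction r)
  case 0
  show ?case unfolding qappr.simps by (rule tendsto_eq_intros refl | simp add: power2_eq_square)+
next
  case (Suc r)
  have "((\<lambda>\<delta>. (q_seq r)\<^sup>2 + (1 - 2 * q_seq r + \<delta> * (q_seq r)\<^sup>2) * qappr \<delta> r) \<longlongrightarrow>
     (q_seq r)\<^sup>2 + (1 - 2 * q_seq r + 0 * (q_seq r)\<^sup>2) * q_seq r) (at_right 0)"
    by (intro tendsto_intros Suc)
  then show ?case by (simp add: power2_eq_square algebra_simps)
qed

locale test_chain =
  fixes M :: nat and \<delta> :: real
  assumes M1: "1 \<le> M" and d: "0 < \<delta>" "\<delta> \<le> 1 / 2"
begin

abbreviation \<theta> where "\<theta> \<equiv> expo M \<delta>"
abbreviation b where "b \<equiv> base M \<delta>"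
abbreviation c where "c \<equiv> decay M \<delta>"
abbreviation W where "W i t x \<equiv> tW M \<delta> b i t 0 x"
abbreviation Y where "Y i t x \<equiv> tY M \<delta> b i t 0 x"

lemma expo_bounds: "0 < \<theta> x" "\<theta> x \<le> 1"
  using q_seq_bounds[of "M - 1 - x"] d by (auto simp: expo_def)

lemma one_minus: "0 < 1 - \<delta> * \<theta> x"
proof -
  have "\<delta> * \<theta> x \<le> 1 / 2 * 1" using expo_bounds[of x] d by (intro mult_mono) auto
  then show ?thesis by simp
qed

lemma b_pos: "0 < b x"
  using one_minus[of x] by (simp add: base_def)

lemma c_pos: "0 < c x"
proof (cases "x = M")
  case True
  \<comment> \<open>The offset \<open>\<delta> / 8\<close> in the exponent cancels the term
    \<open>\<delta> / 4\<close> of the decay; the rest is positive, yet negligible after division by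
    \<open>\<delta>\<close>.\<close>
  have "c x = \<delta>\<^sup>2 / 8 + \<delta> ^ 3 / 64"
    using True by (simp add: decay_def expo_def power2_eq_square power3_eq_cube field_simps)
  then show ?thesis using d by (simp add: add_pos_pos)
next
  case False
  then have "\<theta> x \<le> 1 / 4" using q_seq_bounds by (simp add: expo_def)
  moreover have "0 \<le> \<delta> * (\<theta> x)\<^sup>2" using d by simp
  ultimately show ?thesis by (simp add: decay_def)
qed

lemma b_sq: "0 < x \<Longrightarrow> 1 / (b x)\<^sup>2 = 1 - \<delta> + \<delta> * c x"
  using one_minus[of x] by (simp add: base_def decay_def power2_eq_square field_simps)

lemma b_contract: assumes "0 < x"
  shows "(b x)\<^sup>2 * (1 - \<delta>) < 1" "(b x)\<^sup>2 / (1 - (b x)\<^sup>2 * (1 - \<delta>)) = 1 / (\<delta> * c x)"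
proof -
  have bb: "0 < (b x)\<^sup>2" using b_pos[of x] by simp
  have dc: "0 < \<delta> * c x" using d c_pos by simp
  have e: "1 = (b x)\<^sup>2 * (1 - \<delta>) + (b x)\<^sup>2 * (\<delta> * c x)"
    using b_sq[OF assms] bb by (simp add: field_simps)
  then have e': "1 - (b x)\<^sup>2 * (1 - \<delta>) = (b x)\<^sup>2 * (\<delta> * c x)" by linarith
  have "0 < (b x)\<^sup>2 * (\<delta> * c x)" using bb dc by simp
  then show "(b x)\<^sup>2 * (1 - \<delta>) < 1" using e' by linarith
  show "(b x)\<^sup>2 / (1 - (b x)\<^sup>2 * (1 - \<delta>)) = 1 / (\<delta> * c x)" unfolding e' using bb dc by simp
qed

lemma affine_limit:
  assumes x: "0 < x" and u: "\<And>t. u (Suc t) = (b x)\<^sup>2 * (s t + (1 - \<delta>) * u t)" and s: "s \<longlonglongrightarrow> L"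
  shows "u \<longlonglongrightarrow> L / (\<delta> * c x)"
proof -
  have "u \<longlonglongrightarrow> (b x)\<^sup>2 * L / (1 - (b x)\<^sup>2 * (1 - \<delta>))"
  proof (rule affine_recursion_tendsto)
    show "u (Suc t) = (b x)\<^sup>2 * (1 - \<delta>) * u t + (b x)\<^sup>2 * s t" for t
      by (simp add: u algebra_simps)
    show "(\<lambda>t. (b x)\<^sup>2 * s t) \<longlonglongrightarrow> (b x)\<^sup>2 * L" by (intro tendsto_intros s)
  qed (use b_contract(1)[OF x] d in auto)
  moreover have "(b x)\<^sup>2 * L / (1 - (b x)\<^sup>2 * (1 - \<delta>)) = L / (\<delta> * c x)"
  proof -
    have "(b x)\<^sup>2 * L / (1 - (b x)\<^sup>2 * (1 - \<delta>)) = L * ((b x)\<^sup>2 / (1 - (b x)\<^sup>2 * (1 - \<delta>)))" by simp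
    then show ?thesis unfolding b_contract(2)[OF x] by simp
  qed
  ultimately show ?thesis by simp
qed

text \<open>\<open>wst x\<close> and \<open>yst x\<close> are the limits of \<open>W 0 t x\<close>
  and, for \<open>0 < x\<close>, of \<open>Y 0 t x\<close>: a level passed downwards contributes
  \<open>1 / c\<close>, one passed upwards \<open>1 / (\<delta> * c)\<close>.\<close>

definition wst :: "nat \<Rightarrow> real" where "wst x = (\<Prod>k\<in>{0<..x}. 1 / c k)"

definition yst :: "nat \<Rightarrow> real" where "yst x = wst M * (\<Prod>k\<in>{x..<M}. 1 / (\<delta> * c k))"

lemma wst_Suc: "wst (Suc x) = wst x / c (Suc x)"
proof -
  have "{0<..Suc x} = insert (Suc x) {0<..x}" by auto
  then show ?thesis by (simp add: wst_def)
qed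

lemma yst_step: "x < M \<Longrightarrow> yst x = yst (Suc x) / (\<delta> * c x)"
  by (simp add: yst_def prod.atLeast_Suc_lessThan)

lemma wst_pos: "0 < wst x"
  unfolding wst_def by (intro prod_pos) (simp add: c_pos)

lemma yst_pos: "0 < yst x"
  unfolding yst_def using d by (intro mult_pos_pos wst_pos prod_pos) (simp add: c_pos)

lemma W_0: "W i t 0 = (if i = 0 then 1 else 0)"
  by (induction t) (auto simp: stay_def base_def)

text \<open>At \<open>\<epsilon> = 0\<close> the walk only descends; holding above 0 has weight
  below 1, and 0 is absorbing with weight 1. So only the target \<open>i = 0\<close>
  survives.\<close>

lemma W_limit: "(\<lambda>t. W i t x) \<longlonglongrightarrow> (if i = 0 then wst x else 0)"
proof (induction x)
  case 0
  then show ?case by (simp add: W_0 wst_def)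
next
  case (Suc x)
  have "(\<lambda>t. W i t (Suc x)) \<longlonglongrightarrow> \<delta> * (if i = 0 then wst x else 0) / (\<delta> * c (Suc x))"
  proof (rule affine_limit[where s = "\<lambda>t. \<delta> * W i t x"])
    show "(\<lambda>t. \<delta> * W i t x) \<longlonglongrightarrow> \<delta> * (if i = 0 then wst x else 0)" by (intro tendsto_intros Suc)
  qed (simp_all add: stay_def)
  then show ?case using d by (simp add: wst_Suc split: if_splits)
qed

lemma Y_limit: "0 < x \<Longrightarrow> x \<le> M \<Longrightarrow> (\<lambda>t. Y i t x) \<longlonglongrightarrow> (if i = 0 then yst x else 0)"
proof (induction "M - x" arbitrary: x)
  case 0
  then have x: "x = M" by simp
  have e: "Y i (Suc t) M = W i (Suc t) M" for t by simp
  have "(\<lambda>t. Y i (Suc t) M) \<longlonglongrightarrow> (if i = 0 then wst M else 0)"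
    unfolding e by (rule LIMSEQ_Suc[OF W_limit])
  then have "(\<lambda>t. Y i t M) \<longlonglongrightarrow> (if i = 0 then wst M else 0)"
    by (rule LIMSEQ_imp_Suc)
  then show ?case unfolding x by (simp only: yst_def atLeastLessThan_empty order_refl prod.empty mult_1_right)
next
  case (Suc k)
  then have x: "x < M" by simp
  have "(\<lambda>t. Y i t (Suc x)) \<longlonglongrightarrow> (if i = 0 then yst (Suc x) else 0)"
    using Suc x by (intro Suc(1)) auto
  then have "(\<lambda>t. Y i t x) \<longlonglongrightarrow> (if i = 0 then yst (Suc x) else 0) / (\<delta> * c x)"
    using Suc x by (intro affine_limit[where s = "\<lambda>t. Y i t (Suc x)"]) (auto simp: stay_def)
  then show ?case by (simp add: yst_step[OF x] split: if_splits)
qed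

text \<open>Holding in 0 has weight 1, so \<open>Y\<close> there sums over the starting time of the
  climb. Its linear growth balances the factor \<open>n\<close> of the ratio, while the numerator
  converges.\<close>

lemma Y_bottom: "Y 0 t 0 = (\<Sum>s<t. Y 0 s 1)"
proof (induction t)
  case (Suc t)
  then show ?case using M1 by (simp add: stay_def base_def)
qed simp

lemma Y_bottom_limit: "(\<lambda>t. Y 0 t 0 / real (Suc t)) \<longlonglongrightarrow> yst 1"
proof -
  have "(\<lambda>t. Y 0 t 0 / real t) \<longlonglongrightarrow> yst 1"
    unfolding Y_bottom using Y_limit[of 1 0] M1 by (intro cesaro_mean) simp
  then have "(\<lambda>t. Y 0 t 0 / real t * (real t / real (Suc t))) \<longlonglongrightarrow> yst 1 * 1"
    by (intro tendsto_intros LIMSEQ_n_over_Suc_n)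
  moreover have "Y 0 t 0 / real t * (real t / real (Suc t)) = Y 0 t 0 / real (Suc t)" for t
    by (cases "t = 0") auto
  ultimately show ?thesis by simp
qed

definition summand :: "nat \<Rightarrow> real" where
  "summand j = (1 / \<delta>) ^ j * ((b j - 1)\<^sup>2 * ((if j < M then yst (Suc j) else 0) + (1 - \<delta>) * yst j)
      + (if j = M then (b M)\<^sup>2 * \<delta> * wst (M - 1) else 0))"

lemma numer_limit: "(\<lambda>t. numer M \<delta> b t 0) \<longlonglongrightarrow> (\<Sum>j\<in>{1..M}. summand j)"
proof -
  have *: "(\<lambda>t. (1 / \<delta>) ^ j * flux M \<delta> b i t 0 j) \<longlonglongrightarrow> (if i = 0 then summand j else 0)"
    if ij: "j \<in> {..M}" "i \<in> {..<j}" for i j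
  proof -
    have "(\<lambda>t. (1 / \<delta>) ^ j * ((b j - b i)\<^sup>2 * ((if j < M then Y i t (Suc j) else 0) + (1 - \<delta>) * Y i t j)
       + (if j = M then (b M)\<^sup>2 * (\<delta> * W i t (M - 1)) else 0))) \<longlonglongrightarrow>
      (1 / \<delta>) ^ j * ((b j - b i)\<^sup>2 * ((if j < M then (if i = 0 then yst (Suc j) else 0) else 0)
       + (1 - \<delta>) * (if i = 0 then yst j else 0))
       + (if j = M then (b M)\<^sup>2 * (\<delta> * (if i = 0 then wst (M - 1) else 0)) else 0))"
      by (intro tendsto_mult tendsto_add tendsto_const tendsto_cond W_limit Y_limit) (use ij in auto)
    then show ?thesis using ij by (simp add: flux_def summand_def stay_def base_def mult.assoc split: if_splits)
  qed
  have "(\<lambda>t. numer M \<delta> b t 0) \<longlonglongrightarrow> (\<Sum>j\<le>M. \<Sum>i<j. if i = 0 then summand j else 0)"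
    unfolding numer_def by (intro tendsto_sum *)
  also have "(\<Sum>j\<le>M. \<Sum>i<j. if i = 0 then summand j else 0) = (\<Sum>j\<le>M. if 0 < j then summand j else 0)"
    by (rule sum.cong) auto
  also have "\<dots> = (\<Sum>j\<in>{1..M}. summand j)"
  proof -
    have "{..M} \<inter> {j. 0 < j} = {1..M}" by auto
    then show ?thesis by (simp add: sum.If_cases)
  qed
  finally show ?thesis .
qed

text \<open>Normalised so that going up one level multiplies by \<open>c j\<close>, the coefficient
  in the recursion of \<open>qappr\<close>.\<close>

definition wgt :: "nat \<Rightarrow> real" where "wgt j = (1 / \<delta>) ^ j * yst j"

lemma wgt_Suc: "j < M \<Longrightarrow> wgt (Suc j) = wgt j * c j"
  using d c_pos[of j] by (simp add: wgt_def yst_step)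

lemma one_minus_inv: "0 < j \<Longrightarrow> 1 - 1 / b j = \<delta> * \<theta> j"
  using one_minus[of j] by (simp add: base_def)

lemma b_minus_sq: assumes "0 < j" shows "(b j - 1)\<^sup>2 / (b j)\<^sup>2 = \<delta>\<^sup>2 * (\<theta> j)\<^sup>2"
proof -
  have "(b j - 1)\<^sup>2 / (b j)\<^sup>2 = (1 - 1 / b j)\<^sup>2"
    using b_pos[of j] by (simp add: power_divide[symmetric] diff_divide_distrib)
  then show ?thesis by (simp add: one_minus_inv[OF assms] power_mult_distrib)
qed

lemma summand_mid: assumes "0 < j" "j < M" shows "summand j = wgt j * (\<delta>\<^sup>2 * (\<theta> j)\<^sup>2)"
proof -
  have y: "yst (Suc j) = yst j * (\<delta> * c j)" using yst_step[OF assms(2)] d c_pos[of j] by simp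
  have "summand j = (1 / \<delta>) ^ j * ((b j - 1)\<^sup>2 * (yst j * (1 - \<delta> + \<delta> * c j)))"
    using assms by (simp add: summand_def y algebra_simps)
  also have "\<dots> = wgt j * ((b j - 1)\<^sup>2 / (b j)\<^sup>2)" by (simp add: b_sq[OF assms(1), symmetric] wgt_def)
  finally show ?thesis by (simp add: b_minus_sq[OF assms(1)])
qed

text \<open>The top level also contains the windows that lose their only \<open>M\<close>. As
  \<open>\<delta> * wst (M - 1) = yst M * (\<delta> * c M)\<close>, both parts share the factor
  \<open>wgt M\<close>.\<close>

lemma summand_top: "summand M = \<delta>\<^sup>2 * wgt M * qappr \<delta> 0"
proof -
  obtain k where k: "M = Suc k" using M1 by (cases M) auto
  have M0: "0 < M" using M1 by simp
  have w: "\<delta> * wst (M - 1) = yst M * (\<delta> * c M)"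
  proof -
    have "yst M = wst M" by (simp add: yst_def)
    moreover have "wst M = wst (M - 1) / c M" using wst_Suc[of k] by (simp add: k)
    ultimately show ?thesis using c_pos[of M] by simp
  qed
  have r: "1 - \<delta> = 1 / (b M)\<^sup>2 - \<delta> * c M" using b_sq[OF M0] by simp
  have "summand M = (1 / \<delta>) ^ M * ((b M - 1)\<^sup>2 * ((1 - \<delta>) * yst M) + (b M)\<^sup>2 * (\<delta> * wst (M - 1)))"
    by (simp add: summand_def mult.assoc)
  also have "\<dots> = wgt M * ((b M - 1)\<^sup>2 / (b M)\<^sup>2 + \<delta> * c M * ((b M)\<^sup>2 - (b M - 1)\<^sup>2))"
    unfolding w r by (simp add: wgt_def algebra_simps diff_divide_distrib)
  also have "(b M)\<^sup>2 - (b M - 1)\<^sup>2 = 2 * b M - 1" by (simp add: power2_eq_square algebra_simps)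
  also have "(b M - 1)\<^sup>2 / (b M)\<^sup>2 + \<delta> * c M * (2 * b M - 1) = \<delta>\<^sup>2 * qappr \<delta> 0"
  proof -
    have "c M = \<delta> * (\<delta> / 8 + \<delta>\<^sup>2 / 64)" by (simp add: decay_def expo_def power2_eq_square field_simps)
    moreover have "b M = 1 / (1 - \<delta> * (1 / 2 + \<delta> / 8))" using M0 by (simp add: base_def expo_def)
    ultimately show ?thesis
      unfolding b_minus_sq[OF M0] by (simp add: expo_def power2_eq_square distrib_left mult.assoc)
  qed
  finally show ?thesis by simp
qed

text \<open>Going down, level \<open>k\<close> adds \<open>(\<theta> k)\<^sup>2\<close> and
  multiplies everything above by \<open>c k\<close>, which is the recursion of
  \<open>qappr\<close>.\<close>

lemma tail_sum: "1 \<le> k \<Longrightarrow> k \<le> M \<Longrightarrow> (\<Sum>j\<in>{k..M}. summand j) = \<delta>\<^sup>2 * wgt k * qappr \<delta> (M - k)"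
proof (induction "M - k" arbitrary: k)
  case 0
  then have "k = M" by simp
  then show ?case by (simp only: summand_top) (simp add: summand_top)
next
  case (Suc r)
  then have k: "k < M" "0 < k" by auto
  have r: "M - k = Suc r" "M - Suc k = r" "M - 1 - k = r" using Suc by auto
  have "(\<Sum>j\<in>{k..M}. summand j) = summand k + (\<Sum>j\<in>{Suc k..M}. summand j)"
    using k by (intro sum.atLeast_Suc_atMost) simp
  also have "(\<Sum>j\<in>{Suc k..M}. summand j) = \<delta>\<^sup>2 * wgt (Suc k) * qappr \<delta> r"
    using Suc(1)[of "Suc k"] k r by simp
  also have "summand k + \<dots> = \<delta>\<^sup>2 * wgt k * ((\<theta> k)\<^sup>2 + c k * qappr \<delta> r)"
    using k by (simp add: summand_mid wgt_Suc algebra_simps)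
  also have "(\<theta> k)\<^sup>2 + c k * qappr \<delta> r = qappr \<delta> (M - k)"
    using k r by (simp add: decay_def expo_def)
  finally show ?case .
qed

lemma c_star_le_qappr: "c_star (Suc M) \<le> qappr \<delta> (M - 1)"
proof (rule tendsto_lowerbound)
  let ?f = "\<lambda>t. numer M \<delta> b t 0 / (\<delta> * (Y 0 t 0 / real (Suc t)))"
  have "?f \<longlonglongrightarrow> (\<Sum>j\<in>{1..M}. summand j) / (\<delta> * yst 1)"
    by (intro tendsto_intros numer_limit Y_bottom_limit) (use d yst_pos[of 1] in auto)
  \<comment> \<open>\<open>wgt 1 = yst 1 / \<delta>\<close>, so everything but \<open>qappr\<close>
    cancels.\<close>
  moreover have "(\<Sum>j\<in>{1..M}. summand j) / (\<delta> * yst 1) = qappr \<delta> (M - 1)"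
    using tail_sum[of 1] M1 d yst_pos[of 1] by (simp add: wgt_def power2_eq_square)
  ultimately show "?f \<longlonglongrightarrow> qappr \<delta> (M - 1)" by simp
  have "eventually (\<lambda>t. 0 < Y 0 t 0 / real (Suc t)) sequentially"
    using order_tendstoD(1)[OF Y_bottom_limit yst_pos] .
  then show "eventually (\<lambda>t. c_star (Suc M) \<le> ?f t) sequentially"
    using eventually_ge_at_top[of 1]
  proof eventually_elim
    case (elim t)
    then have V: "0 < Y 0 t 0" by (simp add: zero_less_divide_iff)
    have "c_star (Suc M) \<le> real (Suc t) * numer M \<delta> b (Suc t - 1) 0 / (\<delta> * Y 0 (Suc t - 1) 0)"
      by (rule c_star_le_limit) (use M1 d elim V in \<open>auto simp: base_def\<close>)
    also have "\<dots> = ?f t" using V d by (simp add: field_simps)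
    finally show ?case .
  qed
qed simp

end

lemma c_star_upper:
  assumes "2 \<le> m"
  shows "c_star m \<le> q_seq (m - 2)"
proof (rule tendsto_lowerbound[OF tendsto_qappr])
  have "eventually (\<lambda>\<delta>. \<delta> \<in> {0<..<1 / 2}) (at_right (0::real))" by (rule eventually_at_right_real) simp
  then show "eventually (\<lambda>\<delta>. c_star m \<le> qappr \<delta> (m - 2)) (at_right 0)"
  proof eventually_elim
    case (elim \<delta>)
    interpret test_chain "m - 1" \<delta> by unfold_locales (use assms elim in auto)
    show ?case using c_star_le_qappr assms by (simp add: numeral_2_eq_2)
  qed
qed simp

subsection \<open>Asymptotics of the recursion\<close>

text \<open>From \<open>1 / (q * (1 - q)) = 1 / q + 1 / (1 - q)\<close>. The reciprocal grows by 1
  plus a term of order \<open>1 / r\<close>, whose sum is the logarithm.\<close>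

lemma recip_q_Suc: "1 / q_seq (Suc r) = 1 / q_seq r + 1 + 1 / (1 / q_seq r - 1)"
proof -
  have q: "0 < q_seq r" "0 < 1 - q_seq r" using q_seq_bounds[of r] by auto
  have "1 / (1 / q_seq r - 1) = q_seq r / (1 - q_seq r)" using q by (simp add: field_simps)
  then show ?thesis using q by (simp add: field_simps)
qed

lemma recip_q_ge: "real r + 4 \<le> 1 / q_seq r"
proof (induction r)
  case (Suc r)
  have "0 \<le> 1 / (1 / q_seq r - 1)" using Suc by simp
  then show ?case using Suc unfolding recip_q_Suc of_nat_Suc by linarith
qed simp

definition excess :: "nat \<Rightarrow> real" where "excess r = 1 / q_seq r - real r"

lemma excess_0: "excess 0 = 4"
  by (simp add: excess_def)

lemma excess_Suc: "excess (Suc r) = excess r + 1 / (1 / q_seq r - 1)"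
  unfolding excess_def recip_q_Suc by simp

lemma excess_step_le: "1 / (1 / q_seq r - 1) \<le> 1 / (real r + 3)"
  using recip_q_ge[of r] by (intro divide_left_mono mult_pos_pos) auto

text \<open>Weaker than the logarithmic bound, but a square root fits the telescoping error estimate
  in \<open>excess_lower\<close>.\<close>

lemma excess_sqrt: "excess r \<le> 4 + 2 * sqrt (real r + 1)"
proof (induction r)
  case (Suc r)
  define x where "x = sqrt (real r + 1)"
  define y where "y = sqrt (real r + 2)"
  have sq: "x * x = real r + 1" "y * y = real r + 2" by (simp_all add: x_def y_def)
  have pos: "1 \<le> x" "1 \<le> y" by (simp_all add: x_def y_def)
  have "x \<le> x * x" "y \<le> y * y" using pos by (simp_all add: mult_le_cancel_left1)
  then have "x + y \<le> 2 * (real r + 3)" using sq by simp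
  then have "1 / (real r + 3) \<le> 2 / (x + y)" using pos by (simp add: field_simps)
  moreover have "(y - x) * (x + y) = 1" using sq by (simp add: algebra_simps)
  then have "y - x = 1 / (x + y)" using pos by (simp add: eq_divide_eq)
  ultimately have "1 / (real r + 3) \<le> 2 * (y - x)" by simp
  then show ?case using Suc excess_step_le[of r] unfolding excess_Suc x_def y_def by (simp add: add.commute)
qed (simp add: excess_0)

lemma excess_upper: "excess r \<le> 4 + ln (real r + 2)"
proof (induction r)
  case (Suc r)
  have "1 / (real r + 3) \<le> ln (real r + 3) - ln (real r + 2)"
  proof -
    have "ln ((real r + 2) / (real r + 3)) \<le> (real r + 2) / (real r + 3) - 1"
      by (rule ln_le_minus_one) simp
    also have "\<dots> = - (1 / (real r + 3))" by (simp add: field_simps)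
    finally show ?thesis by (simp add: ln_div)
  qed
  then show ?case using Suc excess_step_le[of r] unfolding excess_Suc by (simp add: algebra_simps)
qed (simp add: excess_0)

text \<open>By the square root bound the increments fall short of \<open>1 / (r + 3)\<close> by
  order \<open>r powr (-3/2)\<close>, which is summable. The decrements of
  \<open>4 / sqrt (r + 2)\<close> pay for these errors one by one.\<close>

lemma excess_lower: "ln (real r + 3) + 4 / sqrt (real r + 2) - ln 3 \<le> excess r"
proof (induction r)
  case 0
  have "4 / sqrt 2 \<le> (4::real)" by (simp add: divide_le_eq)
  then show ?case by (simp add: excess_0)
next
  case (Suc r)
  define s where "s = 1 / q_seq r"
  define x where "x = sqrt (real r + 2)"
  define y where "y = sqrt (real r + 3)"
  have s: "real r + 4 \<le> s" unfolding s_def by (rule recip_q_ge)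
  have sq: "x * x = real r + 2" "y * y = real r + 3" by (simp_all add: x_def y_def)
  have xy: "1 \<le> x" "x \<le> y" by (simp_all add: x_def y_def)
  have l: "ln (real r + 4) - ln (real r + 3) \<le> 1 / (real r + 3)"
  proof -
    have "ln ((real r + 4) / (real r + 3)) \<le> (real r + 4) / (real r + 3) - 1"
      by (rule ln_le_minus_one) simp
    also have "\<dots> = 1 / (real r + 3)" by (simp add: field_simps)
    finally show ?thesis by (simp add: ln_div)
  qed
  have "1 / (real r + 3) - 1 / (s - 1) = (s - real r - 4) / ((real r + 3) * (s - 1))"
    using s by (simp add: field_simps)
  also have "\<dots> \<le> 2 * x / ((real r + 3) * (real r + 3))"
  proof (rule frac_le)
    have "s - real r - 4 \<le> 2 * sqrt (real r + 1)" using excess_sqrt[of r] by (simp add: excess_def s_def)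
    also have "\<dots> \<le> 2 * x" by (simp add: x_def)
    finally show "s - real r - 4 \<le> 2 * x" .
    show "(real r + 3) * (real r + 3) \<le> (real r + 3) * (s - 1)" using s by (intro mult_left_mono) auto
  qed (use xy in auto)
  also have "\<dots> \<le> 4 / x - 4 / y"
  proof -
    have "(y - x) * (x + y) = 1" using sq by (simp add: algebra_simps)
    then have yx: "y - x = 1 / (x + y)" using xy by (simp add: eq_divide_eq)
    have "4 / x - 4 / y = 4 * (y - x) / (x * y)" using xy by (simp add: field_simps)
    then have "4 / x - 4 / y = 4 / (x * y * (x + y))" unfolding yx by simp
    moreover have "2 * x / (y * y * (y * y)) \<le> 4 / (x * y * (x + y))"
    proof -
      have "2 * x * (x * y * (x + y)) = 2 * (x * x) * (y * (x + y))" by (simp add: algebra_simps)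
      also have "\<dots> \<le> 2 * (y * y) * (y * (y + y))"
        using xy by (intro mult_mono add_mono) auto
      also have "\<dots> = 4 * (y * y * (y * y))" by (simp add: algebra_simps)
      finally have le: "2 * x * (x * y * (x + y)) \<le> 4 * (y * y * (y * y))" .
      have "0 < x * y * (x + y)" "0 < y * y * (y * y)" using xy by (auto intro!: mult_pos_pos)
      then show ?thesis using le by (simp only: pos_divide_le_eq pos_le_divide_eq times_divide_eq_left)
    qed
    ultimately show ?thesis by (simp add: sq)
  qed
  finally have "1 / (real r + 3) - 1 / (s - 1) \<le> 4 / x - 4 / y" .
  then show ?case using Suc l unfolding excess_Suc s_def[symmetric] x_def y_def by (simp add: algebra_simps)
qed

lemma q_seq_le: "2 \<le> m \<Longrightarrow> q_seq (m - 2) \<le> 1 / (real m + 2)"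
proof -
  assume m: "2 \<le> m"
  have "real m + 2 \<le> 1 / q_seq (m - 2)" using recip_q_ge[of "m - 2"] m by simp
  then show ?thesis using q_seq_bounds(1)[of "m - 2"] by (simp add: field_simps)
qed

lemma q_seq_asymptotic:
  "\<exists>e :: nat \<Rightarrow> real. e \<in> O(\<lambda>_. 1) \<and>
     (\<forall>\<^sub>F m in at_top. q_seq (m - 2) = 1 / (real m + ln (real m) + e m))"
proof (intro exI conjI)
  define e where "e m = 1 / q_seq (m - 2) - real m - ln (real m)" for m
  have b: "\<bar>e m\<bar> \<le> 4" if m: "2 \<le> m" for m
  proof -
    define r where "r = m - 2"
    have mr: "real m = real r + 2" using m by (simp add: r_def)
    have e: "e m = excess r - 2 - ln (real r + 2)" unfolding e_def excess_def mr by (simp add: r_def)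
    have "ln (3::real) \<le> 2" using ln_le_minus_one[of "3::real"] by simp
    moreover have "ln (real r + 2) \<le> ln (real r + 3)" by simp
    moreover have "0 \<le> 4 / sqrt (real r + 2)" by simp
    ultimately show ?thesis using excess_upper[of r] excess_lower[of r] unfolding e by linarith
  qed
  have "eventually (\<lambda>m. norm (e m) \<le> 4 * norm (1::real)) at_top"
    using eventually_ge_at_top[of 2] by eventually_elim (use b in auto)
  then show "e \<in> O(\<lambda>_. 1)" by (rule landau_o.bigI[rotated]) simp
  show "\<forall>\<^sub>F m in at_top. q_seq (m - 2) = 1 / (real m + ln (real m) + e m)"
    by (simp add: e_def)
qed

lemma c_star_theta: "c_star \<in> \<Theta>(\<lambda>m. 1 / real m)" "C_opt \<in> \<Theta>(\<lambda>m. real m)"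
proof -
  have lo: "1 / (1080 * real m) \<le> c_star m" and up: "c_star m \<le> 1 / real m" if m: "2 \<le> m" for m
  proof -
    show "1 / (1080 * real m) \<le> c_star m" by (rule c_star_lower[OF m])
    have "c_star m \<le> 1 / (real m + 2)" using c_star_upper[OF m] q_seq_le[OF m] by simp
    also have "\<dots> \<le> 1 / real m" using m by (intro divide_left_mono) auto
    finally show "c_star m \<le> 1 / real m" .
  qed
  have pos: "0 < c_star m" if m: "2 \<le> m" for m
    by (rule less_le_trans[OF _ lo[OF m]]) (use m in simp)
  have big: "eventually (\<lambda>m. 2 \<le> m) (at_top :: nat filter)" by (rule eventually_ge_at_top)
  show "c_star \<in> \<Theta>(\<lambda>m. 1 / real m)"
  proof (rule bigthetaI)
    show "c_star \<in> O(\<lambda>m. 1 / real m)"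
    proof (rule landau_o.bigI[of 1])
      show "\<forall>\<^sub>F m in at_top. norm (c_star m) \<le> 1 * norm (1 / real m)"
        using big by eventually_elim (use up pos in \<open>auto simp: less_imp_le\<close>)
    qed simp
    show "c_star \<in> \<Omega>(\<lambda>m. 1 / real m)"
    proof (rule landau_omega.bigI[of "1 / 1080"])
      show "\<forall>\<^sub>F m in at_top. 1 / 1080 * norm (1 / real m) \<le> norm (c_star m)"
        using big by eventually_elim (use lo pos in \<open>auto simp: less_imp_le\<close>)
    qed simp
  qed
  show "C_opt \<in> \<Theta>(\<lambda>m. real m)"
  proof (rule bigthetaI)
    show "C_opt \<in> O(\<lambda>m. real m)"
    proof (rule landau_o.bigI[of 1080])
      show "\<forall>\<^sub>F m in at_top. norm (C_opt m) \<le> 1080 * norm (real m)"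
        using big
      proof eventually_elim
        case (elim m)
        have "inverse (c_star m) \<le> inverse (1 / (1080 * real m))"
          using elim by (intro le_imp_inverse_le lo) auto
        then show ?case using pos[OF elim] by (simp add: C_opt_def)
      qed
    qed simp
    show "C_opt \<in> \<Omega>(\<lambda>m. real m)"
    proof (rule landau_omega.bigI[of 1])
      show "\<forall>\<^sub>F m in at_top. 1 * norm (real m) \<le> norm (C_opt m)"
        using big
      proof eventually_elim
        case (elim m)
        have "inverse (1 / real m) \<le> inverse (c_star m)"
          by (intro le_imp_inverse_le up pos elim)
        then show ?case using pos[OF elim] by (simp add: C_opt_def)
      qed
    qed simp
  qed
qed

theorem theorem1p1:
  shows "(\<forall>m\<ge>2. 1 / (1080 * real m) \<le> c_star m \<and> c_star m \<le> q_seq (m - 2))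
    \<and> (\<forall>m\<ge>2. q_seq (m - 2) \<le> 1 / (real m + 2))
    \<and> (\<exists>e :: nat \<Rightarrow> real. e \<in> O(\<lambda>_. 1) \<and>
         (\<forall>\<^sub>F m in at_top. q_seq (m - 2) = 1 / (real m + ln (real m) + e m)))
    \<and> c_star \<in> \<Theta>(\<lambda>m. 1 / real m)
    \<and> C_opt \<in> \<Theta>(\<lambda>m. real m)"
  using c_star_lower c_star_upper q_seq_le q_seq_asymptotic c_star_theta by blast

end
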